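(* Let $\kappa>0$, let $\mathcal U\subset\mathbb R^3$ be an exterior region, and let $\psi$ be a radiation solution of the Helmholtz equation $-\Delta\psi=\kappa^2\psi$ in $\mathcal U$. Let $L=L_{x_0,\theta}$, with $x_0\in\mathbb R^3$ and $\theta\in\mathbb S^2$, be a ray such that $L\subset\mathcal U$, and let $\Lambda$ be an arbitrary non-empty open interval of $L$. Then $\psi$ on $L$ is uniquely determined by $\operatorname{Im}\psi$ on $\Lambda$. That is, if $\psi_1,\psi_2$ are two radiation solutions in $\mathcal U$ (for the same $\kappa$) and $\operatorname{Im}\psi_1=\operatorname{Im}\psi_2$ on $\Lambda$, then $\psi_1=\psi_2$ on $L$.
   Context: An exterior region $\mathcal U$ in $\mathbb R^3$ is an open unbounded connected set consisting of all points in the exterior of a closed bounded regular surface $S$. A radiation solution in $\mathcal U$ is a complex-valued function $\psi$, of class $C^2$ in the closure of $\mathcal U$, satisfying $-\Delta\psi(x)=\kappa^2\psi(x)$ for $x\in\mathcal U$ and the Sommerfeld radiation condition $|x|\left(\frac{\partial}{\partial|x|}-i\kappa\right)\psi(x)\to0$ as $|x|\to+\infty$, uniformly in $x/|x|$. $\mathbb S^2$ is the unit sphere in $\mathbb R^3$. The ray $L_{x_0,\theta}$ is $\{x\in\mathbb R^3: x=x_0+s\theta,\ 0<s<+\infty\}$. *)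

theory Defs
  imports "HOL-Analysis.Analysis"
begin

text \<open>A regular surface in the usual sense of differential geometry: locally the homeomorphic
  image of an open subset of the plane under an immersion.  Only \<open>C\<^sup>1\<close> parametrisations are
  required, so regular surfaces of class \<open>C\<^sup>k\<close> or \<open>C\<^sup>\<infinity>\<close> are included.\<close>

definition regular_surface :: "(real^3) set \<Rightarrow> bool" where
  "regular_surface S \<longleftrightarrow>
     (\<forall>p\<in>S. \<exists>(V :: (real^3) set) (W :: (real^2) set) f g (f' :: real^2 \<Rightarrow> (real^2) \<Rightarrow>\<^sub>L (real^3)).
        open V \<and> p \<in> V \<and> open W \<and> homeomorphism W (V \<inter> S) f g \<and>
        (\<forall>u\<in>W. (f has_derivative blinfun_apply (f' u)) (at u)) \<and>
        continuous_on W f' \<and>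
        (\<forall>u\<in>W. inj (blinfun_apply (f' u))))"

text \<open>\<^term>\<open>outside S\<close> is the union of the unbounded components of the complement of \<open>S\<close>; for
  bounded \<open>S\<close> it is automatically the unique such component.\<close>

definition exterior_region :: "(real^3) set \<Rightarrow> bool" where
  "exterior_region U \<longleftrightarrow>
     open U \<and> \<not> bounded U \<and> connected U \<and>
     (\<exists>S. S \<noteq> {} \<and> closed S \<and> bounded S \<and> regular_surface S \<and> U = outside S)"

definition directional_deriv ::
    "'a::real_normed_vector \<Rightarrow> ('a \<Rightarrow> 'b::real_normed_vector) \<Rightarrow> 'a \<Rightarrow> 'b" where
  "directional_deriv v f x = vector_derivative (\<lambda>t. f (x + t *\<^sub>R v)) (at 0)"

definition laplacian :: "('a::euclidean_space \<Rightarrow> 'b::real_normed_vector) \<Rightarrow> 'a \<Rightarrow> 'b" where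
  "laplacian f x = (\<Sum>b\<in>Basis. directional_deriv b (directional_deriv b f) x)"

text \<open>Class \<open>C\<^sup>2\<close> in the closure of the open set \<open>U\<close>: \<open>f\<close> is \<open>C\<^sup>2\<close> in \<open>U\<close>, and \<open>f\<close> and its
  derivatives of order at most two extend continuously to the closure.  \<open>D1\<close> and \<open>D2\<close> are the first
  two derivatives in \<open>U\<close> and these extensions on the boundary.\<close>

definition C2_on_closure ::
    "'a::euclidean_space set \<Rightarrow> ('a \<Rightarrow> 'b::real_normed_vector) \<Rightarrow> bool" where
  "C2_on_closure U f \<longleftrightarrow>
     continuous_on (closure U) f \<and>
     (\<exists>(D1 :: 'a \<Rightarrow> 'a \<Rightarrow>\<^sub>L 'b) (D2 :: 'a \<Rightarrow> 'a \<Rightarrow>\<^sub>L 'a \<Rightarrow>\<^sub>L 'b).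
        continuous_on (closure U) D1 \<and> continuous_on (closure U) D2 \<and>
        (\<forall>x\<in>U. (f has_derivative blinfun_apply (D1 x)) (at x) \<and>
                (D1 has_derivative blinfun_apply (D2 x)) (at x)))"

text \<open>Here \<open>x = r \<omega>\<close> with \<open>r\<close> the modulus of \<open>x\<close>, and the radial derivative at \<open>x\<close> is the derivative
  in the direction \<open>\<omega>\<close>.\<close>

definition sommerfeld_radiation :: "real \<Rightarrow> (real^3 \<Rightarrow> complex) \<Rightarrow> bool" where
  "sommerfeld_radiation \<kappa> \<psi> \<longleftrightarrow>
     uniform_limit (sphere 0 1)
       (\<lambda>r \<omega>. of_real r * (directional_deriv \<omega> \<psi> (r *\<^sub>R \<omega>) - \<i> * of_real \<kappa> * \<psi> (r *\<^sub>R \<omega>)))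
       (\<lambda>\<omega>. 0) at_top"

definition radiation_solution :: "real \<Rightarrow> (real^3) set \<Rightarrow> (real^3 \<Rightarrow> complex) \<Rightarrow> bool" where
  "radiation_solution \<kappa> U \<psi> \<longleftrightarrow>
     C2_on_closure U \<psi> \<and>
     (\<forall>x\<in>U. - laplacian \<psi> x = of_real (\<kappa>\<^sup>2) * \<psi> x) \<and>
     sommerfeld_radiation \<kappa> \<psi>"

definition ray :: "'a::real_vector \<Rightarrow> 'a \<Rightarrow> 'a set" where
  "ray x\<^sub>0 \<theta> = {x\<^sub>0 + s *\<^sub>R \<theta> | s. 0 < s}"

text \<open>Intervals may be bounded or unbounded.\<close>

definition open_interval_of_ray :: "'a::real_vector \<Rightarrow> 'a \<Rightarrow> 'a set \<Rightarrow> bool" where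
  "open_interval_of_ray x\<^sub>0 \<theta> \<Lambda> \<longleftrightarrow>
     (\<exists>I :: real set. I \<subseteq> {0<..} \<and> open I \<and> is_interval I \<and> \<Lambda> = (\<lambda>s. x\<^sub>0 + s *\<^sub>R \<theta>) ` I)"

end

theory Submission
  imports Defs "HOL-Complex_Analysis.Complex_Analysis"
begin

text \<open>The difference of the two solutions is again a radiation solution \<open>\<psi>\<close>.  Multiplied by a cutoff,
  \<open>\<psi>\<close> becomes a \<open>C\<^sup>2\<close> function \<open>v\<close> on the whole space for which \<open>f = (\<Delta> + \<kappa>\<^sup>2)v\<close> has compact support,
  and Green's formula represents \<open>v(x)\<close>, up to a constant, as the integral of
  \<open>f(y) e\<^sup>i\<^sup>\<kappa>\<^sup>|\<^sup>x\<^sup>-\<^sup>y\<^sup>| / |x - y|\<close>.  Along the ray the kernel is analytic in the parameter \<open>s\<close>, so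
  \<open>u(s) = \<psi>(x\<^sub>0 + s\<theta>)\<close> is real analytic and \<open>Im u\<close> vanishes for all \<open>s > 0\<close> as soon as it
  vanishes on an interval.  At infinity \<open>s e\<^sup>-\<^sup>i\<^sup>\<kappa>\<^sup>s u(s)\<close> is a holomorphic function \<open>H\<close> of \<open>1/s\<close>.  If
  \<open>H\<close> were not identically zero, the phase of \<open>u(s)\<close> would rotate like \<open>e\<^sup>i\<^sup>\<kappa>\<^sup>s\<close>, and \<open>u\<close> could not
  be real.  All integrals are volume integrals: instead of spheres, cutoffs
  \<open>\<eta>(y) = \<beta>(|y|\<^sup>2/R\<^sup>2)\<close> with \<open>R \<rightarrow> \<infinity>\<close> are used.\<close>

section \<open>Partial derivatives and the divergence theorem for compact support\<close>

text \<open>No decay of \<psi> is assumed beyond the Sommerfeld condition, so nothing obvious makes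
  the far boundary term of Green's formula small. The missing control comes from pairing v with its
  own conjugate: the flux through every large shell is the same number, and radiation makes it
  comparable to a weighted integral of |v|^2 over the shell, which is therefore bounded. The other
  obstacle is the pole of the kernel. Instead of excising a ball, |x - y| is replaced by sqrt(|x -
  y|^2 + \<epsilon>^2), so that the kernel is smooth everywhere; \<Delta> + \<kappa>^2 applied to it
  is an approximate identity, and \<epsilon> tends to 0 at a fixed cutoff radius. Two cutoffs occur
  because a representation valid only far out says nothing about the points of the ray near the
  surface: for analyticity at a point the source lies in a small shell around that point, for the
  behaviour at infinity it lies in a fixed ball.\<close>

definition has_pd :: "'a::real_normed_vector \<Rightarrow> ('a \<Rightarrow> 'b::real_normed_vector) \<Rightarrow> 'b \<Rightarrow> 'a \<Rightarrow> bool" where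
  "has_pd b f D x \<longleftrightarrow> ((\<lambda>t. f (x + t *\<^sub>R b)) has_vector_derivative D) (at 0)"

text \<open>Reparametrising the line by \<open>t - s\<close> moves the base point; this turns the
  pointwise notion into a derivative along a whole segment, as the mean value inequality
  requires.\<close>

lemma has_pd_at:
  assumes "\<And>x. has_pd b f (f' x) x"
  shows "((\<lambda>t. f (x + t *\<^sub>R b)) has_vector_derivative f' (x + s *\<^sub>R b)) (at s)"
proof -
  have "((\<lambda>t. f ((x + s *\<^sub>R b) + t *\<^sub>R b)) has_vector_derivative f' (x + s *\<^sub>R b)) (at (s - s))"
    using assms[of "x + s *\<^sub>R b"] unfolding has_pd_def by simp
  then have "((\<lambda>t. f ((x + s *\<^sub>R b) + t *\<^sub>R b)) \<circ> (\<lambda>t. t - s) has_vector_derivative 1 *\<^sub>R f' (x + s *\<^sub>R b)) (at s)"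
    by (intro vector_diff_chain_at) (auto intro!: derivative_eq_intros)
  moreover have "(\<lambda>t. f ((x + s *\<^sub>R b) + t *\<^sub>R b)) \<circ> (\<lambda>t. t - s) = (\<lambda>t. f (x + t *\<^sub>R b))"
    by (auto simp: fun_eq_iff algebra_simps)
  ultimately show ?thesis by simp
qed

lemma has_pd_const [simp]: "has_pd b (\<lambda>x. c) 0 x"
  unfolding has_pd_def by simp

lemma has_pd_add: "has_pd b f D x \<Longrightarrow> has_pd b g E x \<Longrightarrow> has_pd b (\<lambda>x. f x + g x) (D + E) x"
  unfolding has_pd_def by (rule has_vector_derivative_add)

lemma has_pd_diff: "has_pd b f D x \<Longrightarrow> has_pd b g E x \<Longrightarrow> has_pd b (\<lambda>x. f x - g x) (D - E) x"
  unfolding has_pd_def by (rule has_vector_derivative_diff)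

lemma has_pd_mult:
  fixes f g :: "'a::real_normed_vector \<Rightarrow> 'b::real_normed_algebra"
  shows "has_pd b f D x \<Longrightarrow> has_pd b g E x \<Longrightarrow> has_pd b (\<lambda>x. f x * g x) (f x * E + D * g x) x"
  unfolding has_pd_def by (drule (1) has_vector_derivative_mult) simp

lemma has_pd_bounded_linear:
  "bounded_linear L \<Longrightarrow> has_pd b f D x \<Longrightarrow> has_pd b (\<lambda>x. L (f x)) (L D) x"
  unfolding has_pd_def by (rule bounded_linear.has_vector_derivative)

lemma has_pd_chain:
  assumes "has_pd b r D x" "(F has_vector_derivative E) (at (r x))"
  shows "has_pd b (\<lambda>x. F (r x)) (D *\<^sub>R E) x"
  using vector_diff_chain_at[of "\<lambda>t. r (x + t *\<^sub>R b)" D 0 F E] assms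
  unfolding has_pd_def by (simp add: o_def)

lemma has_pd_cong_open:
  assumes "open S" "x \<in> S" "\<And>y. y \<in> S \<Longrightarrow> f y = g y" "has_pd b g D x"
  shows "has_pd b f D x"
proof -
  have "open ((\<lambda>t::real. x + t *\<^sub>R b) -` S)"
    by (intro open_vimage assms(1) continuous_intros)
  moreover have "0 \<in> (\<lambda>t::real. x + t *\<^sub>R b) -` S" using assms(2) by simp
  ultimately show ?thesis
    using assms(4) unfolding has_pd_def has_vector_derivative_def
    using has_derivative_transform_within_open[of "\<lambda>t. g (x + t *\<^sub>R b)" _ 0 UNIV
        "(\<lambda>t::real. x + t *\<^sub>R b) -` S" "\<lambda>t. f (x + t *\<^sub>R b)"]
    by (auto simp: assms(3))
qed

lemma has_pd_unique: "has_pd b f D x \<Longrightarrow> has_pd b f E x \<Longrightarrow> D = E"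
  unfolding has_pd_def by (rule vector_derivative_unique_at)

lemma has_pd_has_derivative:
  assumes "(f has_derivative f') (at x)"
  shows "has_pd b f (f' b) x"
proof -
  interpret bounded_linear f' using assms by (rule has_derivative_bounded_linear)
  have "(f \<circ> (\<lambda>t. x + t *\<^sub>R b) has_derivative f' \<circ> (\<lambda>t. t *\<^sub>R b)) (at 0)"
    by (rule diff_chain_at) (auto intro!: derivative_eq_intros simp: assms)
  then show ?thesis
    unfolding has_pd_def has_vector_derivative_def by (simp add: o_def scaleR)
qed

lemma has_pd_inner_self:
  fixes a :: "'a::real_inner"
  shows "has_pd b (\<lambda>y. (y - a) \<bullet> (y - a)) (2 * ((x - a) \<bullet> b)) x"
  unfolding has_pd_def has_vector_derivative_def
  by (auto intro!: derivative_eq_intros simp: inner_commute algebra_simps)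

lemma has_pd_inner:
  fixes a :: "'a::real_inner"
  shows "has_pd b (\<lambda>y. (y - a) \<bullet> c) (b \<bullet> c) x"
  unfolding has_pd_def has_vector_derivative_def
  by (auto intro!: derivative_eq_intros simp: inner_commute algebra_simps)

section \<open>Integrals of continuous functions with compact support\<close>

lemma integrable_continuous_compact_support:
  fixes h :: "'a::euclidean_space \<Rightarrow> 'b::{banach, second_countable_topology}"
  assumes "continuous_on UNIV h" "\<And>x. norm x > A \<Longrightarrow> h x = 0"
  shows "integrable lborel h"
proof -
  have "integrable lborel (\<lambda>x. indicator (cball 0 A) x *\<^sub>R h x)"
    by (intro borel_integrable_compact continuous_on_subset[OF assms(1)]) auto
  moreover have "(\<lambda>x. indicator (cball 0 A) x *\<^sub>R h x) = h"
    using assms(2) by (auto simp: fun_eq_iff indicator_def not_le)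
  ultimately show ?thesis by simp
qed

lemma bounded_continuous_compact_support:
  fixes h :: "'a::euclidean_space \<Rightarrow> 'b::real_normed_vector"
  assumes "continuous_on UNIV h" "\<And>x. norm x > A \<Longrightarrow> h x = 0"
  obtains B where "B > 0" "\<And>x. norm (h x) \<le> B"
proof -
  have "compact (h ` cball 0 A)"
    by (intro compact_continuous_image continuous_on_subset[OF assms(1)]) auto
  then obtain B where "B > 0" "\<And>y. y \<in> h ` cball 0 A \<Longrightarrow> norm y \<le> B"
    using compact_imp_bounded bounded_pos by metis
  then have "norm (h x) \<le> B" for x
    by (cases "norm x \<le> A") (use assms(2)[of x] in auto)
  with \<open>B > 0\<close> that show ?thesis by blast
qed

lemma integral_translate:
  fixes h :: "'a::euclidean_space \<Rightarrow> 'b::{banach, second_countable_topology}"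
  assumes "h \<in> borel_measurable borel"
  shows "integral\<^sup>L lborel (\<lambda>x. h (x + a)) = integral\<^sup>L lborel h"
proof -
  have "integral\<^sup>L lborel h = integral\<^sup>L (distr lborel borel ((+) a)) h"
    by (simp add: lborel_distr_plus)
  also have "\<dots> = integral\<^sup>L lborel (\<lambda>x. h (a + x))"
    by (rule integral_distr) (use assms in auto)
  finally show ?thesis by (simp add: add.commute)
qed

text \<open>The difference quotients have integral \<open>0\<close> by translation invariance.\<close>

lemma integral_pd_eq_0:
  fixes h :: "'a::euclidean_space \<Rightarrow> 'b::{banach, second_countable_topology}"
  assumes c: "continuous_on UNIV h" "continuous_on UNIV h'"
    and pd: "\<And>x. has_pd b h (h' x) x"
    and z: "\<And>x. norm x > A \<Longrightarrow> h x = 0"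
  shows "integral\<^sup>L lborel h' = 0"
proof -
  \<comment> \<open>The region \<open>norm x > A\<close> is open and \<open>h\<close> is identically
    0 on it, so the derivative vanishes there too.\<close>
  have z': "h' x = 0" if "norm x > A" for x
  proof -
    have "has_pd b h 0 x"
      by (rule has_pd_cong_open[of "- cball 0 A" _ _ "\<lambda>_. 0"]) (use that z in auto)
    with pd show ?thesis using has_pd_unique by blast
  qed
  obtain B where B: "B > 0" "\<And>x. norm (h' x) \<le> B"
    using bounded_continuous_compact_support[OF c(2) z'] by blast
  define q where "q = (\<lambda>n x. (real (Suc n)) *\<^sub>R (h (x + (1 / real (Suc n)) *\<^sub>R b) - h x))"
  have ih: "integrable lborel h"
    by (rule integrable_continuous_compact_support[OF c(1) z])
  have bh: "h \<in> borel_measurable borel" "h' \<in> borel_measurable borel"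
    using c borel_measurable_continuous_onI by blast+
  \<comment> \<open>Shifts by \<open>d *\<^sub>R b\<close> with \<open>0 \<le> d \<le> 1\<close>
    move the support by at most \<open>norm b\<close>, so all difference quotients vanish outside
    this one ball.\<close>
  define C where "C = A + norm b"
  have ihs: "integrable lborel (\<lambda>x. h (x + d *\<^sub>R b))" if "0 \<le> d" "d \<le> 1" for d
  proof (rule integrable_continuous_compact_support[of _ C])
    show "continuous_on UNIV (\<lambda>x. h (x + d *\<^sub>R b))"
      by (intro continuous_on_compose2[OF c(1)] continuous_intros) auto
    fix x :: 'a assume "norm x > C"
    moreover have "norm x \<le> norm (x + d *\<^sub>R b) + norm (d *\<^sub>R b)"
      by (metis add_diff_cancel norm_triangle_ineq4)
    moreover have "norm (d *\<^sub>R b) \<le> norm b"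
      using that by (simp add: mult_left_le_one_le)
    ultimately show "h (x + d *\<^sub>R b) = 0" by (intro z) (auto simp: C_def)
  qed
  have q0: "integral\<^sup>L lborel (q n) = 0" for n
  proof -
    have "integral\<^sup>L lborel (q n) = (real (Suc n)) *\<^sub>R (integral\<^sup>L lborel (\<lambda>x. h (x + (1 / real (Suc n)) *\<^sub>R b)) - integral\<^sup>L lborel h)"
      unfolding q_def using ih ihs[of "1 / real (Suc n)"] by simp
    also have "\<dots> = 0" using integral_translate[OF bh(1)] by simp
    finally show ?thesis .
  qed
  have lim: "(\<lambda>n. q n x) \<longlonglongrightarrow> h' x" for x
  proof -
    have "((\<lambda>t. h (x + t *\<^sub>R b)) has_vector_derivative h' x) (at 0)"
      using pd unfolding has_pd_def .
    then have "(\<lambda>t. norm (h (x + t *\<^sub>R b) - h x - t *\<^sub>R h' x) / norm t) \<midarrow>0\<rightarrow> 0"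
      unfolding has_vector_derivative_def has_derivative_at by simp
    moreover have "filterlim (\<lambda>n. 1 / real (Suc n)) (at 0) sequentially"
      using LIMSEQ_inverse_real_of_nat
      by (auto simp: filterlim_at inverse_eq_divide simp del: of_nat_Suc)
    ultimately have "(\<lambda>n. norm (h (x + (1 / real (Suc n)) *\<^sub>R b) - h x - (1 / real (Suc n)) *\<^sub>R h' x) / norm (1 / real (Suc n))) \<longlonglongrightarrow> 0"
      by (rule filterlim_compose)
    moreover have "norm (h (x + (1 / real (Suc n)) *\<^sub>R b) - h x - (1 / real (Suc n)) *\<^sub>R h' x) / norm (1 / real (Suc n))
        = norm (q n x - h' x)" for n
    proof -
      define m where "m = real (Suc n)"
      have m: "m > 0" by (simp add: m_def)
      have "q n x - h' x = m *\<^sub>R (h (x + (1 / m) *\<^sub>R b) - h x - (1 / m) *\<^sub>R h' x)"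
        using m unfolding q_def m_def[symmetric] by (simp add: scaleR_diff_right)
      then show ?thesis using m unfolding m_def[symmetric] by simp
    qed
    ultimately show ?thesis
      by (simp add: tendsto_norm_zero_iff LIM_zero_iff)
  qed
  \<comment> \<open>The mean value inequality along the segment from x to x + d b bounds the
    quotient by B for every n. This is the majorant for dominated convergence.\<close>
  have bd: "norm (q n x) \<le> B * indicator (cball 0 C) x" for n x
  proof -
    define d where "d = 1 / real (Suc n)"
    have d: "0 < d" "d \<le> 1" by (auto simp: d_def)
    have qd: "q n x = (1 / d) *\<^sub>R (h (x + d *\<^sub>R b) - h x)" by (simp add: q_def d_def)
    show ?thesis
    proof (cases "norm x \<le> C")
      case True
      have "norm (h (x + d *\<^sub>R b) - h (x + 0 *\<^sub>R b)) \<le> B * norm (d - 0)"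
      proof (rule differentiable_bound[of UNIV "\<lambda>t. h (x + t *\<^sub>R b)" "\<lambda>s t. t *\<^sub>R h' (x + s *\<^sub>R b)"])
        fix s :: real
        show "((\<lambda>t. h (x + t *\<^sub>R b)) has_derivative (\<lambda>t. t *\<^sub>R h' (x + s *\<^sub>R b))) (at s within UNIV)"
          using has_pd_at[OF pd] by (simp add: has_vector_derivative_def)
        show "onorm (\<lambda>t. t *\<^sub>R h' (x + s *\<^sub>R b)) \<le> B"
          by (rule onorm_bound) (use B in \<open>auto simp: mult.commute[of B] intro: mult_left_mono less_imp_le\<close>)
      qed auto
      then have "norm (q n x) \<le> B" unfolding qd norm_scaleR using d by (simp add: field_simps)
      then show ?thesis using True by (simp add: indicator_def)
    next
      case False
      have "norm x \<le> norm (x + d *\<^sub>R b) + norm (d *\<^sub>R b)"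
        by (metis add_diff_cancel norm_triangle_ineq4)
      moreover have "norm (d *\<^sub>R b) \<le> norm b"
        using d by (simp add: mult_left_le_one_le)
      ultimately have "norm (x + d *\<^sub>R b) > A" "norm x > A"
        using False norm_ge_zero[of b] unfolding C_def by linarith+
      then show ?thesis using False by (simp add: qd z indicator_def)
    qed
  qed
  have "(\<lambda>n. integral\<^sup>L lborel (q n)) \<longlonglongrightarrow> integral\<^sup>L lborel h'"
  proof (rule integral_dominated_convergence)
    show "integrable lborel (\<lambda>x. B * indicator (cball 0 C) x :: real)"
      using emeasure_lborel_cball_finite[of 0 C]
      by (intro integrable_mult_right integrable_real_indicator) auto
  qed (use lim bd bh in \<open>auto simp: q_def\<close>)
  then show ?thesis using q0 LIMSEQ_unique by (simp add: LIMSEQ_const_iff)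
qed

section \<open>Twice differentiable functions and Green's formula\<close>

text \<open>The derivatives are carried as explicit functions indexed by basis vectors;
  \<open>f2 b\<close> is the pure second derivative along \<open>b\<close>, which is what the
  Laplacian sums. Product and cutoff rules thereby become formulas for \<open>f1\<close> and
  \<open>f2\<close>.\<close>

definition C2_data :: "'a::euclidean_space set \<Rightarrow> ('a \<Rightarrow> 'b::real_normed_vector) \<Rightarrow> ('a \<Rightarrow> 'a \<Rightarrow> 'b) \<Rightarrow> ('a \<Rightarrow> 'a \<Rightarrow> 'b) \<Rightarrow> bool" where
  "C2_data S f f1 f2 \<longleftrightarrow> continuous_on S f \<and>
     (\<forall>b\<in>Basis. continuous_on S (f1 b) \<and> continuous_on S (f2 b) \<and>
        (\<forall>x\<in>S. has_pd b f (f1 b x) x \<and> has_pd b (f1 b) (f2 b x) x))"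

definition helmholtz :: "real \<Rightarrow> ('a::euclidean_space \<Rightarrow> complex) \<Rightarrow> ('a \<Rightarrow> 'a \<Rightarrow> complex) \<Rightarrow> 'a \<Rightarrow> complex" where
  "helmholtz \<kappa> f f2 x = (\<Sum>b\<in>Basis. f2 b x) + of_real (\<kappa>\<^sup>2) * f x"

lemma C2_dataD:
  assumes "C2_data S f f1 f2"
  shows "continuous_on S f" "b \<in> Basis \<Longrightarrow> continuous_on S (f1 b)" "b \<in> Basis \<Longrightarrow> continuous_on S (f2 b)"
    "b \<in> Basis \<Longrightarrow> x \<in> S \<Longrightarrow> has_pd b f (f1 b x) x" "b \<in> Basis \<Longrightarrow> x \<in> S \<Longrightarrow> has_pd b (f1 b) (f2 b x) x"
  using assms unfolding C2_data_def by auto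

lemma C2_data_cnj:
  assumes "C2_data S f f1 f2"
  shows "C2_data S (\<lambda>x. cnj (f x)) (\<lambda>b x. cnj (f1 b x)) (\<lambda>b x. cnj (f2 b x))"
  unfolding C2_data_def
  using C2_dataD[OF assms]
  by (auto intro!: continuous_intros has_pd_bounded_linear[OF bounded_linear_cnj])

lemma continuous_on_helmholtz:
  assumes "C2_data S f f1 f2"
  shows "continuous_on S (helmholtz \<kappa> f f2)"
  unfolding helmholtz_def
  by (intro continuous_intros C2_dataD[OF assms])

lemma C2_data_mult:
  fixes f g :: "'a::euclidean_space \<Rightarrow> 'b::real_normed_algebra"
  assumes f: "C2_data S f f1 f2" and g: "C2_data S g g1 g2"
  shows "C2_data S (\<lambda>x. f x * g x) (\<lambda>b x. f x * g1 b x + f1 b x * g x)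
     (\<lambda>b x. (f x * g2 b x + f1 b x * g1 b x) + (f1 b x * g1 b x + f2 b x * g x))"
  unfolding C2_data_def using C2_dataD[OF f] C2_dataD[OF g]
  by (auto intro!: continuous_intros has_pd_mult has_pd_add)

text \<open>The divergence theorem for the field \<open>\<eta> (K \<nabla>v - v \<nabla>K)\<close>.\<close>

lemma green_cutoff:
  fixes v K \<eta> :: "'a::euclidean_space \<Rightarrow> complex"
  assumes v: "C2_data UNIV v v1 v2" and K: "C2_data UNIV K K1 K2"
    and \<eta>: "continuous_on UNIV \<eta>" "\<And>b. b \<in> Basis \<Longrightarrow> continuous_on UNIV (\<eta>1 b)"
      "\<And>b x. b \<in> Basis \<Longrightarrow> has_pd b \<eta> (\<eta>1 b x) x"
    and z: "\<And>x. norm x > A \<Longrightarrow> \<eta> x = 0" "\<And>b x. b \<in> Basis \<Longrightarrow> norm x > A \<Longrightarrow> \<eta>1 b x = 0"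
  shows "integral\<^sup>L lborel (\<lambda>x. \<eta> x * (K x * helmholtz \<kappa> v v2 x - v x * helmholtz \<kappa> K K2 x))
      = - integral\<^sup>L lborel (\<lambda>x. \<Sum>b\<in>Basis. \<eta>1 b x * (K x * v1 b x - v x * K1 b x))"
proof -
  \<comment> \<open>\<open>h' b\<close> is the derivative along \<open>b\<close> of
    \<open>\<eta> * (K * v1 b - v * K1 b)\<close>: the products \<open>v1 b * K1 b\<close> cancel.
    After summation over the basis the two \<kappa>^2 terms may be added, because they cancel as
    well.\<close>
  define h' where "h' = (\<lambda>b x. \<eta> x * (K x * v2 b x - v x * K2 b x) + \<eta>1 b x * (K x * v1 b x - v x * K1 b x))"
  have h'_int: "integrable lborel (h' b)" "integral\<^sup>L lborel (h' b) = 0" if b: "b \<in> Basis" for b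
  proof -
    note c = C2_dataD[OF v] C2_dataD[OF K] \<eta>
    have ch': "continuous_on UNIV (h' b)"
      unfolding h'_def by (intro continuous_intros c b)
    show "integrable lborel (h' b)"
      by (rule integrable_continuous_compact_support[OF ch', of A]) (simp add: h'_def z b)
    show "integral\<^sup>L lborel (h' b) = 0"
    proof (rule integral_pd_eq_0[OF _ ch', where A=A])
      show "continuous_on UNIV (\<lambda>x. \<eta> x * (K x * v1 b x - v x * K1 b x))"
        by (intro continuous_intros c b)
      fix x
      have "has_pd b (\<lambda>x. \<eta> x * (K x * v1 b x - v x * K1 b x))
         (\<eta> x * ((K x * v2 b x + K1 b x * v1 b x) - (v x * K2 b x + v1 b x * K1 b x)) + \<eta>1 b x * (K x * v1 b x - v x * K1 b x)) x"
        by (intro has_pd_mult has_pd_diff c b UNIV_I)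
      then show "has_pd b (\<lambda>x. \<eta> x * (K x * v1 b x - v x * K1 b x)) (h' b x) x"
        by (simp add: h'_def algebra_simps)
    qed (simp add: z)
  qed
  have i1: "integrable lborel (\<lambda>x. \<eta> x * (K x * helmholtz \<kappa> v v2 x - v x * helmholtz \<kappa> K K2 x))"
    by (rule integrable_continuous_compact_support[of _ A])
       (auto intro!: continuous_intros C2_dataD[OF v] C2_dataD[OF K] \<eta> continuous_on_helmholtz[OF v] continuous_on_helmholtz[OF K] simp: z)
  have i2: "integrable lborel (\<lambda>x. \<Sum>b\<in>Basis. \<eta>1 b x * (K x * v1 b x - v x * K1 b x))"
    by (rule integrable_continuous_compact_support[of _ A])
       (auto intro!: continuous_intros C2_dataD[OF v] C2_dataD[OF K] \<eta> simp: z)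
  have "(\<Sum>b\<in>Basis. h' b x) = \<eta> x * (K x * helmholtz \<kappa> v v2 x - v x * helmholtz \<kappa> K K2 x)
        + (\<Sum>b\<in>Basis. \<eta>1 b x * (K x * v1 b x - v x * K1 b x))" for x
    unfolding h'_def helmholtz_def sum.distrib
    by (simp add: sum_distrib_left sum_subtractf algebra_simps)
  then have "integral\<^sup>L lborel (\<lambda>x. \<eta> x * (K x * helmholtz \<kappa> v v2 x - v x * helmholtz \<kappa> K K2 x))
       + integral\<^sup>L lborel (\<lambda>x. \<Sum>b\<in>Basis. \<eta>1 b x * (K x * v1 b x - v x * K1 b x))
      = integral\<^sup>L lborel (\<lambda>x. \<Sum>b\<in>Basis. h' b x)"
    using i1 i2 by simp
  also have "\<dots> = 0" using h'_int by simp
  finally show ?thesis by (simp add: add_eq_0_iff)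
qed

section \<open>Cutoff functions\<close>

text \<open>The exponent is at least 2 so that both halves meet at 0 with slope 0: the difference
  quotient there is \<open>max 0 h ^ Suc n\<close>.\<close>

lemma has_real_derivative_pos_part_power:
  "((\<lambda>t. max 0 t ^ Suc (Suc n)) has_real_derivative real (Suc (Suc n)) * max 0 t ^ Suc n) (at (t::real))"
proof (cases t "0::real" rule: linorder_cases)
  case less
  have "((\<lambda>t. 0) has_real_derivative 0) (at t)" by simp
  then have "((\<lambda>t. max 0 t ^ Suc (Suc n)) has_real_derivative 0) (at t)"
    by (rule has_field_derivative_transform_within_open[of _ _ _ "{..<0}" ]) (use less in auto)
  then show ?thesis using less by simp
next
  case equal
  have "(\<lambda>h::real. max 0 h ^ Suc n) \<midarrow>0\<rightarrow> max 0 0 ^ Suc n"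
    by (intro tendsto_intros)
  then have "(\<lambda>h::real. max 0 h ^ Suc n) \<midarrow>0\<rightarrow> 0" by simp
  then have "(\<lambda>h::real. (max 0 (0 + h) ^ Suc (Suc n) - max 0 0 ^ Suc (Suc n)) / h) \<midarrow>0\<rightarrow> 0"
    by (rule Lim_transform_eventually) (auto simp: eventually_at_filter max_def)
  then show ?thesis using equal by (simp add: DERIV_def)
next
  case greater
  have "((\<lambda>t. t ^ Suc (Suc n)) has_real_derivative real (Suc (Suc n)) * t ^ Suc n) (at t)"
    using DERIV_pow[of "Suc (Suc n)"] by simp
  then have "((\<lambda>t. max 0 t ^ Suc (Suc n)) has_real_derivative real (Suc (Suc n)) * t ^ Suc n) (at t)"
    by (rule has_field_derivative_transform_within_open[of _ _ _ "{0<..}" ]) (use greater in auto)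
  then show ?thesis using greater by simp
qed

abbreviation pos_part :: "real \<Rightarrow> real" where "pos_part t \<equiv> max 0 t"

text \<open>A piecewise polynomial step: the cube of a positive part is twice continuously
  differentiable, enough smoothness for a Laplacian. The inner cube is at least 1 for
  \<open>t \<le> 1\<close> and vanishes for \<open>t \<ge> 2\<close>, and the outer truncation turns
  this into the exact values 1 and 0.\<close>

definition cutoff :: "real \<Rightarrow> real" where
  "cutoff t = 1 - pos_part (1 - pos_part (2 - t) ^ 3) ^ 3"

definition cutoff1 :: "real \<Rightarrow> real" where
  "cutoff1 t = - (9 * pos_part (1 - pos_part (2 - t) ^ 3) ^ 2 * pos_part (2 - t) ^ 2)"

definition cutoff2 :: "real \<Rightarrow> real" where
  "cutoff2 t = - (54 * pos_part (1 - pos_part (2 - t) ^ 3) * pos_part (2 - t) ^ 4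
      - 18 * pos_part (1 - pos_part (2 - t) ^ 3) ^ 2 * pos_part (2 - t))"

lemma DERIV_pos_part_cube:
  "(f has_real_derivative D) (at t) \<Longrightarrow> ((\<lambda>t. pos_part (f t) ^ 3) has_real_derivative 3 * pos_part (f t) ^ 2 * D) (at t)"
  using DERIV_chain2[OF has_real_derivative_pos_part_power[of 1]] by (simp add: numeral_eq_Suc)

lemma DERIV_pos_part_square:
  "(f has_real_derivative D) (at t) \<Longrightarrow> ((\<lambda>t. pos_part (f t) ^ 2) has_real_derivative 2 * pos_part (f t) * D) (at t)"
  using DERIV_chain2[OF has_real_derivative_pos_part_power[of 0]] by (simp add: numeral_eq_Suc)

lemma DERIV_inner_cutoff:
  "((\<lambda>t. 1 - pos_part (2 - t) ^ 3) has_real_derivative 3 * pos_part (2 - t) ^ 2) (at t)"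
  by (rule DERIV_cong[OF DERIV_diff[OF DERIV_const DERIV_pos_part_cube[OF DERIV_diff[OF DERIV_const DERIV_ident]]]]) simp

lemma DERIV_cutoff: "(cutoff has_real_derivative cutoff1 t) (at t)"
  unfolding cutoff_def [abs_def]
  by (rule DERIV_cong[OF DERIV_diff[OF DERIV_const DERIV_pos_part_cube[OF DERIV_inner_cutoff]]])
     (simp add: cutoff1_def)

lemma DERIV_cutoff1: "(cutoff1 has_real_derivative cutoff2 t) (at t)"
proof -
  have "((\<lambda>t. - (9 * (pos_part (1 - pos_part (2 - t) ^ 3) ^ 2 * pos_part (2 - t) ^ 2))) has_real_derivative
      - (9 * (2 * pos_part (1 - pos_part (2 - t) ^ 3) * (3 * pos_part (2 - t) ^ 2) * pos_part (2 - t) ^ 2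
          + (2 * pos_part (2 - t) * (0 - 1)) * pos_part (1 - pos_part (2 - t) ^ 3) ^ 2))) (at t)"
    by (intro DERIV_minus DERIV_cmult DERIV_mult DERIV_pos_part_square DERIV_inner_cutoff DERIV_diff DERIV_const DERIV_ident)
  moreover have "- (9 * (2 * p * (3 * q ^ 2) * q ^ 2 + (2 * q * (0 - 1)) * p ^ 2)) = - (54 * p * q ^ 4 - 18 * p ^ 2 * q)" for p q :: real
    by algebra
  ultimately show ?thesis unfolding cutoff1_def [abs_def] cutoff2_def by (simp add: mult.assoc mult.left_commute mult.commute)
qed

lemma continuous_on_cutoff2: "continuous_on S cutoff2"
  unfolding cutoff2_def [abs_def] by (intro continuous_intros)

lemma pos_part_inner_cutoff: "t \<le> 1 \<Longrightarrow> pos_part (1 - pos_part (2 - t) ^ 3) = 0"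
proof -
  assume t: "t \<le> 1"
  have "1 \<le> (2 - t) ^ 3" by (rule one_le_power) (use t in simp)
  moreover have "pos_part (2 - t) = 2 - t" using t by simp
  ultimately show ?thesis by (metis diff_le_0_iff_le max.absorb1)
qed

lemma cutoff_eq_1: "t \<le> 1 \<Longrightarrow> cutoff t = 1"
  by (simp only: cutoff_def pos_part_inner_cutoff) simp

lemma cutoff_eq_0: "t \<ge> 2 \<Longrightarrow> cutoff t = 0"
  by (simp add: cutoff_def)

lemma cutoff1_eq_0: "t \<le> 1 \<or> t \<ge> 2 \<Longrightarrow> cutoff1 t = 0"
  by (elim disjE, simp only: cutoff1_def pos_part_inner_cutoff) (simp_all add: cutoff1_def)

lemma cutoff2_eq_0: "t \<le> 1 \<or> t \<ge> 2 \<Longrightarrow> cutoff2 t = 0"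
  by (elim disjE, simp only: cutoff2_def pos_part_inner_cutoff) (simp_all add: cutoff2_def)

lemma cutoff1_nonpos: "cutoff1 t \<le> 0"
  by (simp add: cutoff1_def)

text \<open>For \<open>t > 1\<close> both positive parts lie in [0, 1], so only the factor 9 from
  differentiating two nested cubes remains.\<close>

lemma cutoff1_ge: "cutoff1 t \<ge> -9"
proof (cases "t \<le> 1")
  case False
  then have "pos_part (2 - t) ^ 2 \<le> 1"  "pos_part (1 - pos_part (2 - t) ^ 3) ^ 2 \<le> 1"
    by (auto intro!: power_le_one)
  then have "pos_part (1 - pos_part (2 - t) ^ 3) ^ 2 * pos_part (2 - t) ^ 2 \<le> 1"
    by (intro mult_le_one) auto
  then show ?thesis by (simp add: cutoff1_def)
qed (simp add: cutoff1_eq_0)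

text \<open>The squared distance is a polynomial, so no smoothness is lost at the centre
  \<open>a\<close>. The transition happens for |y - a| between R and sqrt 2 R; the lemmas below use
  the coarser outer radius 2 R.\<close>

definition radial_cutoff :: "'a::euclidean_space \<Rightarrow> real \<Rightarrow> 'a \<Rightarrow> real" where
  "radial_cutoff a R y = cutoff ((y - a) \<bullet> (y - a) / R\<^sup>2)"

definition radial_cutoff1 :: "'a::euclidean_space \<Rightarrow> real \<Rightarrow> 'a \<Rightarrow> 'a \<Rightarrow> real" where
  "radial_cutoff1 a R b y = (2 * ((y - a) \<bullet> b) / R\<^sup>2) * cutoff1 ((y - a) \<bullet> (y - a) / R\<^sup>2)"

definition radial_cutoff2 :: "'a::euclidean_space \<Rightarrow> real \<Rightarrow> 'a \<Rightarrow> 'a \<Rightarrow> real" where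
  "radial_cutoff2 a R b y = (2 * (b \<bullet> b) / R\<^sup>2) * cutoff1 ((y - a) \<bullet> (y - a) / R\<^sup>2)
     + (2 * ((y - a) \<bullet> b) / R\<^sup>2)\<^sup>2 * cutoff2 ((y - a) \<bullet> (y - a) / R\<^sup>2)"

lemma C2_data_radial_cutoff:
  assumes "R \<noteq> 0"
  shows "C2_data S (radial_cutoff a R) (radial_cutoff1 a R) (radial_cutoff2 a R)"
proof -
  have cc: "continuous_on UNIV cutoff" "continuous_on UNIV cutoff1"
    by (intro continuous_at_imp_continuous_on ballI DERIV_isCont[OF DERIV_cutoff] DERIV_isCont[OF DERIV_cutoff1])+
  have q: "has_pd b (\<lambda>y. (y - a) \<bullet> (y - a) / R\<^sup>2) (2 * ((x - a) \<bullet> b) / R\<^sup>2) x" for b x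
    by (rule has_pd_bounded_linear[OF bounded_linear_divide has_pd_inner_self])
  have l: "has_pd b (\<lambda>y. 2 * ((y - a) \<bullet> b) / R\<^sup>2) (2 * (b \<bullet> b) / R\<^sup>2) x" for b x
    using has_pd_bounded_linear[OF bounded_linear_mult_right[of "2 / R\<^sup>2"] has_pd_inner[of b a b x]]
    by simp
  have c1: "has_pd b (\<lambda>y. cutoff ((y - a) \<bullet> (y - a) / R\<^sup>2)) ((2 * ((x - a) \<bullet> b) / R\<^sup>2) *\<^sub>R cutoff1 ((x - a) \<bullet> (x - a) / R\<^sup>2)) x"
    and c2: "has_pd b (\<lambda>y. cutoff1 ((y - a) \<bullet> (y - a) / R\<^sup>2)) ((2 * ((x - a) \<bullet> b) / R\<^sup>2) *\<^sub>R cutoff2 ((x - a) \<bullet> (x - a) / R\<^sup>2)) x" for b x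
    by (rule has_pd_chain[OF q], use DERIV_cutoff DERIV_cutoff1 in \<open>simp add: has_real_derivative_iff_has_vector_derivative\<close>)+
  show ?thesis
    unfolding C2_data_def
  proof (intro conjI ballI)
    show "continuous_on S (radial_cutoff a R)"
      unfolding radial_cutoff_def by (intro continuous_on_compose2[OF cc(1)] continuous_intros) (use assms in auto)
    fix b :: 'a
    show "continuous_on S (radial_cutoff1 a R b)"
      unfolding radial_cutoff1_def
      by (intro continuous_on_compose2[OF cc(2)] continuous_intros) (use assms in auto)
    show "continuous_on S (radial_cutoff2 a R b)"
      unfolding radial_cutoff2_def
      by (intro continuous_on_compose2[OF cc(2)] continuous_on_compose2[OF continuous_on_cutoff2[of UNIV]] continuous_intros) (use assms in auto)
    fix x :: 'a
    show "has_pd b (radial_cutoff a R) (radial_cutoff1 a R b x) x"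
      using c1 unfolding radial_cutoff_def radial_cutoff1_def by simp
    show "has_pd b (radial_cutoff1 a R b) (radial_cutoff2 a R b x) x"
    proof -
      have eq: "L * (L *\<^sub>R C) + M * D = M * D + L\<^sup>2 * C" for L M C D :: real
        by (simp add: power2_eq_square)
      show ?thesis
        using has_pd_mult[OF l c2, of b x] unfolding radial_cutoff1_def radial_cutoff2_def eq .
    qed
  qed
qed

lemma radial_cutoff_eq_1: "R > 0 \<Longrightarrow> norm (y - a) \<le> R \<Longrightarrow> radial_cutoff a R y = 1"
  unfolding radial_cutoff_def
  by (rule cutoff_eq_1) (simp add: dot_square_norm power_mono)

lemma radial_cutoff_eq_0:
  assumes "R > 0" "norm (y - a) \<ge> 2 * R"
  shows "radial_cutoff a R y = 0"
proof -
  have "(2 * R)\<^sup>2 \<le> (norm (y - a))\<^sup>2" using assms by (intro power_mono) auto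
  then have "4 * R\<^sup>2 \<le> (norm (y - a))\<^sup>2" by (simp add: power_mult_distrib)
  then have "2 * R\<^sup>2 \<le> (y - a) \<bullet> (y - a)"
    unfolding dot_square_norm using zero_le_power2[of R] by linarith
  then show ?thesis
    unfolding radial_cutoff_def using assms(1) by (intro cutoff_eq_0) (simp add: field_simps)
qed

lemma radial_cutoff1_eq_0:
  assumes "R > 0" "norm (y - a) \<le> R \<or> norm (y - a) \<ge> 2 * R"
  shows "radial_cutoff1 a R b y = 0" "radial_cutoff2 a R b y = 0"
proof -
  have "(y - a) \<bullet> (y - a) / R\<^sup>2 \<le> 1 \<or> (y - a) \<bullet> (y - a) / R\<^sup>2 \<ge> 2"
    using assms power_mono[of "2 * R" "norm (y - a)" 2] power_mono[of "norm (y - a)" R 2]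
    by (auto simp: dot_square_norm field_simps power2_eq_square)
  then show "radial_cutoff1 a R b y = 0" "radial_cutoff2 a R b y = 0"
    unfolding radial_cutoff1_def radial_cutoff2_def by (simp_all add: cutoff1_eq_0 cutoff2_eq_0)
qed

section \<open>The regularised fundamental solution\<close>

definition helm :: "real \<Rightarrow> real \<Rightarrow> complex" where
  "helm \<kappa> r = exp (\<i> * of_real (\<kappa> * r)) / of_real r"

text \<open>This is the derivative of \<open>helm\<close> divided by r, and \<open>helm2\<close> is
  the derivative of \<open>helm1\<close>. With the division, the gradient of a radial kernel is the
  vector y - x times \<open>helm1\<close>, without a normalised direction.\<close>

definition helm1 :: "real \<Rightarrow> real \<Rightarrow> complex" where
  "helm1 \<kappa> r = exp (\<i> * of_real (\<kappa> * r)) * (\<i> * of_real \<kappa> / of_real r ^ 2 - 1 / of_real r ^ 3)"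

definition helm2 :: "real \<Rightarrow> real \<Rightarrow> complex" where
  "helm2 \<kappa> r = exp (\<i> * of_real (\<kappa> * r)) * (3 / of_real r ^ 4 - 3 * \<i> * of_real \<kappa> / of_real r ^ 3 - of_real \<kappa> ^ 2 / of_real r ^ 2)"

definition reg_dist :: "real \<Rightarrow> 'a::euclidean_space \<Rightarrow> 'a \<Rightarrow> real" where
  "reg_dist \<epsilon> x y = sqrt ((y - x) \<bullet> (y - x) + \<epsilon>\<^sup>2)"

definition reg_kernel :: "real \<Rightarrow> real \<Rightarrow> 'a::euclidean_space \<Rightarrow> 'a \<Rightarrow> complex" where
  "reg_kernel \<kappa> \<epsilon> x y = helm \<kappa> (reg_dist \<epsilon> x y)"

definition reg_kernel1 :: "real \<Rightarrow> real \<Rightarrow> 'a::euclidean_space \<Rightarrow> 'a \<Rightarrow> 'a \<Rightarrow> complex" where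
  "reg_kernel1 \<kappa> \<epsilon> x b y = of_real ((y - x) \<bullet> b) * helm1 \<kappa> (reg_dist \<epsilon> x y)"

definition reg_kernel2 :: "real \<Rightarrow> real \<Rightarrow> 'a::euclidean_space \<Rightarrow> 'a \<Rightarrow> 'a \<Rightarrow> complex" where
  "reg_kernel2 \<kappa> \<epsilon> x b y = of_real (b \<bullet> b) * helm1 \<kappa> (reg_dist \<epsilon> x y)
     + of_real (((y - x) \<bullet> b)\<^sup>2 / reg_dist \<epsilon> x y) * helm2 \<kappa> (reg_dist \<epsilon> x y)"

lemma has_vector_derivative_helm:
  assumes "r > 0"
  shows "(helm \<kappa> has_vector_derivative of_real r * helm1 \<kappa> r) (at r)"
    "(helm1 \<kappa> has_vector_derivative helm2 \<kappa> r) (at r)"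
proof -
  have r: "complex_of_real r \<noteq> 0" using assms by simp
  \<comment> \<open>The derivative is taken over the complex numbers and then restricted to the real
    axis.\<close>
  have "((\<lambda>z. exp (\<i> * (of_real \<kappa> * z)) / z) has_field_derivative of_real r * helm1 \<kappa> r) (at (of_real r))"
    unfolding helm1_def using r
    by (auto intro!: derivative_eq_intros) (simp add: field_simps power2_eq_square power3_eq_cube)
  from has_vector_derivative_real_field[OF this]
  show "(helm \<kappa> has_vector_derivative of_real r * helm1 \<kappa> r) (at r)"
    by (simp add: helm_def[abs_def])
  have "((\<lambda>z. exp (\<i> * (of_real \<kappa> * z)) * (\<i> * of_real \<kappa> / z ^ 2 - 1 / z ^ 3)) has_field_derivative helm2 \<kappa> r) (at (of_real r))"
    unfolding helm2_def using r
    by (auto intro!: derivative_eq_intros) (simp add: field_simps power_numeral_reduce)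
  from has_vector_derivative_real_field[OF this]
  show "(helm1 \<kappa> has_vector_derivative helm2 \<kappa> r) (at r)"
    by (simp add: helm1_def[abs_def])
qed

lemma reg_dist_pos: "\<epsilon> > 0 \<Longrightarrow> reg_dist \<epsilon> x y > 0"
  by (simp add: reg_dist_def add_nonneg_pos)

lemma has_pd_reg_dist:
  assumes "\<epsilon> > 0"
  shows "has_pd b (reg_dist \<epsilon> x) (((y - x) \<bullet> b) / reg_dist \<epsilon> x y) y"
proof -
  have p: "(y - x) \<bullet> (y - x) + \<epsilon>\<^sup>2 > 0" using assms by (simp add: add_nonneg_pos)
  have "has_pd b (\<lambda>y. (y - x) \<bullet> (y - x) + \<epsilon>\<^sup>2) (2 * ((y - x) \<bullet> b) + 0) y"
    by (intro has_pd_add has_pd_inner_self has_pd_const)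
  moreover have "(sqrt has_vector_derivative inverse (sqrt ((y - x) \<bullet> (y - x) + \<epsilon>\<^sup>2)) / 2) (at ((y - x) \<bullet> (y - x) + \<epsilon>\<^sup>2))"
    using DERIV_real_sqrt[OF p] by (simp add: has_real_derivative_iff_has_vector_derivative)
  ultimately have "has_pd b (\<lambda>y. sqrt ((y - x) \<bullet> (y - x) + \<epsilon>\<^sup>2)) ((2 * ((y - x) \<bullet> b) + 0) *\<^sub>R (inverse (sqrt ((y - x) \<bullet> (y - x) + \<epsilon>\<^sup>2)) / 2)) y"
    by (rule has_pd_chain)
  then show ?thesis by (simp add: reg_dist_def[abs_def] field_simps)
qed

lemma continuous_on_reg_dist: "continuous_on S (reg_dist \<epsilon> x)"
  unfolding reg_dist_def by (intro continuous_intros)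

lemma C2_data_reg_kernel:
  assumes "\<epsilon> > 0"
  shows "C2_data S (reg_kernel \<kappa> \<epsilon> x) (reg_kernel1 \<kappa> \<epsilon> x) (reg_kernel2 \<kappa> \<epsilon> x)"
proof -
  have nz: "reg_dist \<epsilon> x y \<noteq> 0" for y using reg_dist_pos[OF assms, of x y] by simp
  have d: "has_pd b (\<lambda>y. helm \<kappa> (reg_dist \<epsilon> x y)) ((((y - x) \<bullet> b) / reg_dist \<epsilon> x y) *\<^sub>R (of_real (reg_dist \<epsilon> x y) * helm1 \<kappa> (reg_dist \<epsilon> x y))) y"
    "has_pd b (\<lambda>y. helm1 \<kappa> (reg_dist \<epsilon> x y)) ((((y - x) \<bullet> b) / reg_dist \<epsilon> x y) *\<^sub>R helm2 \<kappa> (reg_dist \<epsilon> x y)) y" for b y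
    by (rule has_pd_chain[OF has_pd_reg_dist[OF assms] has_vector_derivative_helm(1)[OF reg_dist_pos[OF assms]]]
        has_pd_chain[OF has_pd_reg_dist[OF assms] has_vector_derivative_helm(2)[OF reg_dist_pos[OF assms]]])+
  show ?thesis
    unfolding C2_data_def
  proof (intro conjI ballI)
    show "continuous_on S (reg_kernel \<kappa> \<epsilon> x)"
      unfolding reg_kernel_def[abs_def] helm_def using nz
      by (intro continuous_intros continuous_on_reg_dist) auto
    fix b :: 'a
    show "continuous_on S (reg_kernel1 \<kappa> \<epsilon> x b)"
      unfolding reg_kernel1_def[abs_def] helm1_def using nz
      by (intro continuous_intros continuous_on_reg_dist) auto
    show "continuous_on S (reg_kernel2 \<kappa> \<epsilon> x b)"
      unfolding reg_kernel2_def[abs_def] helm1_def helm2_def using nz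
      by (intro continuous_intros continuous_on_reg_dist) auto
    fix y :: 'a
    show "has_pd b (reg_kernel \<kappa> \<epsilon> x) (reg_kernel1 \<kappa> \<epsilon> x b y) y"
      using d(1)[of b y] nz[of y] unfolding reg_kernel_def[abs_def] reg_kernel1_def
      by (simp add: scaleR_conv_of_real)
    have "has_pd b (\<lambda>y. complex_of_real ((y - x) \<bullet> b)) (of_real (b \<bullet> b)) y"
      by (rule has_pd_bounded_linear[OF bounded_linear_of_real has_pd_inner])
    from has_pd_mult[OF this d(2)[of b y]]
    show "has_pd b (reg_kernel1 \<kappa> \<epsilon> x b) (reg_kernel2 \<kappa> \<epsilon> x b y) y"
      unfolding reg_kernel1_def[abs_def] reg_kernel2_def
      by (simp add: scaleR_conv_of_real power2_eq_square add.commute mult.assoc)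
  qed
qed

text \<open>In three dimensions the Laplacian of the kernel is 3 \<open>helm1\<close> + ((r^2 -
  \<epsilon>^2) / r) \<open>helm2\<close>, because the squared coordinates of y - x sum to r^2 -
  \<epsilon>^2. The true spherical wave satisfies 3 \<open>helm1\<close> + r \<open>helm2\<close> +
  \<kappa>^2 \<open>helm\<close> = 0, so only the \<epsilon>^2 term is left.\<close>

lemma helmholtz_reg_kernel:
  fixes x y :: "real^3"
  assumes "\<epsilon> > 0"
  shows "helmholtz \<kappa> (reg_kernel \<kappa> \<epsilon> x) (reg_kernel2 \<kappa> \<epsilon> x) y
     = - (of_real (\<epsilon>\<^sup>2 / reg_dist \<epsilon> x y) * helm2 \<kappa> (reg_dist \<epsilon> x y))"
proof -
  define r where "r = reg_dist \<epsilon> x y"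
  have r: "r > 0" using reg_dist_pos[OF assms] by (simp add: r_def)
  have r2: "(\<Sum>b\<in>Basis. ((y - x) \<bullet> b)\<^sup>2) = r\<^sup>2 - \<epsilon>\<^sup>2"
    unfolding r_def reg_dist_def
    by (simp add: power2_eq_square euclidean_inner[of "y - x" "y - x"] sum_nonneg)
  have "(\<Sum>b\<in>Basis. reg_kernel2 \<kappa> \<epsilon> x b y)
      = (\<Sum>b\<in>(Basis :: (real^3) set). helm1 \<kappa> r) + of_real ((\<Sum>b\<in>Basis. ((y - x) \<bullet> b)\<^sup>2) / r) * helm2 \<kappa> r"
    unfolding reg_kernel2_def r_def[symmetric] sum.distrib
    by (simp add: sum_distrib_right sum_divide_distrib)
  also have "\<dots> = 3 * helm1 \<kappa> r + of_real ((r\<^sup>2 - \<epsilon>\<^sup>2) / r) * helm2 \<kappa> r"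
    by (simp add: r2)
  finally have "helmholtz \<kappa> (reg_kernel \<kappa> \<epsilon> x) (reg_kernel2 \<kappa> \<epsilon> x) y
     = 3 * helm1 \<kappa> r + of_real ((r\<^sup>2 - \<epsilon>\<^sup>2) / r) * helm2 \<kappa> r + of_real (\<kappa>\<^sup>2) * helm \<kappa> r"
    by (simp add: helmholtz_def reg_kernel_def r_def)
  also have "\<dots> = - (of_real (\<epsilon>\<^sup>2 / r) * helm2 \<kappa> r)"
  proof -
    define E where "E = exp (\<i> * complex_of_real (\<kappa> * r))"
    have "complex_of_real r \<noteq> 0" using r by simp
    then show ?thesis
      unfolding helm_def helm1_def helm2_def E_def[symmetric]
      by (simp add: field_simps power_numeral_reduce)
  qed
  finally show ?thesis by (simp add: r_def)
qed

section \<open>Concentration of the regularised kernel as \<epsilon> tends to 0\<close>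

lemma integral_affine:
  fixes h :: "'a::euclidean_space \<Rightarrow> 'b::{banach, second_countable_topology}"
  assumes "h \<in> borel_measurable borel" "c > 0"
  shows "integral\<^sup>L lborel h = c ^ DIM('a) *\<^sub>R integral\<^sup>L lborel (\<lambda>z. h (x + c *\<^sub>R z))"
proof -
  have "integral\<^sup>L lborel h = integral\<^sup>L (density (distr lborel borel (\<lambda>z. x + c *\<^sub>R z)) (\<lambda>_. \<bar>c\<bar>^DIM('a))) h"
    using lborel_affine[of c x] assms(2) by simp
  also have "\<dots> = integral\<^sup>L (distr lborel borel (\<lambda>z. x + c *\<^sub>R z)) (\<lambda>y. (c ^ DIM('a)) *\<^sub>R h y)"
    using assms by (subst integral_density) auto
  also have "\<dots> = integral\<^sup>L lborel (\<lambda>z. (c ^ DIM('a)) *\<^sub>R h (x + c *\<^sub>R z))"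
    using assms by (subst integral_distr) auto
  finally show ?thesis by simp
qed

lemma reg_dist_ge: "norm (y - x) \<le> reg_dist \<epsilon> x y"
  unfolding reg_dist_def by (rule real_le_rsqrt) (simp add: dot_square_norm)

lemma reg_dist_le: "\<epsilon> \<ge> 0 \<Longrightarrow> reg_dist \<epsilon> x y \<le> norm (y - x) + \<epsilon>"
  unfolding reg_dist_def by (rule real_le_lsqrt) (auto simp: dot_square_norm power2_sum)

lemma reg_dist_1_ge_1: "1 \<le> reg_dist 1 x y"
  unfolding reg_dist_def by (rule real_le_rsqrt) simp

lemma reg_dist_scale: "\<epsilon> > 0 \<Longrightarrow> reg_dist \<epsilon> x (x + \<epsilon> *\<^sub>R z) = \<epsilon> * reg_dist 1 0 z"
proof -
  assume e: "\<epsilon> > 0"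
  have "(\<epsilon> *\<^sub>R z) \<bullet> (\<epsilon> *\<^sub>R z) + \<epsilon>\<^sup>2 = \<epsilon>\<^sup>2 * (z \<bullet> z + 1)"
    by (simp add: power2_eq_square algebra_simps)
  then show ?thesis unfolding reg_dist_def using e by (simp add: real_sqrt_mult)
qed

text \<open>Dyadic comparison: on the shell between radii 2^(k-1) and 2^k the integrand is at most
  32 / 32^k, while the ball of radius 2^k has volume proportional to 8^k, so the integrals are
  dominated by a geometric series of ratio 1/4.\<close>

lemma integrable_reg_dist: "integrable lborel (\<lambda>z::real^3. 1 / reg_dist 1 0 z ^ 5)"
proof (rule integrableI_bounded)
  have "continuous_on UNIV (\<lambda>z::real^3. 1 / reg_dist 1 0 z ^ 5)"
    using reg_dist_1_ge_1[of "0::real^3"]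
    by (intro continuous_intros continuous_on_reg_dist) (metis not_one_le_zero power_not_zero)
  then show "(\<lambda>z::real^3. 1 / reg_dist 1 0 z ^ 5) \<in> borel_measurable lborel"
    by (simp add: borel_measurable_continuous_onI)
  define V where "V = unit_ball_vol (real DIM(real^3))"
  have V: "V \<ge> 0" unfolding V_def by simp
  have pt: "ennreal (norm (1 / reg_dist 1 0 z ^ 5)) \<le> (\<Sum>k. ennreal (32 / 32 ^ k) * indicator (ball 0 (2 ^ k)) z)" (is "_ \<le> (\<Sum>k. ?t k z)") for z :: "real^3"
  proof -
    \<comment> \<open>The least such k also gives \<open>2 ^ (k - 1) \<le> norm z\<close> when k >
      0; this index shift costs the factor 2^5 = 32.\<close>
    define k where "k = (LEAST k. norm z < 2 ^ k)"
    have k: "norm z < 2 ^ k"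
      unfolding k_def by (rule LeastI_ex) (use real_arch_pow[of 2 "norm z"] in simp)
    have "1 / reg_dist 1 0 z ^ 5 \<le> 32 / 32 ^ k"
    proof (cases k)
      case 0
      have "1 \<le> reg_dist 1 0 z ^ 5" by (intro one_le_power reg_dist_1_ge_1)
      then have "1 / reg_dist 1 0 z ^ 5 \<le> 1" by (simp add: divide_le_eq_1_pos reg_dist_pos)
      then show ?thesis using 0 by simp
    next
      case (Suc m)
      have "\<not> norm z < 2 ^ m" using not_less_Least[of m "\<lambda>k. norm z < 2 ^ k"] Suc k_def by simp
      then have "2 ^ m \<le> reg_dist 1 0 z" using reg_dist_ge[of z 0 1] by simp
      then have "(2 ^ m) ^ 5 \<le> reg_dist 1 0 z ^ 5" by (rule power_mono) simp
      then have "1 / reg_dist 1 0 z ^ 5 \<le> 1 / (2 ^ m) ^ 5" by (intro divide_left_mono) (auto intro!: mult_pos_pos zero_less_power reg_dist_pos)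
      also have "\<dots> = 32 / 32 ^ k" 
      proof -
        have "((2::real) ^ m) ^ 5 = (2 ^ 5) ^ m" by (simp only: power_mult[symmetric] mult.commute)
        then show ?thesis by (simp add: Suc)
      qed
      finally show ?thesis .
    qed
    then have "ennreal (norm (1 / reg_dist 1 0 z ^ 5)) \<le> ?t k z"
      using k reg_dist_pos[of 1 0 z] by (simp add: ennreal_leI)
    also have "\<dots> \<le> (\<Sum>k. ?t k z)"
    proof -
      have "sum (\<lambda>k. ?t k z) {k} \<le> (\<Sum>k. ?t k z)" by (rule sum_le_suminf) auto
      then show ?thesis
        by (simp only: sum.insert finite.emptyI empty_iff not_False_eq_True sum.empty add_0_right)
    qed
    finally show ?thesis .
  qed
  have "(\<integral>\<^sup>+z. ennreal (norm (1 / reg_dist 1 0 z ^ 5)) \<partial>(lborel :: (real^3) measure))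
      \<le> (\<integral>\<^sup>+z. (\<Sum>k. ennreal (32 / 32 ^ k) * indicator (ball 0 (2 ^ k)) z) \<partial>(lborel :: (real^3) measure))"
    by (intro nn_integral_mono pt)
  also have "\<dots> = (\<Sum>k. \<integral>\<^sup>+z. ennreal (32 / 32 ^ k) * indicator (ball 0 (2 ^ k)) z \<partial>(lborel :: (real^3) measure))"
    by (rule nn_integral_suminf, intro borel_measurable_times_ennreal borel_measurable_const borel_measurable_indicator) auto
  also have "\<dots> = (\<Sum>k. ennreal (32 * V * (1/4) ^ k))"
  proof (intro suminf_cong)
    fix k :: nat
    have "(\<integral>\<^sup>+z. ennreal (32 / 32 ^ k) * indicator (ball 0 (2 ^ k)) z \<partial>(lborel :: (real^3) measure))
       = ennreal (32 / 32 ^ k) * ennreal (V * (2 ^ k) ^ 3)"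
      by (subst nn_integral_cmult_indicator) (auto simp: emeasure_ball V_def)
    also have "\<dots> = ennreal (32 / 32 ^ k * (V * (2 ^ k) ^ 3))"
      using V by (intro ennreal_mult[symmetric]) auto
    also have "32 / 32 ^ k * (V * (2 ^ k) ^ 3) = 32 * V * (1/4) ^ k"
    proof -
      have "(32::real) ^ k = 4 ^ k * 8 ^ k" by (simp add: power_mult_distrib[symmetric])
      moreover have "((2::real) ^ k) ^ 3 = (2 ^ 3) ^ k" by (simp only: power_mult[symmetric] mult.commute)
      ultimately show ?thesis by (simp add: power_divide)
    qed
    finally show "(\<integral>\<^sup>+z. ennreal (32 / 32 ^ k) * indicator (ball 0 (2 ^ k)) z \<partial>(lborel :: (real^3) measure))
       = ennreal (32 * V * (1/4) ^ k)" .
  qed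
  also have "\<dots> = ennreal (\<Sum>k. 32 * V * (1/4) ^ k)"
    using V by (intro suminf_ennreal2 summable_mult summable_geometric) auto
  also have "\<dots> < \<infinity>" by simp
  finally show "(\<integral>\<^sup>+z. ennreal (norm (1 / reg_dist 1 0 z ^ 5)) \<partial>(lborel :: (real^3) measure)) < \<infinity>" .
qed

text \<open>The constant 4 \<pi> of the fundamental solution, in integral form; the 3 is the leading
  coefficient of \<open>helm2\<close>. Below it acts as a positive constant to divide by.\<close>

definition kernel_mass :: real where
  "kernel_mass = 3 * integral\<^sup>L lborel (\<lambda>z::real^3. 1 / reg_dist 1 0 z ^ 5)"

lemma kernel_mass_pos: "kernel_mass > 0"
proof -
  let ?I = "integral\<^sup>L lborel (\<lambda>z::real^3. 1 / reg_dist 1 0 z ^ 5)"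
  have pos: "1 / reg_dist 1 0 z ^ 5 > 0" for z :: "real^3"
    using reg_dist_pos[of 1 "0::real^3" z] by simp
  have "?I \<noteq> 0"
  proof
    assume "?I = 0"
    then have "AE z in lborel. 1 / reg_dist 1 0 (z::real^3) ^ 5 = 0"
      using integral_nonneg_eq_0_iff_AE[OF integrable_reg_dist] pos by (simp add: less_imp_le)
    then have "AE z in (lborel :: (real^3) measure). False"
      using pos by (elim eventually_mono) (metis less_irrefl)
    then show False by (simp add: ae_filter_eq_bot_iff eventually_False)
  qed
  moreover have "?I \<ge> 0" using pos by (simp add: less_imp_le)
  ultimately have "?I > 0" by simp
  then show ?thesis unfolding kernel_mass_def by simp
qed


text \<open>The substitution y = x + \<epsilon> z turns the integral into one of W(x + \<epsilon> z)
  against a kernel that converges pointwise to -3 / d(z)^5, where d(z) = sqrt(|z|^2 + 1). Dominated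
  convergence then leaves W(x) times the total mass.\<close>

lemma reg_kernel_approx_identity:
  fixes W :: "real^3 \<Rightarrow> complex"
  assumes W: "continuous_on UNIV W" "\<And>y. norm y > A \<Longrightarrow> W y = 0" and "\<kappa> \<ge> 0" "A \<ge> 0"
  shows "(\<lambda>n. integral\<^sup>L lborel (\<lambda>y. W y * helmholtz \<kappa> (reg_kernel \<kappa> (1 / Suc n) x) (reg_kernel2 \<kappa> (1 / Suc n) x) y))
     \<longlonglongrightarrow> - of_real kernel_mass * W x"
proof -
  obtain B where B: "B > 0" "\<And>y. norm (W y) \<le> B"
    using bounded_continuous_compact_support[OF W] by blast
  define \<epsilon> where "\<epsilon> = (\<lambda>n. 1 / real (Suc n))"
  have \<epsilon>: "\<epsilon> n > 0" "\<epsilon> n \<le> 1" for n by (auto simp: \<epsilon>_def)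
  have \<epsilon>0: "\<epsilon> \<longlonglongrightarrow> 0"
    unfolding \<epsilon>_def using LIMSEQ_inverse_real_of_nat by (simp add: inverse_eq_divide)
  define d where "d = reg_dist 1 (0::real^3)"
  have d: "d z > 0" for z unfolding d_def by (simp add: reg_dist_pos)
  \<comment> \<open>The Jacobian \<open>\<epsilon> n ^ 3\<close> is already absorbed: \<epsilon>
    survives only in the phase and as a factor of the two terms that vanish in the limit.\<close>
  define k where "k = (\<lambda>n z. - (exp (\<i> * of_real (\<kappa> * (\<epsilon> n * d z))) *
      (3 / of_real (d z) ^ 5 - 3 * \<i> * of_real \<kappa> * of_real (\<epsilon> n) / of_real (d z) ^ 4 - of_real \<kappa> ^ 2 * of_real (\<epsilon> n) ^ 2 / of_real (d z) ^ 3)))"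
  have scale: "integral\<^sup>L lborel (\<lambda>y. W y * helmholtz \<kappa> (reg_kernel \<kappa> (\<epsilon> n) x) (reg_kernel2 \<kappa> (\<epsilon> n) x) y)
       = integral\<^sup>L lborel (\<lambda>z. W (x + \<epsilon> n *\<^sub>R z) * k n z)" for n
  proof -
    let ?h = "\<lambda>y. W y * helmholtz \<kappa> (reg_kernel \<kappa> (\<epsilon> n) x) (reg_kernel2 \<kappa> (\<epsilon> n) x) y"
    have "continuous_on UNIV ?h"
      by (intro continuous_intros W continuous_on_helmholtz[OF C2_data_reg_kernel[OF \<epsilon>(1)]])
    then have "?h \<in> borel_measurable borel" by (rule borel_measurable_continuous_onI)
    then have "integral\<^sup>L lborel ?h = (\<epsilon> n ^ 3) *\<^sub>R integral\<^sup>L lborel (\<lambda>z. ?h (x + \<epsilon> n *\<^sub>R z))"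
      using integral_affine[of ?h "\<epsilon> n" x] \<epsilon>(1) by simp
    also have "\<dots> = integral\<^sup>L lborel (\<lambda>z. (\<epsilon> n ^ 3) *\<^sub>R ?h (x + \<epsilon> n *\<^sub>R z))" by simp
    also have "(\<lambda>z. (\<epsilon> n ^ 3) *\<^sub>R ?h (x + \<epsilon> n *\<^sub>R z)) = (\<lambda>z. W (x + \<epsilon> n *\<^sub>R z) * k n z)"
    proof
      fix z
      have nz: "complex_of_real (d z) \<noteq> 0" "complex_of_real (\<epsilon> n) \<noteq> 0" using d[of z] \<epsilon>(1)[of n] by auto
      have "e ^ 3 * (w * - (e\<^sup>2 / (e * D) * (E * (3 / (e * D) ^ 4 - 3 * \<i> * k / (e * D) ^ 3 - k\<^sup>2 / (e * D)\<^sup>2))))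
        = w * - (E * (3 / D ^ 5 - 3 * \<i> * k * e / D ^ 4 - k\<^sup>2 * e\<^sup>2 / D ^ 3))" if "e \<noteq> 0" "D \<noteq> 0" for e D k w E :: complex
        using that by (simp add: field_simps power_numeral_reduce)
      from this[OF nz(2,1), of "W (x + \<epsilon> n *\<^sub>R z)" "exp (\<i> * of_real (\<kappa> * (\<epsilon> n * d z)))" "of_real \<kappa>"]
      show "(\<epsilon> n ^ 3) *\<^sub>R ?h (x + \<epsilon> n *\<^sub>R z) = W (x + \<epsilon> n *\<^sub>R z) * k n z"
        unfolding helmholtz_reg_kernel[OF \<epsilon>(1)] reg_dist_scale[OF \<epsilon>(1)] d_def[symmetric] k_def helm2_def scaleR_conv_of_real[where 'a=complex]
        by simp
    qed
    finally show ?thesis .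
  qed
  \<comment> \<open>Where W(x + \<epsilon> z) is nonzero, \<epsilon> |z| is at most A + |x|; with
    d(z) at most |z| + 1 this gives \<epsilon> d(z) \<le> M. The slower terms, of order d^-4 and
    d^-3, then become multiples of d^-5.\<close>
  define M where "M = A + norm x + 1"
  define C where "C = B * (3 + 3 * \<kappa> * M + \<kappa>\<^sup>2 * M\<^sup>2)"
  have M: "M > 0" unfolding M_def using assms(4) by (simp add: add_nonneg_pos)
  have bd: "norm (W (x + \<epsilon> n *\<^sub>R z) * k n z) \<le> C * (1 / d z ^ 5)" for n z
  proof (cases "norm (x + \<epsilon> n *\<^sub>R z) \<le> A")
    case False
    then show ?thesis using W(2)[of "x + \<epsilon> n *\<^sub>R z"] d[of z] B M assms(3) by (simp add: C_def)
  next
    case True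
    have "norm (\<epsilon> n *\<^sub>R z) \<le> norm (x + \<epsilon> n *\<^sub>R z) + norm x"
      by (metis add.commute add_diff_cancel norm_triangle_ineq4)
    with True have "\<epsilon> n * norm z \<le> A + norm x" using \<epsilon>(1)[of n] by simp
    moreover have "\<epsilon> n * d z \<le> \<epsilon> n * (norm z + 1)"
      unfolding d_def using \<epsilon>(1)[of n] reg_dist_le[of 1 0 z] by (intro mult_left_mono) auto
    ultimately have ed: "\<epsilon> n * d z \<le> M" using \<epsilon>[of n] unfolding M_def by (simp add: distrib_left)
    have ed0: "0 \<le> \<epsilon> n * d z" using \<epsilon>(1)[of n] d[of z] by (simp add: less_imp_le)
    have "norm (k n z) \<le> 3 / d z ^ 5 + 3 * \<kappa> * \<epsilon> n / d z ^ 4 + \<kappa>\<^sup>2 * (\<epsilon> n)\<^sup>2 / d z ^ 3"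
    proof -
      have "norm (k n z) = norm (3 / of_real (d z) ^ 5 - 3 * \<i> * of_real \<kappa> * of_real (\<epsilon> n) / of_real (d z) ^ 4 - of_real \<kappa> ^ 2 * of_real (\<epsilon> n) ^ 2 / complex_of_real (d z) ^ 3)"
        unfolding k_def norm_minus_cancel norm_mult norm_exp_i_times by simp
      also have "\<dots> \<le> norm (3 / complex_of_real (d z) ^ 5) + norm (3 * \<i> * of_real \<kappa> * of_real (\<epsilon> n) / complex_of_real (d z) ^ 4) + norm (of_real \<kappa> ^ 2 * of_real (\<epsilon> n) ^ 2 / complex_of_real (d z) ^ 3)"
        by (intro norm_triangle_le_diff add_right_mono) auto
      also have "\<dots> = 3 / d z ^ 5 + 3 * \<kappa> * \<epsilon> n / d z ^ 4 + \<kappa>\<^sup>2 * (\<epsilon> n)\<^sup>2 / d z ^ 3"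
        using d[of z] \<epsilon>(1)[of n] assms(3) by (simp add: norm_divide norm_mult norm_power)
      finally show ?thesis .
    qed
    also have "\<dots> = (3 + 3 * \<kappa> * (\<epsilon> n * d z) + \<kappa>\<^sup>2 * (\<epsilon> n * d z)\<^sup>2) * (1 / d z ^ 5)"
      using d[of z] by (simp add: field_simps power_numeral_reduce)
    also have "\<dots> \<le> (3 + 3 * \<kappa> * M + \<kappa>\<^sup>2 * M\<^sup>2) * (1 / d z ^ 5)"
      using ed ed0 d[of z] assms(3) by (intro mult_right_mono add_mono mult_left_mono power_mono) auto
    finally have "norm (k n z) \<le> (3 + 3 * \<kappa> * M + \<kappa>\<^sup>2 * M\<^sup>2) * (1 / d z ^ 5)" .
    then have "norm (W (x + \<epsilon> n *\<^sub>R z)) * norm (k n z) \<le> B * ((3 + 3 * \<kappa> * M + \<kappa>\<^sup>2 * M\<^sup>2) * (1 / d z ^ 5))"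
      using B by (intro mult_mono) (auto simp: less_imp_le)
    then show ?thesis by (simp add: norm_mult C_def mult.assoc)
  qed
  have lim: "(\<lambda>n. W (x + \<epsilon> n *\<^sub>R z) * k n z) \<longlonglongrightarrow> W x * (- (3 / of_real (d z) ^ 5))" for z
  proof -
    have "(\<lambda>n. W (x + \<epsilon> n *\<^sub>R z)) \<longlonglongrightarrow> W (x + 0 *\<^sub>R z)"
      by (rule continuous_on_tendsto_compose[OF W(1)], intro tendsto_intros \<epsilon>0) auto
    moreover have "k' \<longlonglongrightarrow> - (exp (\<i> * of_real (\<kappa> * (0 * d z))) *
      (3 / of_real (d z) ^ 5 - 3 * \<i> * of_real \<kappa> * of_real 0 / of_real (d z) ^ 4 - of_real \<kappa> ^ 2 * of_real 0 ^ 2 / of_real (d z) ^ 3))"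
      if "k' = (\<lambda>n. k n z)" for k'
      unfolding k_def that using d[of z] by (intro tendsto_intros \<epsilon>0) auto
    ultimately show ?thesis by (intro tendsto_mult) auto
  qed
  have cd: "continuous_on UNIV d" unfolding d_def by (rule continuous_on_reg_dist)
  have "(\<lambda>n. integral\<^sup>L lborel (\<lambda>z. W (x + \<epsilon> n *\<^sub>R z) * k n z)) \<longlonglongrightarrow> integral\<^sup>L lborel (\<lambda>z. W x * (- (3 / of_real (d z) ^ 5)))"
  proof (rule integral_dominated_convergence)
    show "integrable lborel (\<lambda>z. C * (1 / d z ^ 5))"
      unfolding d_def by (rule integrable_mult_right[OF integrable_reg_dist])
    have "continuous_on UNIV (\<lambda>z. W x * (- (3 / complex_of_real (d z) ^ 5)))"
      using d by (intro continuous_intros cd) (metis less_irrefl of_real_eq_0_iff power_not_zero)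
    then show "(\<lambda>z. W x * (- (3 / of_real (d z) ^ 5))) \<in> borel_measurable lborel"
      unfolding measurable_lborel2 by (rule borel_measurable_continuous_onI)
    fix n
    have dnz: "complex_of_real (d z) \<noteq> 0" for z using d[of z] by simp
    have "continuous_on UNIV (\<lambda>z. W (x + \<epsilon> n *\<^sub>R z) * k n z)"
      unfolding k_def using dnz
      by (intro continuous_intros cd continuous_on_compose2[OF W(1)]) auto
    then show "(\<lambda>z. W (x + \<epsilon> n *\<^sub>R z) * k n z) \<in> borel_measurable lborel"
      by (simp add: borel_measurable_continuous_onI)
  qed (use lim bd in auto)
  also have "integral\<^sup>L lborel (\<lambda>z. W x * (- (3 / complex_of_real (d z) ^ 5))) = - of_real kernel_mass * W x"
  proof -
    have "(\<lambda>z. W x * (- (3 / complex_of_real (d z) ^ 5))) = (\<lambda>z. (- 3 * W x) * of_real (1 / d z ^ 5))"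
      by (auto simp: fun_eq_iff field_simps)
    then show ?thesis
      unfolding kernel_mass_def d_def by (simp only: integral_mult_right_zero integral_complex_of_real) simp
  qed
  finally show ?thesis using scale unfolding \<epsilon>_def by simp
qed

text \<open>The source vanishes within distance \<delta> of x, so the singularity is never seen:
  wherever the source is nonzero all kernels are bounded by 1 / \<delta>.\<close>

lemma reg_kernel_limit:
  fixes f :: "'a::euclidean_space \<Rightarrow> complex"
  assumes f: "continuous_on UNIV f" "\<And>y. norm y > A \<Longrightarrow> f y = 0"
    and \<delta>: "\<delta> > 0" "\<And>y. norm (y - x) < \<delta> \<Longrightarrow> f y = 0"
  shows "(\<lambda>n. integral\<^sup>L lborel (\<lambda>y. reg_kernel \<kappa> (1 / Suc n) x y * f y))
     \<longlonglongrightarrow> integral\<^sup>L lborel (\<lambda>y. helm \<kappa> (norm (y - x)) * f y)"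
proof (rule integral_dominated_convergence)
  define \<epsilon> where "\<epsilon> = (\<lambda>n. 1 / real (Suc n))"
  have \<epsilon>: "\<epsilon> n > 0" for n by (auto simp: \<epsilon>_def)
  have \<epsilon>0: "\<epsilon> \<longlonglongrightarrow> 0"
    unfolding \<epsilon>_def using LIMSEQ_inverse_real_of_nat by (simp add: inverse_eq_divide)
  have "integrable lborel f" by (rule integrable_continuous_compact_support[OF f])
  then show "integrable lborel (\<lambda>y. (1 / \<delta>) * norm (f y))" by simp
  have bf: "f \<in> borel_measurable borel" using f(1) by (rule borel_measurable_continuous_onI)
  show "(\<lambda>y. helm \<kappa> (norm (y - x)) * f y) \<in> borel_measurable lborel"
    unfolding helm_def using bf by simp
  show "(\<lambda>y. reg_kernel \<kappa> (1 / Suc n) x y * f y) \<in> borel_measurable lborel" for n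
    unfolding reg_kernel_def helm_def reg_dist_def using bf by simp
  show "AE y in lborel. (\<lambda>n. reg_kernel \<kappa> (1 / Suc n) x y * f y) \<longlonglongrightarrow> helm \<kappa> (norm (y - x)) * f y"
  proof (rule AE_I2)
    fix y
    show "(\<lambda>n. reg_kernel \<kappa> (1 / Suc n) x y * f y) \<longlonglongrightarrow> helm \<kappa> (norm (y - x)) * f y"
    proof (cases "norm (y - x) < \<delta>")
      case False
      then have nz: "norm (y - x) \<noteq> 0" using \<delta>(1) by linarith
      have "(\<lambda>n. reg_dist (\<epsilon> n) x y) \<longlonglongrightarrow> sqrt ((y - x) \<bullet> (y - x) + 0\<^sup>2)"
        unfolding reg_dist_def by (intro tendsto_intros \<epsilon>0)
      then have "(\<lambda>n. reg_dist (\<epsilon> n) x y) \<longlonglongrightarrow> norm (y - x)" by (simp add: norm_eq_sqrt_inner)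
      then have "(\<lambda>n. helm \<kappa> (reg_dist (\<epsilon> n) x y)) \<longlonglongrightarrow> helm \<kappa> (norm (y - x))"
        unfolding helm_def using nz by (intro tendsto_intros) auto
      then show ?thesis unfolding reg_kernel_def \<epsilon>_def by (intro tendsto_mult) auto
    qed (simp add: \<delta>)
  qed
  show "AE y in lborel. norm (reg_kernel \<kappa> (1 / Suc n) x y * f y) \<le> (1 / \<delta>) * norm (f y)" for n
  proof (rule AE_I2)
    fix y
    show "norm (reg_kernel \<kappa> (1 / Suc n) x y * f y) \<le> (1 / \<delta>) * norm (f y)"
    proof (cases "norm (y - x) < \<delta>")
      case False
      then have "\<delta> \<le> reg_dist (1 / Suc n) x y" using reg_dist_ge[of y x "1 / Suc n"] by simp
      then have "norm (reg_kernel \<kappa> (1 / Suc n) x y) \<le> 1 / \<delta>"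
        unfolding reg_kernel_def helm_def norm_divide norm_exp_i_times using \<delta>(1) by (simp add: frac_le)
      then show ?thesis unfolding norm_mult by (rule mult_right_mono) simp
    qed (simp add: \<delta>)
  qed
qed

section \<open>The representation formula for radiating functions\<close>

text \<open>The kernel radiates as a function of y, uniformly in \<epsilon> \<le> 1. The distance r
  differs from |y| by at most |x| + 1, and P = y . (y - x) agrees with |y| r up to O(|y|), so the
  terms of leading order in i \<kappa> cancel. The constants 2 and 4 come from r \<ge> |y| /
  2.\<close>

lemma kernel_sommerfeld:
  fixes x y :: "real^3"
  assumes \<kappa>: "\<kappa> > 0" and \<epsilon>: "0 < \<epsilon>" "\<epsilon> \<le> 1" and y: "norm y \<ge> 2 * norm x" "norm y > 0"
  shows "norm (reg_kernel \<kappa> \<epsilon> x y) \<le> 2 / norm y"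
    "norm (\<i> * of_real (\<kappa> * norm y) * reg_kernel \<kappa> \<epsilon> x y - (\<Sum>b\<in>Basis. of_real (y \<bullet> b) * reg_kernel1 \<kappa> \<epsilon> x b y))
       \<le> 4 * (\<kappa> * (2 * norm x + 1) + 1) / norm y"
proof -
  define r where "r = reg_dist \<epsilon> x y"
  have r: "r > 0" unfolding r_def using \<epsilon>(1) by (rule reg_dist_pos)
  have yx: "norm (y - x) \<le> r" unfolding r_def by (rule reg_dist_ge)
  have ryx: "r \<le> norm (y - x) + \<epsilon>" unfolding r_def using \<epsilon> by (intro reg_dist_le) auto
  have t: "norm y - norm x \<le> norm (y - x)" "norm (y - x) \<le> norm y + norm x"
    by (rule norm_triangle_ineq2 norm_triangle_ineq4)+
  have ry: "norm y / 2 \<le> r" using yx t y by linarith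
  show "norm (reg_kernel \<kappa> \<epsilon> x y) \<le> 2 / norm y"
  proof -
    have "1 / r \<le> 1 / (norm y / 2)" using ry y r by (intro divide_left_mono) auto
    then show ?thesis
      unfolding reg_kernel_def helm_def norm_divide norm_exp_i_times r_def[symmetric] using r by simp
  qed
  define P where "P = y \<bullet> (y - x)"
  have "(\<Sum>b\<in>Basis. of_real (y \<bullet> b) * reg_kernel1 \<kappa> \<epsilon> x b y) = of_real (\<Sum>b\<in>Basis. (y \<bullet> b) * ((y - x) \<bullet> b)) * helm1 \<kappa> r"
    unfolding reg_kernel1_def r_def[symmetric] by (simp add: sum_distrib_right mult.assoc)
  also have "(\<Sum>b\<in>Basis. (y \<bullet> b) * ((y - x) \<bullet> b)) = P"
    unfolding P_def by (rule euclidean_inner[symmetric])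
  finally have DK: "(\<Sum>b\<in>Basis. of_real (y \<bullet> b) * reg_kernel1 \<kappa> \<epsilon> x b y) = of_real P * helm1 \<kappa> r" .
  have "\<i> * of_real (\<kappa> * norm y) * helm \<kappa> r - of_real P * helm1 \<kappa> r
      = exp (\<i> * of_real (\<kappa> * r)) * (\<i> * of_real (\<kappa> * (norm y * r - P) / r\<^sup>2) + of_real (P / r ^ 3))"
    unfolding helm_def helm1_def using r by (simp add: field_simps power2_eq_square power3_eq_cube)
  then have "norm (\<i> * of_real (\<kappa> * norm y) * helm \<kappa> r - of_real P * helm1 \<kappa> r)
     = norm (\<i> * complex_of_real (\<kappa> * (norm y * r - P) / r\<^sup>2) + of_real (P / r ^ 3))"
    by (simp only: norm_mult norm_exp_i_times mult_1)
  also have "\<dots> \<le> norm (\<i> * complex_of_real (\<kappa> * (norm y * r - P) / r\<^sup>2)) + norm (complex_of_real (P / r ^ 3))"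
    by (rule norm_triangle_ineq)
  also have "\<dots> = \<kappa> * \<bar>norm y * r - P\<bar> / r\<^sup>2 + \<bar>P\<bar> / r ^ 3"
    using \<kappa> r by (simp only: norm_mult norm_ii norm_of_real mult_1 abs_mult abs_divide) simp
  also have "\<dots> \<le> (\<kappa> * (2 * norm x + 1) + 1) * (norm y / r\<^sup>2)"
  proof -
    \<comment> \<open>This identity exhibits the cancellation: two quantities of size |y|^2 differ
      only by |y| (r - |y|) and y . x.\<close>
    have "norm y * r - P = norm y * (r - norm y) + y \<bullet> x"
      unfolding P_def by (simp add: algebra_simps dot_square_norm power2_eq_square)
    then have "\<bar>norm y * r - P\<bar> \<le> norm y * \<bar>r - norm y\<bar> + \<bar>y \<bullet> x\<bar>"
      by (metis abs_mult abs_norm_cancel abs_triangle_ineq)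
    also have "\<dots> \<le> norm y * (norm x + 1) + norm y * norm x"
      using yx ryx t \<epsilon> by (intro add_mono mult_left_mono Cauchy_Schwarz_ineq2) auto
    finally have 1: "\<bar>norm y * r - P\<bar> \<le> norm y * (2 * norm x + 1)" by (simp add: algebra_simps)
    have "\<bar>P\<bar> \<le> norm y * norm (y - x)" unfolding P_def by (rule Cauchy_Schwarz_ineq2)
    also have "\<dots> \<le> norm y * r" using yx by (intro mult_left_mono) auto
    finally have 2: "\<bar>P\<bar> \<le> norm y * r" .
    have "\<kappa> * \<bar>norm y * r - P\<bar> / r\<^sup>2 + \<bar>P\<bar> / r ^ 3 \<le> \<kappa> * (norm y * (2 * norm x + 1)) / r\<^sup>2 + norm y * r / r ^ 3"
      using 1 2 \<kappa> r by (intro add_mono divide_right_mono mult_left_mono) auto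
    also have "\<dots> = (\<kappa> * (2 * norm x + 1) + 1) * (norm y / r\<^sup>2)"
      using r by (simp add: field_simps power2_eq_square power3_eq_cube)
    finally show ?thesis .
  qed
  also have "\<dots> \<le> (\<kappa> * (2 * norm x + 1) + 1) * (4 / norm y)"
  proof (intro mult_left_mono)
    have "(norm y / 2)\<^sup>2 \<le> r\<^sup>2" using ry by (intro power_mono) auto
    then have "norm y * norm y \<le> 4 * r\<^sup>2" by (simp add: power2_eq_square)
    then show "norm y / r\<^sup>2 \<le> 4 / norm y" using r y by (simp add: field_simps)
  qed (use \<kappa> in auto)
  finally show "norm (\<i> * of_real (\<kappa> * norm y) * reg_kernel \<kappa> \<epsilon> x y - (\<Sum>b\<in>Basis. of_real (y \<bullet> b) * reg_kernel1 \<kappa> \<epsilon> x b y))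
       \<le> 4 * (\<kappa> * (2 * norm x + 1) + 1) / norm y"
    unfolding DK by (simp add: reg_kernel_def r_def mult.commute)
qed

section \<open>Flux through large shells\<close>

text \<open>The gradient of \<open>radial_cutoff 0 R\<close> at y is -w(y) y with this scalar w. It
  takes over the role of surface measure on a large sphere: nonnegative, at most 18 / R^2 (18 = 2 *
  9 from the bound on \<open>cutoff1\<close>), and zero off the shell R < |y| < 2 R.\<close>

definition cutoff_weight :: "real \<Rightarrow> 'a::euclidean_space \<Rightarrow> real" where
  "cutoff_weight R y = - (2 / R\<^sup>2) * cutoff1 (y \<bullet> y / R\<^sup>2)"

lemma radial_cutoff1_weight: "radial_cutoff1 0 R b y = - (cutoff_weight R y * (y \<bullet> b))"
  unfolding radial_cutoff1_def cutoff_weight_def by simp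

lemma cutoff_weight_bounds:
  assumes "R > 0" shows "0 \<le> cutoff_weight R y" "cutoff_weight R y \<le> 18 / R\<^sup>2"
proof -
  show "0 \<le> cutoff_weight R y"
    unfolding cutoff_weight_def using cutoff1_nonpos[of "y \<bullet> y / R\<^sup>2"]
    by (simp add: divide_nonpos_nonneg mult_nonneg_nonpos)
  have "(2 / R\<^sup>2) * (- cutoff1 (y \<bullet> y / R\<^sup>2)) \<le> (2 / R\<^sup>2) * 9"
    using cutoff1_ge[of "y \<bullet> y / R\<^sup>2"] by (intro mult_left_mono) auto
  then show "cutoff_weight R y \<le> 18 / R\<^sup>2" unfolding cutoff_weight_def by simp
qed

lemma cutoff_weight_eq_0:
  assumes "R > 0" "norm y \<le> R \<or> norm y \<ge> 2 * R"
  shows "cutoff_weight R y = 0"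
proof -
  have "y \<bullet> y / R\<^sup>2 \<le> 1 \<or> y \<bullet> y / R\<^sup>2 \<ge> 2"
    using assms power_mono[of "2 * R" "norm y" 2] power_mono[of "norm y" R 2]
    by (auto simp: dot_square_norm field_simps power2_eq_square)
  then show ?thesis
    unfolding cutoff_weight_def by (simp add: cutoff1_eq_0)
qed

lemma continuous_on_cutoff_weight: "R > 0 \<Longrightarrow> continuous_on S (cutoff_weight R)"
proof -
  assume R: "R > 0"
  have c: "continuous_on UNIV cutoff1"
    by (intro continuous_at_imp_continuous_on ballI DERIV_isCont[OF DERIV_cutoff1])
  show ?thesis
    unfolding cutoff_weight_def[abs_def]
    by (intro continuous_intros continuous_on_compose2[OF c]) (use R in auto)
qed

text \<open>Since the gradient of the cutoff is radial, the boundary term sees v and K only through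
  y . grad v and y . grad K, the derivatives that the radiation condition controls.\<close>

lemma green_radial:
  fixes v K :: "'a::euclidean_space \<Rightarrow> complex"
  assumes v: "C2_data UNIV v v1 v2" and K: "C2_data UNIV K K1 K2" and R: "R > 0"
  shows "integral\<^sup>L lborel (\<lambda>y. of_real (radial_cutoff 0 R y) * (K y * helmholtz \<kappa> v v2 y - v y * helmholtz \<kappa> K K2 y))
    = integral\<^sup>L lborel (\<lambda>y. of_real (cutoff_weight R y) *
        (K y * (\<Sum>b\<in>Basis. of_real (y \<bullet> b) * v1 b y) - v y * (\<Sum>b\<in>Basis. of_real (y \<bullet> b) * K1 b y)))"
proof -
  note c = C2_dataD[OF C2_data_radial_cutoff[of R UNIV 0]]
  have "integral\<^sup>L lborel (\<lambda>y. of_real (radial_cutoff 0 R y) * (K y * helmholtz \<kappa> v v2 y - v y * helmholtz \<kappa> K K2 y))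
    = - integral\<^sup>L lborel (\<lambda>y. \<Sum>b\<in>Basis. of_real (radial_cutoff1 0 R b y) * (K y * v1 b y - v y * K1 b y))"
  proof (rule green_cutoff[OF v K, where A = "2 * R"])
    show "continuous_on UNIV (\<lambda>y. complex_of_real (radial_cutoff 0 R y))"
      "b \<in> Basis \<Longrightarrow> continuous_on UNIV (\<lambda>y. complex_of_real (radial_cutoff1 0 R b y))" for b
      using R by (auto intro!: continuous_intros c)
    show "has_pd b (\<lambda>y. complex_of_real (radial_cutoff 0 R y)) (of_real (radial_cutoff1 0 R b x)) x" if "b \<in> Basis" for b x
      by (rule has_pd_bounded_linear[OF bounded_linear_of_real]) (use R that c in auto)
    fix x :: 'a assume "norm x > 2 * R"
    then show "complex_of_real (radial_cutoff 0 R x) = 0" "complex_of_real (radial_cutoff1 0 R b x) = 0" for b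
      using R radial_cutoff_eq_0[of R x 0] radial_cutoff1_eq_0[of R x 0] by auto
  qed
  also have "\<dots> = integral\<^sup>L lborel (\<lambda>y. - (\<Sum>b\<in>Basis. of_real (radial_cutoff1 0 R b y) * (K y * v1 b y - v y * K1 b y)))"
    by simp
  also have "(\<lambda>y. - (\<Sum>b\<in>Basis. of_real (radial_cutoff1 0 R b y) * (K y * v1 b y - v y * K1 b y)))
      = (\<lambda>y. of_real (cutoff_weight R y) *
        (K y * (\<Sum>b\<in>Basis. of_real (y \<bullet> b) * v1 b y) - v y * (\<Sum>b\<in>Basis. of_real (y \<bullet> b) * K1 b y)))"
    by (simp add: fun_eq_iff radial_cutoff1_weight sum_distrib_left sum_negf sum_subtractf algebra_simps)
  finally show ?thesis .
qed

lemma integrable_indicator_cball: "integrable lborel (\<lambda>y::'a::euclidean_space. c * indicator (cball 0 R) y :: real)"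
  using emeasure_lborel_cball_finite[of "0::'a" R]
  by (intro integrable_mult_right integrable_real_indicator) auto

lemma integral_indicator_cball:
  "R \<ge> 0 \<Longrightarrow> integral\<^sup>L lborel (\<lambda>y::real^3. c * indicator (cball 0 R) y) = c * (unit_ball_vol 3 * R ^ 3)"
  using content_cball[of R "0::real^3"] by (simp add: measure_def)

text \<open>The Sommerfeld condition with the factor |y| multiplied in: |y| times the radial
  derivative is y . grad v, so no unit vector has to be formed.\<close>

definition radiating :: "real \<Rightarrow> ('a::euclidean_space \<Rightarrow> complex) \<Rightarrow> ('a \<Rightarrow> 'a \<Rightarrow> complex) \<Rightarrow> bool" where
  "radiating \<kappa> v v1 \<longleftrightarrow> (\<forall>\<delta>>0. \<exists>R0. \<forall>y. norm y \<ge> R0 \<longrightarrow>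
     norm ((\<Sum>b\<in>Basis. of_real (y \<bullet> b) * v1 b y) - \<i> * of_real (\<kappa> * norm y) * v y) \<le> \<delta>)"

lemma young_sq: "c > 0 \<Longrightarrow> 2 * a * b \<le> c * a\<^sup>2 + b\<^sup>2 / (c::real)"
proof -
  assume "c > 0"
  have "0 \<le> (c * a - b)\<^sup>2 / c" using \<open>c > 0\<close> by simp
  also have "\<dots> = c * a\<^sup>2 + b\<^sup>2 / c - 2 * a * b"
    using \<open>c > 0\<close> by (simp add: power2_eq_square field_simps)
  finally show ?thesis by simp
qed

lemma integral_add_indicator_cball:
  fixes g :: "real^3 \<Rightarrow> real"
  assumes g: "integrable lborel g" and R: "R \<ge> 0"
  shows "integral\<^sup>L lborel (\<lambda>y. a * g y + c * indicator (cball 0 R) y) = a * integral\<^sup>L lborel g + c * (unit_ball_vol 3 * R ^ 3)"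
proof -
  have "integral\<^sup>L lborel (\<lambda>y. a * g y + c * indicator (cball 0 R) y)
      = integral\<^sup>L lborel (\<lambda>y. a * g y) + integral\<^sup>L lborel (\<lambda>y::real^3. c * indicator (cball 0 R) y)"
    by (rule Bochner_Integration.integral_add) (intro integrable_mult_right g integrable_indicator_cball)+
  then show ?thesis unfolding integral_indicator_cball[OF R] unfolding integral_mult_right_zero .
qed

text \<open>Green's formula with the conjugate of v as second function has a volume term J that does
  not depend on R. Its boundary term is the flux Im (cnj v * (y . grad v)), which radiation turns
  into \<kappa> |y| |v|^2 up to a controllable error. Hence the weighted L2 mass on shells is
  bounded although no decay of v is known.\<close>

lemma radiating_flux_bound:
  fixes v :: "real^3 \<Rightarrow> complex"
  assumes \<kappa>: "\<kappa> > 0" and v: "C2_data UNIV v v1 v2"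
    and f: "\<And>y. norm y > A \<Longrightarrow> helmholtz \<kappa> v v2 y = 0" and rad: "radiating \<kappa> v v1"
  obtains C R0 where "C \<ge> 0" "\<And>R. R \<ge> R0 \<Longrightarrow> R > 0 \<Longrightarrow>
      integral\<^sup>L lborel (\<lambda>y. cutoff_weight R y * (norm y * (norm (v y))\<^sup>2)) \<le> C"
proof -
  let ?f = "helmholtz \<kappa> v v2"
  let ?D = "\<lambda>y. \<Sum>b\<in>Basis. of_real (y \<bullet> b) * v1 b y"
  obtain R1 where R1: "\<And>y. norm y \<ge> R1 \<Longrightarrow> norm (?D y - \<i> * of_real (\<kappa> * norm y) * v y) \<le> 1"
    using rad unfolding radiating_def by (meson zero_less_one)
  define R0 where "R0 = max A R1"
  define J where "J = integral\<^sup>L lborel (\<lambda>y. cnj (v y) * ?f y - v y * cnj (?f y))"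
  \<comment> \<open>The second summand is the error 18 / (\<kappa>^2 R^3) integrated over the ball
    of radius 2 R, whose volume carries 8 R^3; the result no longer depends on R.\<close>
  define C where "C = (2 / \<kappa>) * (norm J / 2 + 72 / \<kappa> * unit_ball_vol 3)"
  have hc: "helmholtz \<kappa> (\<lambda>x. cnj (v x)) (\<lambda>b x. cnj (v2 b x)) y = cnj (?f y)" for y
    unfolding helmholtz_def by simp
  note cv = C2_dataD[OF v]
  have "integral\<^sup>L lborel (\<lambda>y. cutoff_weight R y * (norm y * (norm (v y))\<^sup>2)) \<le> C"
    if R: "R \<ge> R0" "R > 0" for R
  proof -
    let ?w = "cutoff_weight R"
    note wb = cutoff_weight_bounds[OF R(2)]
    have w0: "?w y = 0" if "norm y > 2 * R" for y
      using cutoff_weight_eq_0[OF R(2), of y] that by simp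
    have green: "J = integral\<^sup>L lborel (\<lambda>y. of_real (?w y) * (cnj (v y) * ?D y - v y * cnj (?D y)))"
    proof -
      have pe: "of_real (radial_cutoff 0 R y) * (cnj (v y) * ?f y - v y * cnj (?f y)) = cnj (v y) * ?f y - v y * cnj (?f y)" for y
        using radial_cutoff_eq_1[OF R(2), of y 0] f[of y] R(1) unfolding R0_def
        by (cases "norm y \<le> R") auto
      have cD: "(\<Sum>b\<in>Basis. of_real (y \<bullet> b) * cnj (v1 b y)) = cnj (?D y)" for y
        by simp
      show ?thesis
        using green_radial[OF v C2_data_cnj[OF v] R(2), of \<kappa>] unfolding J_def hc pe cD .
    qed
    have eq: "of_real (?w y) * (cnj (v y) * ?D y - v y * cnj (?D y)) = \<i> * of_real (2 * ?w y * Im (cnj (v y) * ?D y))" for y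
    proof -
      have "of_real w * (cnj a * D - a * cnj D) = \<i> * of_real (2 * w * Im (cnj a * D))" for w and a D :: complex
        by (rule complex_eqI) (auto simp: algebra_simps)
      then show ?thesis .
    qed
    have cw: "continuous_on UNIV ?w" by (rule continuous_on_cutoff_weight[OF R(2)])
    have int1: "integrable lborel (\<lambda>y. ?w y * Im (cnj (v y) * ?D y))"
      by (rule integrable_continuous_compact_support[of _ "2 * R"])
         (auto intro!: continuous_intros cw cv simp: w0)
    have int2: "integrable lborel (\<lambda>y. ?w y * (norm y * (norm (v y))\<^sup>2))"
      by (rule integrable_continuous_compact_support[of _ "2 * R"])
         (auto intro!: continuous_intros cw cv simp: w0)
    have "J = integral\<^sup>L lborel (\<lambda>y. \<i> * of_real (2 * (?w y * Im (cnj (v y) * ?D y))))"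
      unfolding green eq by (simp add: mult.assoc)
    also have "\<dots> = \<i> * of_real (2 * integral\<^sup>L lborel (\<lambda>y. ?w y * Im (cnj (v y) * ?D y)))"
      by (simp only: integral_mult_right_zero integral_complex_of_real)
    finally have "norm J = 2 * \<bar>integral\<^sup>L lborel (\<lambda>y. ?w y * Im (cnj (v y) * ?D y))\<bar>"
      by (simp add: norm_mult)
    then have Jb: "integral\<^sup>L lborel (\<lambda>y. ?w y * Im (cnj (v y) * ?D y)) \<le> norm J / 2" by linarith
    have pt: "?w y * (norm y * (norm (v y))\<^sup>2) \<le> (2 / \<kappa>) * (?w y * Im (cnj (v y) * ?D y)) + (18 / (\<kappa>\<^sup>2 * R ^ 3)) * indicator (cball 0 (2 * R)) y" for y
    proof (cases "R < norm y \<and> norm y < 2 * R")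
      case False
      then have "?w y = 0" using cutoff_weight_eq_0[OF R(2), of y] by auto
      then show ?thesis using R(2) by simp
    next
      case True
      have ny: "norm y > 0" using True R(2) by linarith
      define e where "e = ?D y - \<i> * of_real (\<kappa> * norm y) * v y"
      have e: "norm e \<le> 1" unfolding e_def by (rule R1) (use True R(1) R0_def in auto)
      have "cnj (v y) * ?D y = cnj (v y) * e + \<i> * of_real (\<kappa> * norm y * (norm (v y))\<^sup>2)"
        unfolding e_def of_real_mult complex_norm_square by (simp add: algebra_simps)
      then have "Im (cnj (v y) * ?D y) = Im (cnj (v y) * e) + \<kappa> * norm y * (norm (v y))\<^sup>2"
        by simp
      moreover have "\<bar>Im (cnj (v y) * e)\<bar> \<le> norm (v y)"
        using abs_Im_le_cmod[of "cnj (v y) * e"] e mult_left_le[of "norm e" "norm (v y)"]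
        by (simp add: norm_mult)
      \<comment> \<open>Young's inequality with weight \<kappa> |y| lets half of the main term
        absorb the error |v|.\<close>
      moreover have "2 * norm (v y) * 1 \<le> (\<kappa> * norm y) * (norm (v y))\<^sup>2 + 1\<^sup>2 / (\<kappa> * norm y)"
        by (rule young_sq) (use \<kappa> ny in simp)
      ultimately have "\<kappa> * norm y * (norm (v y))\<^sup>2 / 2 \<le> Im (cnj (v y) * ?D y) + 1 / (2 * (\<kappa> * norm y))"
        by simp
      also have "1 / (2 * (\<kappa> * norm y)) \<le> 1 / (2 * (\<kappa> * R))"
        using \<kappa> True R(2) ny by (intro divide_left_mono mult_left_mono mult_pos_pos) auto
      finally have "?w y * (\<kappa> * norm y * (norm (v y))\<^sup>2 / 2) \<le> ?w y * (Im (cnj (v y) * ?D y) + 1 / (2 * (\<kappa> * R)))"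
        using wb(1) by (intro mult_left_mono) auto
      also have "\<dots> \<le> ?w y * Im (cnj (v y) * ?D y) + (18 / R\<^sup>2) * (1 / (2 * (\<kappa> * R)))"
        unfolding distrib_left using wb(2) \<kappa> R(2) by (intro add_left_mono mult_right_mono) auto
      finally have "(2 / \<kappa>) * (?w y * (\<kappa> * norm y * (norm (v y))\<^sup>2 / 2)) \<le> (2 / \<kappa>) * (?w y * Im (cnj (v y) * ?D y) + (18 / R\<^sup>2) * (1 / (2 * (\<kappa> * R))))"
        using \<kappa> by (intro mult_left_mono) auto
      moreover have "(2 / \<kappa>) * (?w y * (\<kappa> * norm y * (norm (v y))\<^sup>2 / 2)) = ?w y * (norm y * (norm (v y))\<^sup>2)"
        using \<kappa> by simp
      moreover have "(2 / \<kappa>) * ((18 / R\<^sup>2) * (1 / (2 * (\<kappa> * R)))) = 18 / (\<kappa>\<^sup>2 * R ^ 3)"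
        using \<kappa> R(2) by (simp add: field_simps power2_eq_square power3_eq_cube)
      ultimately show ?thesis using True by (simp add: distrib_left)
    qed
    have "integral\<^sup>L lborel (\<lambda>y. ?w y * (norm y * (norm (v y))\<^sup>2))
        \<le> integral\<^sup>L lborel (\<lambda>y. (2 / \<kappa>) * (?w y * Im (cnj (v y) * ?D y)) + (18 / (\<kappa>\<^sup>2 * R ^ 3)) * indicator (cball 0 (2 * R)) y)"
      by (intro integral_mono int2 pt Bochner_Integration.integrable_add integrable_mult_right int1 integrable_indicator_cball)
    also have "\<dots> = (2 / \<kappa>) * integral\<^sup>L lborel (\<lambda>y. ?w y * Im (cnj (v y) * ?D y)) + (18 / (\<kappa>\<^sup>2 * R ^ 3)) * (unit_ball_vol 3 * (2 * R) ^ 3)"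
      using R(2) by (intro integral_add_indicator_cball int1) auto
    also have "\<dots> \<le> (2 / \<kappa>) * (norm J / 2) + (18 / (\<kappa>\<^sup>2 * R ^ 3)) * (unit_ball_vol 3 * (2 * R) ^ 3)"
      using Jb \<kappa> by (intro add_right_mono mult_left_mono) auto
    also have "\<dots> = C"
      unfolding C_def using \<kappa> R(2) by (simp add: field_simps power2_eq_square power3_eq_cube)
    finally show ?thesis .
  qed
  moreover have "C \<ge> 0" unfolding C_def using \<kappa> by simp
  ultimately show ?thesis using that by blast
qed

text \<open>The boundary term of Green's formula tends to \<open>0\<close>: \<open>v\<close> and the kernel satisfy the same
  radiation condition, so the leading parts \<open>\<i>\<kappa>Kv\<close> cancel.\<close>

lemma helmholtz_representation:
  fixes v :: "real^3 \<Rightarrow> complex"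
  assumes \<kappa>: "\<kappa> > 0" and v: "C2_data UNIV v v1 v2"
    and f: "\<And>y. norm y > A \<Longrightarrow> helmholtz \<kappa> v v2 y = 0" and rad: "radiating \<kappa> v v1"
    and \<delta>: "\<delta> > 0" "\<And>y. norm (y - x) < \<delta> \<Longrightarrow> helmholtz \<kappa> v v2 y = 0"
  shows "v x = - (1 / of_real kernel_mass) * integral\<^sup>L lborel (\<lambda>y. helm \<kappa> (norm (y - x)) * helmholtz \<kappa> v v2 y)"
proof -
  let ?f = "helmholtz \<kappa> v v2"
  let ?D = "\<lambda>y. \<Sum>b\<in>Basis. of_real (y \<bullet> b) * v1 b y"
  define I where "I = integral\<^sup>L lborel (\<lambda>y. helm \<kappa> (norm (y - x)) * ?f y)"
  define \<epsilon> where "\<epsilon> = (\<lambda>n. 1 / real (Suc n))"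
  have \<epsilon>: "0 < \<epsilon> n" "\<epsilon> n \<le> 1" for n by (auto simp: \<epsilon>_def)
  obtain C R0 where C: "C \<ge> 0" "\<And>R. R \<ge> R0 \<Longrightarrow> R > 0 \<Longrightarrow>
      integral\<^sup>L lborel (\<lambda>y. cutoff_weight R y * (norm y * (norm (v y))\<^sup>2)) \<le> C"
    using radiating_flux_bound[OF \<kappa> v f rad] by blast
  define C2 where "C2 = 4 * (\<kappa> * (2 * norm x + 1) + 1)"
  have C2: "C2 \<ge> 0" unfolding C2_def using \<kappa> by simp
  let ?V = "unit_ball_vol 3 :: real"
  \<comment> \<open>Collects the parts of the boundary estimate that decay like 1 / R: 72 V C2 from
    the constant part integrated over the ball of radius 2 R, and C2 C / 2 from the flux
    bound.\<close>
  define Q where "Q = 72 * ?V * C2 + C2 * C / 2"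
  have Q: "Q \<ge> 0" unfolding Q_def using C2 C(1) by simp
  note cv = C2_dataD[OF v]
  have cf: "continuous_on UNIV ?f" by (rule continuous_on_helmholtz[OF v])
  \<comment> \<open>Here d is the error allowed in the radiation condition for v. The estimate is
    proved for each \<open>\<epsilon> n\<close> with the same right-hand side, so it survives the
    limit n to infinity at fixed R; R grows only afterwards.\<close>
  have main: "norm (I + of_real kernel_mass * v x) \<le> 288 * ?V * d + Q / R"
    if d: "d > 0" and R: "R \<ge> R0" "R > 0" "R \<ge> A" "R \<ge> 2 * norm x" "R \<ge> R1" 
      and R1: "\<And>y. norm y \<ge> R1 \<Longrightarrow> norm (?D y - \<i> * of_real (\<kappa> * norm y) * v y) \<le> d" for d R R1
  proof -
    let ?w = "cutoff_weight R" and ?\<eta> = "radial_cutoff 0 R"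
    note wb = cutoff_weight_bounds[OF R(2)]
    have w0: "?w y = 0" if "norm y > 2 * R" for y
      using cutoff_weight_eq_0[OF R(2), of y] that by simp
    have cw: "continuous_on UNIV ?w" by (rule continuous_on_cutoff_weight[OF R(2)])
    have c\<eta>: "continuous_on UNIV ?\<eta>" using C2_dataD(1)[OF C2_data_radial_cutoff[of R UNIV 0]] R(2) by simp
    have \<eta>0: "?\<eta> y = 0" if "norm y > 2 * R" for y
      using radial_cutoff_eq_0[OF R(2), of y 0] that by simp
    have \<eta>f: "of_real (?\<eta> y) * ?f y = ?f y" for y
      using radial_cutoff_eq_1[OF R(2), of y 0] f[of y] R(3) by (cases "norm y \<le> R") auto
    have step: "norm (integral\<^sup>L lborel (\<lambda>y. reg_kernel \<kappa> (\<epsilon> n) x y * ?f y)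
        - integral\<^sup>L lborel (\<lambda>y. (of_real (?\<eta> y) * v y) * helmholtz \<kappa> (reg_kernel \<kappa> (\<epsilon> n) x) (reg_kernel2 \<kappa> (\<epsilon> n) x) y))
        \<le> 288 * ?V * d + Q / R" for n
    proof -
      let ?K = "reg_kernel \<kappa> (\<epsilon> n) x" and ?K1 = "reg_kernel1 \<kappa> (\<epsilon> n) x" and ?K2 = "reg_kernel2 \<kappa> (\<epsilon> n) x"
      let ?DK = "\<lambda>y. \<Sum>b\<in>Basis. of_real (y \<bullet> b) * ?K1 b y"
      have K: "C2_data UNIV ?K ?K1 ?K2" by (rule C2_data_reg_kernel[OF \<epsilon>(1)])
      note cK = C2_dataD[OF K]
      have i1: "integrable lborel (\<lambda>y. ?K y * ?f y)"
        by (rule integrable_continuous_compact_support[of _ A]) (auto intro!: continuous_intros cf cK simp: f)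
      have i2: "integrable lborel (\<lambda>y. (of_real (?\<eta> y) * v y) * helmholtz \<kappa> ?K ?K2 y)"
        by (rule integrable_continuous_compact_support[of _ "2 * R"])
           (auto intro!: continuous_intros cv c\<eta> continuous_on_helmholtz[OF K] simp: \<eta>0)
      have "integral\<^sup>L lborel (\<lambda>y. ?K y * ?f y) - integral\<^sup>L lborel (\<lambda>y. (of_real (?\<eta> y) * v y) * helmholtz \<kappa> ?K ?K2 y)
          = integral\<^sup>L lborel (\<lambda>y. ?K y * ?f y - (of_real (?\<eta> y) * v y) * helmholtz \<kappa> ?K ?K2 y)"
        by (rule Bochner_Integration.integral_diff[OF i1 i2, symmetric])
      also have "(\<lambda>y. ?K y * ?f y - (of_real (?\<eta> y) * v y) * helmholtz \<kappa> ?K ?K2 y)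
          = (\<lambda>y. of_real (?\<eta> y) * (?K y * ?f y - v y * helmholtz \<kappa> ?K ?K2 y))"
      proof
        fix y
        have "?K y * ?f y = of_real (?\<eta> y) * (?K y * ?f y)"
          using \<eta>f[of y] by (metis mult.left_commute)
        then show "?K y * ?f y - (of_real (?\<eta> y) * v y) * helmholtz \<kappa> ?K ?K2 y
          = of_real (?\<eta> y) * (?K y * ?f y - v y * helmholtz \<kappa> ?K ?K2 y)"
          by (simp add: right_diff_distrib mult.assoc)
      qed
      also have "integral\<^sup>L lborel \<dots> = integral\<^sup>L lborel (\<lambda>y. of_real (?w y) * (?K y * ?D y - v y * ?DK y))"
        by (rule green_radial[OF v K R(2)])
      finally have eq: "integral\<^sup>L lborel (\<lambda>y. ?K y * ?f y) - integral\<^sup>L lborel (\<lambda>y. (of_real (?\<eta> y) * v y) * helmholtz \<kappa> ?K ?K2 y)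
          = integral\<^sup>L lborel (\<lambda>y. of_real (?w y) * (?K y * ?D y - v y * ?DK y))" .
      have pt: "norm (of_real (?w y) * (?K y * ?D y - v y * ?DK y))
          \<le> (C2 / (2 * R)) * (?w y * (norm y * (norm (v y))\<^sup>2))
            + ((18 / R\<^sup>2) * (2 * d / R + C2 / (2 * R\<^sup>2))) * indicator (cball 0 (2 * R)) y" for y
      proof (cases "R < norm y \<and> norm y < 2 * R")
        case False
        then have "?w y = 0" using cutoff_weight_eq_0[OF R(2), of y] by auto
        then show ?thesis using R(2) d C2 by (simp add: indicator_def)
      next
        case True
        then have y: "norm y > 0" "norm y \<ge> 2 * norm x" "norm y \<ge> R1" using R by linarith+
        note ks = kernel_sommerfeld[OF \<kappa> \<epsilon>, of x y n, OF y(2,1), folded C2_def]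
        define e where "e = ?D y - \<i> * of_real (\<kappa> * norm y) * v y"
        have e: "norm e \<le> d" unfolding e_def by (rule R1[OF y(3)])
        \<comment> \<open>The common term i \<kappa> |y| K v is subtracted and added back; what is
          left contains one radiation defect of v and one of the kernel.\<close>
        have "?K y * ?D y - v y * ?DK y = ?K y * e + v y * (\<i> * of_real (\<kappa> * norm y) * ?K y - ?DK y)"
          unfolding e_def by (simp add: algebra_simps)
        then have "norm (?K y * ?D y - v y * ?DK y) \<le> norm (?K y) * norm e + norm (v y) * norm (\<i> * of_real (\<kappa> * norm y) * ?K y - ?DK y)"
          using norm_triangle_ineq[of "?K y * e" "v y * (\<i> * of_real (\<kappa> * norm y) * ?K y - ?DK y)"]
          by (simp only: norm_mult)
        also have "\<dots> \<le> (2 / norm y) * d + norm (v y) * (C2 / norm y)"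
          using ks e d by (intro add_mono mult_mono mult_left_mono) auto
        also have "\<dots> \<le> 2 * d / R + C2 * (norm (v y) / norm y)"
          using True R(2) d by (intro add_mono) (auto simp: frac_le mult.commute)
        also have "norm (v y) / norm y \<le> (norm y * (norm (v y))\<^sup>2 / R + 1 / R\<^sup>2) / 2"
        proof -
          \<comment> \<open>Only a quadratic bound on v is available, so |v| / |y| is split by
            Young's inequality with weight |y| / R into the flux density, divided by R, and a term
            of order 1 / R^2.\<close>
          have "2 * norm (v y) * (1 / norm y) \<le> (norm y / R) * (norm (v y))\<^sup>2 + (1 / norm y)\<^sup>2 / (norm y / R)"
            by (rule young_sq) (use y R(2) in auto)
          also have "(1 / norm y)\<^sup>2 / (norm y / R) = R / norm y ^ 3"
            using y R(2) by (simp add: field_simps power2_eq_square power3_eq_cube)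
          also have "\<dots> \<le> R / R ^ 3"
            using True R(2) y(1) by (intro divide_left_mono power_mono mult_pos_pos zero_less_power) auto
          also have "\<dots> = 1 / R\<^sup>2" using R(2) by (simp add: field_simps power2_eq_square power3_eq_cube)
          finally show ?thesis by (simp add: mult.commute)
        qed
        then have "2 * d / R + C2 * (norm (v y) / norm y) \<le> 2 * d / R + C2 * ((norm y * (norm (v y))\<^sup>2 / R + 1 / R\<^sup>2) / 2)"
          using C2 by (intro add_left_mono mult_left_mono)
        also have "\<dots> = (2 * d / R + C2 / (2 * R\<^sup>2)) + (C2 / (2 * R)) * (norm y * (norm (v y))\<^sup>2)"
          using R(2) by (simp add: field_simps power2_eq_square)
        finally have "norm (?K y * ?D y - v y * ?DK y) \<le> (2 * d / R + C2 / (2 * R\<^sup>2)) + (C2 / (2 * R)) * (norm y * (norm (v y))\<^sup>2)" .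
        then have "?w y * norm (?K y * ?D y - v y * ?DK y) \<le> ?w y * ((2 * d / R + C2 / (2 * R\<^sup>2)) + (C2 / (2 * R)) * (norm y * (norm (v y))\<^sup>2))"
          using wb(1) by (rule mult_left_mono)
        also have "\<dots> = ?w y * (2 * d / R + C2 / (2 * R\<^sup>2)) + (C2 / (2 * R)) * (?w y * (norm y * (norm (v y))\<^sup>2))"
          by (simp add: distrib_left mult.left_commute)
        also have "\<dots> \<le> (18 / R\<^sup>2) * (2 * d / R + C2 / (2 * R\<^sup>2)) + (C2 / (2 * R)) * (?w y * (norm y * (norm (v y))\<^sup>2))"
          using wb(2) d R(2) C2 by (intro add_right_mono mult_right_mono) auto
        finally show ?thesis using True wb(1)[of y] by (simp add: norm_mult)
      qed
      have int2: "integrable lborel (\<lambda>y. ?w y * (norm y * (norm (v y))\<^sup>2))"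
        by (rule integrable_continuous_compact_support[of _ "2 * R"])
           (auto intro!: continuous_intros cw cv simp: w0)
      have "norm (integral\<^sup>L lborel (\<lambda>y. of_real (?w y) * (?K y * ?D y - v y * ?DK y)))
          \<le> integral\<^sup>L lborel (\<lambda>y. (C2 / (2 * R)) * (?w y * (norm y * (norm (v y))\<^sup>2))
            + ((18 / R\<^sup>2) * (2 * d / R + C2 / (2 * R\<^sup>2))) * indicator (cball 0 (2 * R)) y)"
      proof (rule Bochner_Integration.integral_norm_bound_integral[OF _ _ pt])
        show "integrable lborel (\<lambda>y. of_real (?w y) * (?K y * ?D y - v y * ?DK y))"
          by (rule integrable_continuous_compact_support[of _ "2 * R"])
             (auto intro!: continuous_intros cw cv cK simp: w0)
      qed (intro Bochner_Integration.integrable_add integrable_mult_right int2 integrable_indicator_cball)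
      also have "\<dots> = (C2 / (2 * R)) * integral\<^sup>L lborel (\<lambda>y. ?w y * (norm y * (norm (v y))\<^sup>2)) + (18 / R\<^sup>2) * (2 * d / R + C2 / (2 * R\<^sup>2)) * (?V * (2 * R) ^ 3)"
        using R(2) by (intro integral_add_indicator_cball int2) auto
      also have "\<dots> \<le> (C2 / (2 * R)) * C + (18 / R\<^sup>2) * (2 * d / R + C2 / (2 * R\<^sup>2)) * (?V * (2 * R) ^ 3)"
        using C(2)[OF R(1,2)] C2 R(2) by (intro add_right_mono mult_left_mono) auto
      also have "\<dots> = 288 * ?V * d + Q / R"
        unfolding Q_def using R(2) by (simp add: field_simps power2_eq_square power3_eq_cube)
      finally show ?thesis unfolding eq .
    qed
    have "(\<lambda>n. integral\<^sup>L lborel (\<lambda>y. reg_kernel \<kappa> (\<epsilon> n) x y * ?f y)) \<longlonglongrightarrow> I"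
      unfolding I_def \<epsilon>_def by (rule reg_kernel_limit[OF cf f \<delta>])
    moreover have "(\<lambda>n. integral\<^sup>L lborel (\<lambda>y. (of_real (?\<eta> y) * v y) * helmholtz \<kappa> (reg_kernel \<kappa> (\<epsilon> n) x) (reg_kernel2 \<kappa> (\<epsilon> n) x) y))
        \<longlonglongrightarrow> - of_real kernel_mass * (of_real (?\<eta> x) * v x)"
      unfolding \<epsilon>_def
      by (rule reg_kernel_approx_identity[of _ "2 * R"]) (use \<kappa> R(2) in \<open>auto intro!: continuous_intros c\<eta> cv simp: \<eta>0\<close>)
    moreover have "?\<eta> x = 1"
      using radial_cutoff_eq_1[OF R(2), of x 0] R(4) norm_ge_zero[of x] by simp
    ultimately have "(\<lambda>n. integral\<^sup>L lborel (\<lambda>y. reg_kernel \<kappa> (\<epsilon> n) x y * ?f y)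
        - integral\<^sup>L lborel (\<lambda>y. (of_real (?\<eta> y) * v y) * helmholtz \<kappa> (reg_kernel \<kappa> (\<epsilon> n) x) (reg_kernel2 \<kappa> (\<epsilon> n) x) y))
        \<longlonglongrightarrow> I - (- of_real kernel_mass * (1 * v x))"
      by (intro tendsto_diff) auto
    from Lim_bounded[OF tendsto_norm[OF this], of 0] step show ?thesis by simp
  qed
  have "norm (I + of_real kernel_mass * v x) \<le> 0 + e" if e: "e > 0" for e
  proof -
    \<comment> \<open>Chosen so that the first error is at most e / 2; the radius below includes 2 Q
      / e so that the second one is too. The added 1 keeps the denominator positive.\<close>
    define d where "d = e / (2 * (288 * ?V + 1))"
    have V: "?V \<ge> 0" by simp
    have d: "d > 0" unfolding d_def using e V by (simp add: add_nonneg_pos)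
    obtain R1 where R1: "\<And>y. norm y \<ge> R1 \<Longrightarrow> norm (?D y - \<i> * of_real (\<kappa> * norm y) * v y) \<le> d"
      using rad d unfolding radiating_def by blast
    define R where "R = Max {R0, 1, A, 2 * norm x, R1, 2 * Q / e}"
    have R: "R \<ge> R0" "R \<ge> 1" "R \<ge> A" "R \<ge> 2 * norm x" "R \<ge> R1" "R \<ge> 2 * Q / e"
      unfolding R_def by (auto intro: Max_ge)
    have "norm (I + of_real kernel_mass * v x) \<le> 288 * ?V * d + Q / R"
      by (rule main[OF d _ _ _ _ _ R1]) (use R in auto)
    also have "288 * ?V * d \<le> (288 * ?V + 1) * d" using d by (simp add: distrib_right)
    also have "\<dots> = e / 2" 
    proof -
      have half: "P * (e / (2 * P)) = e / 2" if "P > 0" for P using that by simp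
      show ?thesis unfolding d_def by (rule half) (use V in linarith)
    qed
    also have "Q / R \<le> e / 2" using R(2,6) e by (simp add: field_simps)
    finally show ?thesis by simp
  qed
  then have "norm (I + of_real kernel_mass * v x) \<le> 0" by (rule field_le_epsilon)
  then have "of_real kernel_mass * v x = - I" by (simp add: eq_neg_iff_add_eq_0 add.commute)
  then show ?thesis using kernel_mass_pos unfolding I_def[symmetric] by (simp add: field_simps)
qed

section \<open>Radiation solutions and cutoffs\<close>

lemma C2_data_diff:
  assumes f: "C2_data S f f1 f2" and g: "C2_data S g g1 g2"
  shows "C2_data S (\<lambda>x. f x - g x) (\<lambda>b x. f1 b x - g1 b x) (\<lambda>b x. f2 b x - g2 b x)"
  unfolding C2_data_def using C2_dataD[OF f] C2_dataD[OF g]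
  by (auto intro!: continuous_intros has_pd_diff)

lemma helmholtz_diff:
  "helmholtz \<kappa> (\<lambda>x. f x - g x) (\<lambda>b x. f2 b x - g2 b x) x = helmholtz \<kappa> f f2 x - helmholtz \<kappa> g g2 x"
  unfolding helmholtz_def by (simp add: sum_subtractf algebra_simps)

lemma radiating_diff:
  assumes "radiating \<kappa> f f1" "radiating \<kappa> g g1"
  shows "radiating \<kappa> (\<lambda>x. f x - g x) (\<lambda>b x. f1 b x - g1 b x)"
  unfolding radiating_def
proof (intro allI impI)
  fix \<delta> :: real assume "\<delta> > 0"
  let ?E = "\<lambda>f f1 y. (\<Sum>b\<in>Basis. of_real (y \<bullet> b) * f1 b y) - \<i> * of_real (\<kappa> * norm y) * f y :: complex"
  obtain R1 where R1: "\<And>y. norm y \<ge> R1 \<Longrightarrow> norm (?E f f1 y) \<le> \<delta> / 2"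
    using assms(1) \<open>\<delta> > 0\<close> unfolding radiating_def by (meson half_gt_zero)
  obtain R2 where R2: "\<And>y. norm y \<ge> R2 \<Longrightarrow> norm (?E g g1 y) \<le> \<delta> / 2"
    using assms(2) \<open>\<delta> > 0\<close> unfolding radiating_def by (meson half_gt_zero)
  have "norm (?E (\<lambda>x. f x - g x) (\<lambda>b x. f1 b x - g1 b x) y) \<le> \<delta>" if "norm y \<ge> max R1 R2" for y
  proof -
    have "?E (\<lambda>x. f x - g x) (\<lambda>b x. f1 b x - g1 b x) y = ?E f f1 y - ?E g g1 y"
      by (simp add: sum_subtractf algebra_simps)
    also have "norm \<dots> \<le> \<delta> / 2 + \<delta> / 2"
      by (rule order_trans[OF norm_triangle_ineq4 add_mono[OF R1 R2]]) (use that in auto)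
    finally show ?thesis by simp
  qed
  then show "\<exists>R0. \<forall>y. norm y \<ge> R0 \<longrightarrow> norm (?E (\<lambda>x. f x - g x) (\<lambda>b x. f1 b x - g1 b x) y) \<le> \<delta>"
    by blast
qed

text \<open>Translates the definition through total derivatives into coordinates: applying D1 and D2
  to basis vectors yields the explicit data, and y = |y| \<omega> converts the limit along unit
  directions into the condition on y . grad.\<close>

lemma radiation_solution_data:
  assumes \<psi>: "radiation_solution \<kappa> U \<psi>" and U: "open U" and R: "\<And>y. norm y \<ge> R \<Longrightarrow> y \<in> U"
  obtains \<psi>1 \<psi>2 where "C2_data U \<psi> \<psi>1 \<psi>2" "\<And>x. x \<in> U \<Longrightarrow> helmholtz \<kappa> \<psi> \<psi>2 x = 0" "radiating \<kappa> \<psi> \<psi>1"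
proof -
  obtain D1 :: "real^3 \<Rightarrow> (real^3) \<Rightarrow>\<^sub>L complex" and D2 :: "real^3 \<Rightarrow> (real^3) \<Rightarrow>\<^sub>L (real^3) \<Rightarrow>\<^sub>L complex"
    where c: "continuous_on (closure U) \<psi>" "continuous_on (closure U) D1" "continuous_on (closure U) D2"
      and d1: "\<And>x. x \<in> U \<Longrightarrow> (\<psi> has_derivative blinfun_apply (D1 x)) (at x)"
      and d2: "\<And>x. x \<in> U \<Longrightarrow> (D1 has_derivative blinfun_apply (D2 x)) (at x)"
    using \<psi> unfolding radiation_solution_def C2_on_closure_def by blast
  define \<psi>1 where "\<psi>1 = (\<lambda>b x. D1 x b)"
  define \<psi>2 where "\<psi>2 = (\<lambda>b x. D2 x b b)"
  note cU = c[THEN continuous_on_subset[OF _ closure_subset]]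
  have pd1: "has_pd b \<psi> (\<psi>1 b x) x" if "x \<in> U" for b x
    unfolding \<psi>1_def by (rule has_pd_has_derivative[OF d1[OF that]])
  have pd2: "has_pd b (\<psi>1 b) (\<psi>2 b x) x" if "x \<in> U" for b x
    unfolding \<psi>1_def \<psi>2_def
    by (rule has_pd_bounded_linear[OF blinfun.bounded_linear_left has_pd_has_derivative[OF d2[OF that]]])
  have data: "C2_data U \<psi> \<psi>1 \<psi>2"
    unfolding C2_data_def using pd1 pd2
    by (auto simp: \<psi>1_def \<psi>2_def intro!: continuous_intros cU)
  have dd1: "directional_deriv b \<psi> x = \<psi>1 b x" if "x \<in> U" for b x
    using pd1[OF that] unfolding directional_deriv_def has_pd_def by (rule vector_derivative_at)
  \<comment> \<open>The first directional derivative equals \<open>\<psi>1 b\<close> only inside U,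
    so openness of U is what allows it to be differentiated again.\<close>
  have dd2: "directional_deriv b (directional_deriv b \<psi>) x = \<psi>2 b x" if "x \<in> U" for b x
  proof -
    have "has_pd b (directional_deriv b \<psi>) (\<psi>2 b x) x"
      by (rule has_pd_cong_open[OF U that dd1 pd2[OF that]])
    then show ?thesis
      unfolding directional_deriv_def[of b "directional_deriv b \<psi>"] has_pd_def by (rule vector_derivative_at)
  qed
  have helm: "helmholtz \<kappa> \<psi> \<psi>2 x = 0" if "x \<in> U" for x
  proof -
    have "- laplacian \<psi> x = of_real (\<kappa>\<^sup>2) * \<psi> x"
      using \<psi> that unfolding radiation_solution_def by blast
    then show ?thesis
      unfolding helmholtz_def laplacian_def using dd2[OF that] by (simp add: neg_eq_iff_add_eq_0)
  qed
  have "radiating \<kappa> \<psi> \<psi>1"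
    unfolding radiating_def
  proof (intro allI impI)
    fix \<delta> :: real assume "\<delta> > 0"
    then have "\<forall>\<^sub>F r in at_top. \<forall>\<omega>\<in>sphere (0::real^3) 1.
        dist (of_real r * (directional_deriv \<omega> \<psi> (r *\<^sub>R \<omega>) - \<i> * of_real \<kappa> * \<psi> (r *\<^sub>R \<omega>))) 0 < \<delta>"
      using \<psi> unfolding radiation_solution_def sommerfeld_radiation_def uniform_limit_iff by blast
    then obtain r0 where r0: "\<And>r \<omega>. r \<ge> r0 \<Longrightarrow> \<omega> \<in> sphere (0::real^3) 1 \<Longrightarrow>
        dist (of_real r * (directional_deriv \<omega> \<psi> (r *\<^sub>R \<omega>) - \<i> * of_real \<kappa> * \<psi> (r *\<^sub>R \<omega>))) 0 < \<delta>"
      unfolding eventually_at_top_linorder by blast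
    have "norm ((\<Sum>b\<in>Basis. of_real (y \<bullet> b) * \<psi>1 b y) - \<i> * of_real (\<kappa> * norm y) * \<psi> y) \<le> \<delta>"
      if y: "norm y \<ge> max (max r0 R) 1" for y
    proof -
      define \<omega> where "\<omega> = y /\<^sub>R norm y"
      have ny: "norm y > 0" using y by linarith
      then have \<omega>: "\<omega> \<in> sphere 0 1" "norm y *\<^sub>R \<omega> = y" unfolding \<omega>_def by auto
      have yU: "y \<in> U" using R y by simp
      have "of_real (norm y) * D1 y \<omega> = D1 y (norm y *\<^sub>R \<omega>)"
        by (simp add: blinfun.scaleR_right scaleR_conv_of_real[where 'a = complex])
      also have "\<dots> = D1 y (\<Sum>b\<in>Basis. (y \<bullet> b) *\<^sub>R b)"
        unfolding \<omega>(2) by (simp add: euclidean_representation)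
      also have "\<dots> = (\<Sum>b\<in>Basis. of_real (y \<bullet> b) * \<psi>1 b y)"
        by (simp add: blinfun.sum_right blinfun.scaleR_right scaleR_conv_of_real[where 'a = complex] \<psi>1_def)
      finally have "of_real (norm y) * (directional_deriv \<omega> \<psi> (norm y *\<^sub>R \<omega>) - \<i> * of_real \<kappa> * \<psi> (norm y *\<^sub>R \<omega>))
          = (\<Sum>b\<in>Basis. of_real (y \<bullet> b) * \<psi>1 b y) - \<i> * of_real (\<kappa> * norm y) * \<psi> y"
        unfolding \<omega>(2) dd1[OF yU] by (simp add: \<psi>1_def algebra_simps)
      then show ?thesis using r0[of "norm y" \<omega>] \<omega>(1) y unfolding dist_0_norm dist_norm diff_0_right by simp
    qed
    then show "\<exists>R0. \<forall>y. norm y \<ge> R0 \<longrightarrow> norm ((\<Sum>b\<in>Basis. of_real (y \<bullet> b) * \<psi>1 b y) - \<i> * of_real (\<kappa> * norm y) * \<psi> y) \<le> \<delta>"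
      by blast
  qed
  with data helm that show ?thesis by blast
qed

lemma C2_data_union:
  assumes "C2_data S f f1 f2" "C2_data T f f1 f2" "open S" "open T"
  shows "C2_data (S \<union> T) f f1 f2"
  using assms unfolding C2_data_def by (auto intro!: continuous_on_open_Un)

lemma C2_data_zero:
  assumes "open S" "\<And>x. x \<in> S \<Longrightarrow> f x = 0" "\<And>b x. x \<in> S \<Longrightarrow> f1 b x = 0" "\<And>b x. x \<in> S \<Longrightarrow> f2 b x = 0"
  shows "C2_data S f f1 f2"
  unfolding C2_data_def
proof (intro conjI ballI)
  show "continuous_on S f" "continuous_on S (f1 b)" "continuous_on S (f2 b)" for b
    using assms by (simp_all cong: continuous_on_cong)
  fix b x assume "x \<in> S"
  then show "has_pd b f (f1 b x) x" "has_pd b (f1 b) (f2 b x) x"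
    using has_pd_cong_open[OF assms(1) \<open>x \<in> S\<close>, of _ "\<lambda>_. 0" b 0] assms by auto
qed

text \<open>The values of \<open>f\<close>, \<open>f1\<close>, \<open>f2\<close> outside \<open>U\<close> are irrelevant since they are multiplied by \<open>0\<close>.\<close>

lemma C2_data_cutoff:
  fixes f g :: "'a::euclidean_space \<Rightarrow> complex"
  assumes f: "C2_data U f f1 f2" and U: "open U" and g: "C2_data UNIV g g1 g2"
    and C: "closed C" "C \<subseteq> U"
    and z: "\<And>x. x \<notin> C \<Longrightarrow> g x = 0" "\<And>b x. x \<notin> C \<Longrightarrow> g1 b x = 0" "\<And>b x. x \<notin> C \<Longrightarrow> g2 b x = 0"
  shows "C2_data UNIV (\<lambda>x. g x * f x) (\<lambda>b x. g x * f1 b x + g1 b x * f x)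
     (\<lambda>b x. (g x * f2 b x + g1 b x * f1 b x) + (g1 b x * f1 b x + g2 b x * f x))"
proof -
  have "C2_data U g g1 g2"
    using g unfolding C2_data_def by (auto intro: continuous_on_subset)
  from C2_data_union[OF C2_data_mult[OF this f] C2_data_zero[of "- C"] U] C
  have "C2_data (U \<union> - C) (\<lambda>x. g x * f x) (\<lambda>b x. g x * f1 b x + g1 b x * f x)
     (\<lambda>b x. (g x * f2 b x + g1 b x * f1 b x) + (g1 b x * f1 b x + g2 b x * f x))"
    by (simp add: z open_Compl)
  moreover have "U \<union> - C = UNIV" using C(2) by blast
  ultimately show ?thesis by simp
qed

lemma C2_data_of_real:
  "C2_data S f f1 f2 \<Longrightarrow> C2_data S (\<lambda>x. of_real (f x) :: complex) (\<lambda>b x. of_real (f1 b x)) (\<lambda>b x. of_real (f2 b x))"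
  unfolding C2_data_def by (auto intro!: continuous_intros has_pd_bounded_linear[OF bounded_linear_of_real])

section \<open>Solutions as waves emitted by compactly supported sources\<close>

text \<open>Cutting \<psi> off around \<open>a\<close> gives a function of compact support, which
  radiates trivially. Its source lives where the cutoff varies, in the shell between radii d and 2
  d, and so stays away from evaluation points close to \<open>a\<close>.\<close>

lemma local_representation:
  fixes \<psi> :: "real^3 \<Rightarrow> complex"
  assumes \<kappa>: "\<kappa> > 0" and \<psi>: "C2_data U \<psi> \<psi>1 \<psi>2" "\<And>x. x \<in> U \<Longrightarrow> helmholtz \<kappa> \<psi> \<psi>2 x = 0"
    and U: "open U" and a: "cball a (2 * d) \<subseteq> U" "d > 0"
  obtains f where "continuous_on UNIV f" "\<And>y. norm (y - a) < d \<Longrightarrow> f y = 0" "\<And>y. norm (y - a) > 2 * d \<Longrightarrow> f y = 0"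
    "\<And>x. norm (x - a) < d \<Longrightarrow> \<psi> x = integral\<^sup>L lborel (\<lambda>y. helm \<kappa> (norm (y - x)) * f y)"
proof -
  let ?c = "radial_cutoff a d" and ?c1 = "radial_cutoff1 a d" and ?c2 = "radial_cutoff2 a d"
  have z: "?c x = 0" "?c1 b x = 0" "?c2 b x = 0" if "norm (x - a) \<ge> 2 * d" for x b
    using radial_cutoff_eq_0[OF a(2), of x a] radial_cutoff1_eq_0[OF a(2), of x a] that by auto
  have o: "?c x = 1" "?c1 b x = 0" "?c2 b x = 0" if "norm (x - a) \<le> d" for x b
    using radial_cutoff_eq_1[OF a(2), of x a] radial_cutoff1_eq_0[OF a(2), of x a] that by auto
  define v where "v = (\<lambda>x. of_real (?c x) * \<psi> x)"
  define v1 where "v1 = (\<lambda>b x. of_real (?c x) * \<psi>1 b x + of_real (?c1 b x) * \<psi> x)"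
  define v2 where "v2 = (\<lambda>b x. (of_real (?c x) * \<psi>2 b x + of_real (?c1 b x) * \<psi>1 b x) + (of_real (?c1 b x) * \<psi>1 b x + of_real (?c2 b x) * \<psi> x))"
  have "C2_data UNIV (\<lambda>x. complex_of_real (?c x)) (\<lambda>b x. of_real (?c1 b x)) (\<lambda>b x. of_real (?c2 b x))"
    using a(2) by (intro C2_data_of_real C2_data_radial_cutoff) auto
  then have v: "C2_data UNIV v v1 v2"
    unfolding v_def v1_def v2_def
    by (rule C2_data_cutoff[OF \<psi>(1) U _ closed_cball a(1)]) (auto simp: z dist_norm norm_minus_commute)
  have v0: "v x = 0" "v1 b x = 0" "v2 b x = 0" if "norm (x - a) \<ge> 2 * d" for b x
    using z[OF that] by (auto simp: v_def v1_def v2_def)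
  have h0: "helmholtz \<kappa> v v2 y = 0" if "norm (y - a) \<ge> 2 * d" for y
    using v0[OF that] by (simp add: helmholtz_def)
  have h1: "helmholtz \<kappa> v v2 y = 0" if "norm (y - a) \<le> d" for y
  proof -
    have "y \<in> U" using a that by (auto simp: dist_norm norm_minus_commute)
    moreover have "helmholtz \<kappa> v v2 y = helmholtz \<kappa> \<psi> \<psi>2 y"
      using o[OF that] by (simp add: helmholtz_def v_def v2_def)
    ultimately show ?thesis using \<psi>(2) by simp
  qed
  have far: "norm (y - a) \<ge> 2 * d" if "norm y \<ge> norm a + 2 * d" for y
    using norm_triangle_ineq2[of y a] that by linarith
  have "radiating \<kappa> v v1"
    unfolding radiating_def
  proof (intro allI impI exI)
    fix \<delta> :: real and y :: "real^3" assume "\<delta> > 0" "norm a + 2 * d \<le> norm y"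
    then show "norm ((\<Sum>b\<in>Basis. of_real (y \<bullet> b) * v1 b y) - \<i> * of_real (\<kappa> * norm y) * v y) \<le> \<delta>"
      using v0[OF far] by simp
  qed
  note rep = helmholtz_representation[OF \<kappa> v _ this, of "norm a + 2 * d"]
  have main: "\<psi> x = integral\<^sup>L lborel (\<lambda>y. helm \<kappa> (norm (y - x)) * (- (1 / of_real kernel_mass) * helmholtz \<kappa> v v2 y))"
    if x: "norm (x - a) < d" for x
  proof -
    have "v x = - (1 / of_real kernel_mass) * integral\<^sup>L lborel (\<lambda>y. helm \<kappa> (norm (y - x)) * helmholtz \<kappa> v v2 y)"
    proof (rule rep)
      show "helmholtz \<kappa> v v2 y = 0" if "norm a + 2 * d < norm y" for y
        using h0 far that by simp
      \<comment> \<open>The distance from x to the inner sphere of the shell serves as the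
        source-free radius around x.\<close>
      show "d - norm (x - a) > 0" using x by simp
      show "helmholtz \<kappa> v v2 y = 0" if "norm (y - x) < d - norm (x - a)" for y
        using norm_triangle_ineq[of "y - x" "x - a"] that by (intro h1) simp
    qed
    moreover have "v x = \<psi> x" using o[of x] x by (simp add: v_def)
    ultimately show ?thesis by (simp add: integral_mult_right_zero[symmetric] mult.left_commute del: integral_mult_right_zero)
  qed
  show ?thesis
  proof (rule that[of "\<lambda>y. - (1 / of_real kernel_mass) * helmholtz \<kappa> v v2 y"])
    show "continuous_on UNIV (\<lambda>y. - (1 / of_real kernel_mass) * helmholtz \<kappa> v v2 y)"
      by (intro continuous_intros continuous_on_helmholtz[OF v])
  qed (use h0 h1 main in \<open>auto simp del: integral_mult_right_zero\<close>)
qed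

text \<open>The complementary cutoff removes \<psi> near the surface and keeps it at infinity, so
  the radiation condition is inherited while the source is confined to the ball of radius 2
  R.\<close>

lemma exterior_representation:
  fixes \<psi> :: "real^3 \<Rightarrow> complex"
  assumes \<kappa>: "\<kappa> > 0" and \<psi>: "C2_data U \<psi> \<psi>1 \<psi>2" "\<And>x. x \<in> U \<Longrightarrow> helmholtz \<kappa> \<psi> \<psi>2 x = 0" "radiating \<kappa> \<psi> \<psi>1"
    and U: "open U" and R: "\<And>y. norm y \<ge> R \<Longrightarrow> y \<in> U" "R > 0"
  obtains f where "continuous_on UNIV f" "\<And>y. norm y > 2 * R \<Longrightarrow> f y = 0"
    "\<And>x. norm x > 2 * R \<Longrightarrow> \<psi> x = integral\<^sup>L lborel (\<lambda>y. helm \<kappa> (norm (y - x)) * f y)"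
proof -
  \<comment> \<open>The derivatives are written with \<open>0 -\<close> so that they match the rule
    for a difference whose first function is the constant 1.\<close>
  let ?c = "\<lambda>x::real^3. 1 - radial_cutoff 0 R x" and ?c1 = "\<lambda>b (x::real^3). 0 - radial_cutoff1 0 R b x"
    and ?c2 = "\<lambda>b (x::real^3). 0 - radial_cutoff2 0 R b x"
  have o: "?c x = 1" "?c1 b x = 0" "?c2 b x = 0" if "norm x \<ge> 2 * R" for x b
    using radial_cutoff_eq_0[OF R(2), of x 0] radial_cutoff1_eq_0[OF R(2), of x 0] that by auto
  have z: "?c x = 0" "?c1 b x = 0" "?c2 b x = 0" if "norm x \<le> R" for x b
    using radial_cutoff_eq_1[OF R(2), of x 0] radial_cutoff1_eq_0[OF R(2), of x 0] that by auto
  define v where "v = (\<lambda>x. of_real (?c x) * \<psi> x)"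
  define v1 where "v1 = (\<lambda>b x. of_real (?c x) * \<psi>1 b x + of_real (?c1 b x) * \<psi> x)"
  define v2 where "v2 = (\<lambda>b x. (of_real (?c x) * \<psi>2 b x + of_real (?c1 b x) * \<psi>1 b x) + (of_real (?c1 b x) * \<psi>1 b x + of_real (?c2 b x) * \<psi> x))"
  have "C2_data UNIV (\<lambda>x::real^3. 1::real) (\<lambda>b x. 0) (\<lambda>b x. 0)"
    unfolding C2_data_def by simp
  then have "C2_data UNIV ?c ?c1 ?c2"
    by (rule C2_data_diff[OF _ C2_data_radial_cutoff]) (use R(2) in simp)
  then have "C2_data UNIV (\<lambda>x. complex_of_real (?c x)) (\<lambda>b x. of_real (?c1 b x)) (\<lambda>b x. of_real (?c2 b x))"
    by (rule C2_data_of_real)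
  then have v: "C2_data UNIV v v1 v2"
    unfolding v_def v1_def v2_def
  proof (rule C2_data_cutoff[OF \<psi>(1) U, of _ _ _ "- ball 0 R"])
    show "closed (- ball (0::real^3) R)" by (simp add: closed_Compl)
  qed (use R(1) z in auto)
  have eq: "v x = \<psi> x" "v1 b x = \<psi>1 b x" "v2 b x = \<psi>2 b x" if "norm x \<ge> 2 * R" for b x
    using o[OF that] by (auto simp: v_def v1_def v2_def)
  have h: "helmholtz \<kappa> v v2 y = 0" if "norm y \<ge> 2 * R" for y
  proof -
    have "y \<in> U" using R that by simp
    then show ?thesis using \<psi>(2) eq[OF that] by (simp add: helmholtz_def)
  qed
  have rad: "radiating \<kappa> v v1"
    unfolding radiating_def
  proof (intro allI impI)
    fix \<delta> :: real assume "\<delta> > 0"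
    then obtain R0 where R0: "\<And>y. norm y \<ge> R0 \<Longrightarrow> norm ((\<Sum>b\<in>Basis. of_real (y \<bullet> b) * \<psi>1 b y) - \<i> * of_real (\<kappa> * norm y) * \<psi> y) \<le> \<delta>"
      using \<psi>(3) unfolding radiating_def by blast
    have "norm ((\<Sum>b\<in>Basis. of_real (y \<bullet> b) * v1 b y) - \<i> * of_real (\<kappa> * norm y) * v y) \<le> \<delta>" if "norm y \<ge> max R0 (2 * R)" for y
      using R0[of y] eq[of y] that by simp
    then show "\<exists>R0. \<forall>y. norm y \<ge> R0 \<longrightarrow> norm ((\<Sum>b\<in>Basis. of_real (y \<bullet> b) * v1 b y) - \<i> * of_real (\<kappa> * norm y) * v y) \<le> \<delta>"
      by blast
  qed
  have main: "\<psi> x = integral\<^sup>L lborel (\<lambda>y. helm \<kappa> (norm (y - x)) * (- (1 / of_real kernel_mass) * helmholtz \<kappa> v v2 y))"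
    if x: "norm x > 2 * R" for x
  proof -
    have "v x = - (1 / of_real kernel_mass) * integral\<^sup>L lborel (\<lambda>y. helm \<kappa> (norm (y - x)) * helmholtz \<kappa> v v2 y)"
    proof (rule helmholtz_representation[OF \<kappa> v _ rad, of "2 * R"])
      show "helmholtz \<kappa> v v2 y = 0" if "2 * R < norm y" for y
        using h that by simp
      show "norm x - 2 * R > 0" using x by simp
      show "helmholtz \<kappa> v v2 y = 0" if "norm (y - x) < norm x - 2 * R" for y
        using norm_triangle_ineq2[of x y] that by (intro h) (simp add: norm_minus_commute)
    qed
    moreover have "v x = \<psi> x" using eq[of x] x by simp
    ultimately show ?thesis by (simp add: integral_mult_right_zero[symmetric] mult.left_commute del: integral_mult_right_zero)
  qed
  show ?thesis
  proof (rule that[of "\<lambda>y. - (1 / of_real kernel_mass) * helmholtz \<kappa> v v2 y"])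
    show "continuous_on UNIV (\<lambda>y. - (1 / of_real kernel_mass) * helmholtz \<kappa> v v2 y)"
      by (intro continuous_intros continuous_on_helmholtz[OF v])
  qed (use h main in \<open>auto simp del: integral_mult_right_zero\<close>)
qed

section \<open>Analyticity along the ray\<close>

text \<open>Differentiation under the integral over a compact box containing the support of
  \<open>f\<close>. The kernel is well behaved only for y in M; on N the factor \<open>f\<close>
  vanishes and hides its singularities. Both sets are open so that continuity can be glued.\<close>

lemma holomorphic_parameter_integral:
  fixes F F' :: "complex \<Rightarrow> 'a::euclidean_space \<Rightarrow> complex"
  assumes f: "continuous_on UNIV f" "\<And>y. norm y > A \<Longrightarrow> f y = 0"
    and N: "open N" "\<And>y. y \<in> N \<Longrightarrow> f y = 0" and M: "open M" "M \<union> N = UNIV"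
    and D: "\<And>z y. z \<in> ball c r \<Longrightarrow> y \<in> M \<Longrightarrow> ((\<lambda>z. F z y) has_field_derivative F' z y) (at z)"
    and cF: "\<And>z. z \<in> ball c r \<Longrightarrow> continuous_on M (F z)"
    and cF': "continuous_on (ball c r \<times> M) (\<lambda>p. F' (fst p) (snd p))"
  shows "(\<lambda>z. integral\<^sup>L lborel (\<lambda>y. F z y * f y)) holomorphic_on ball c r"
proof -
  obtain a :: 'a where a: "cball 0 A \<subseteq> cbox (- a) a"
    using bounded_subset_cbox_symmetric[OF bounded_cball] by blast
  have c1: "continuous_on UNIV (\<lambda>y. F z y * f y)" if "z \<in> ball c r" for z
  proof -
    have "continuous_on M (\<lambda>y. F z y * f y)"
      by (intro continuous_intros cF that continuous_on_subset[OF f(1)]) auto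
    moreover have "continuous_on N (\<lambda>y. F z y * f y)"
      using N(2) by (simp cong: continuous_on_cong)
    ultimately show ?thesis using continuous_on_open_Un[OF M(1) N(1)] M(2) by simp
  qed
  have eq: "integral\<^sup>L lborel (\<lambda>y. F z y * f y) = integral (cbox (- a) a) (\<lambda>y. F z y * f y)" if "z \<in> ball c r" for z
  proof -
    have "integrable lborel (\<lambda>y. F z y * f y)"
      by (rule integrable_continuous_compact_support[OF c1[OF that], of A]) (simp add: f(2))
    then have "integral\<^sup>L lborel (\<lambda>y. F z y * f y) = integral UNIV (\<lambda>y. F z y * f y)"
      by (rule integral_lborel[symmetric])
    also have "\<dots> = integral (cbox (- a) a) (\<lambda>y. F z y * f y)"
    proof -
      have "(\<lambda>y. F z y * f y) = (\<lambda>y. if y \<in> cbox (- a) a then F z y * f y else 0)"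
      proof
        fix y show "F z y * f y = (if y \<in> cbox (- a) a then F z y * f y else 0)"
          using a f(2)[of y] by (cases "norm y \<le> A") auto
      qed
      from trans[OF arg_cong[OF this, of "integral UNIV"] integral_restrict_UNIV] show ?thesis .
    qed
    finally show ?thesis .
  qed
  have "(\<lambda>z. integral (cbox (- a) a) (\<lambda>y. F z y * f y)) holomorphic_on ball c r"
  proof (rule leibniz_rule_holomorphic[where fx = "\<lambda>z y. F' z y * f y"])
    fix z y assume z: "z \<in> ball c r"
    show "((\<lambda>z. F z y * f y) has_field_derivative F' z y * f y) (at z within ball c r)"
    proof (cases "y \<in> M")
      case True
      show ?thesis by (intro DERIV_cmult_right has_field_derivative_at_within[OF D[OF z True]])
    next
      case False
      then have "f y = 0" using N(2) M(2) by blast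
      then show ?thesis by simp
    qed
    show "(\<lambda>y. F z y * f y) integrable_on cbox (- a) a"
      by (intro integrable_continuous continuous_on_subset[OF c1[OF z]]) auto
  next
    have fs: "continuous_on T (\<lambda>p. f (snd p))" for T :: "(complex \<times> 'a) set"
      by (intro continuous_on_compose2[OF f(1)] continuous_intros) auto
    have "continuous_on (ball c r \<times> M) (\<lambda>p. F' (fst p) (snd p) * f (snd p))"
      by (intro continuous_intros cF' fs)
    moreover have "continuous_on (ball c r \<times> N) (\<lambda>p. F' (fst p) (snd p) * f (snd p))"
      by (rule continuous_on_eq[OF continuous_on_const[of _ 0]]) (use N(2) in auto)
    ultimately have "continuous_on (ball c r \<times> M \<union> ball c r \<times> N) (\<lambda>p. F' (fst p) (snd p) * f (snd p))"
      by (intro continuous_on_open_Un open_Times open_ball M N)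
    moreover have "ball c r \<times> M \<union> ball c r \<times> N = ball c r \<times> UNIV" using M(2) by blast
    ultimately show "continuous_on (ball c r \<times> cbox (- a) a) (\<lambda>(z, y). F' z y * f y)"
      by (auto simp: split_beta intro: continuous_on_subset)
  qed simp
  then show ?thesis by (rule holomorphic_transform) (simp add: eq)
qed

section \<open>The distance to a point of the ray, continued to complex parameters\<close>

text \<open>The squared distance from y to a point of the ray is a real quadratic polynomial in the
  ray parameter, and after division by s^2 it is one in 1/s. A common form covers both uses.
  Positive real part keeps the polynomial off the branch cut, so its principal root is a holomorphic
  distance.\<close>

locale csqrt_quadratic =
  fixes \<alpha> \<beta> \<gamma> :: "'a::euclidean_space \<Rightarrow> real" and r :: real and M :: "'a set"
  assumes cont: "continuous_on UNIV \<alpha>" "continuous_on UNIV \<beta>" "continuous_on UNIV \<gamma>"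
    and pos: "z \<in> ball 0 r \<Longrightarrow> y \<in> M \<Longrightarrow> Re (of_real (\<alpha> y) + of_real (\<beta> y) * z + of_real (\<gamma> y) * z\<^sup>2) > 0"
begin

definition Q :: "complex \<Rightarrow> 'a \<Rightarrow> complex" where
  "Q z y = of_real (\<alpha> y) + of_real (\<beta> y) * z + of_real (\<gamma> y) * z\<^sup>2"

definition W :: "complex \<Rightarrow> 'a \<Rightarrow> complex" where
  "W z y = csqrt (Q z y)"

definition W' :: "complex \<Rightarrow> 'a \<Rightarrow> complex" where
  "W' z y = (of_real (\<beta> y) + of_real (\<gamma> y) * (2 * z)) / (2 * W z y)"

lemma Q_nonpos:
  assumes "z \<in> ball 0 r" "y \<in> M" shows "Q z y \<notin> \<real>\<^sub>\<le>\<^sub>0"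
  using pos[OF assms] unfolding Q_def[symmetric] by (auto simp: complex_nonpos_Reals_iff)

text \<open>The principal root has nonnegative real part, hence 1 + W has real part at least 1; this
  legitimises dividing by 1 + W in the expansion at infinity.\<close>

lemma W_nonzero:
  assumes "z \<in> ball 0 r" "y \<in> M" shows "W z y \<noteq> 0" "1 + W z y \<noteq> 0"
proof -
  show "W z y \<noteq> 0" using Q_nonpos[OF assms] unfolding W_def by auto
  have "Re (W z y) \<ge> 0" unfolding W_def using csqrt_principal[of "Q z y"] by linarith
  then have "Re (1 + W z y) \<noteq> 0" by simp
  then show "1 + W z y \<noteq> 0" by (metis zero_complex.simps(1))
qed

lemma DERIV_W:
  assumes "z \<in> ball 0 r" "y \<in> M"
  shows "((\<lambda>z. W z y) has_field_derivative W' z y) (at z)"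
proof -
  have "((\<lambda>z. Q z y) has_field_derivative (of_real (\<beta> y) + of_real (\<gamma> y) * (2 * z))) (at z)"
    unfolding Q_def by (auto intro!: derivative_eq_intros)
  then show ?thesis unfolding W_def W'_def
    by (rule has_field_derivative_csqrt') (rule Q_nonpos[OF assms])
qed

lemma continuous_on_coeffs:
  "continuous_on T (\<lambda>p. \<alpha> (snd p))" "continuous_on T (\<lambda>p. \<beta> (snd p))" "continuous_on T (\<lambda>p. \<gamma> (snd p))"
  for T :: "(complex \<times> 'a) set"
  by (auto intro!: continuous_on_compose2[OF cont(1)] continuous_on_compose2[OF cont(2)]
      continuous_on_compose2[OF cont(3)] continuous_intros)

lemma continuous_on_W:
  "continuous_on (ball 0 r \<times> M) (\<lambda>p. W (fst p) (snd p))"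
  unfolding W_def
proof (rule continuous_on_compose2[OF continuous_on_csqrt])
  show "continuous_on (ball 0 r \<times> M) (\<lambda>p. Q (fst p) (snd p))"
    unfolding Q_def by (intro continuous_intros continuous_on_coeffs)
  show "(\<lambda>p. Q (fst p) (snd p)) ` (ball 0 r \<times> M) \<subseteq> - \<real>\<^sub>\<le>\<^sub>0"
    using Q_nonpos by auto
qed

lemma continuous_on_W':
  "continuous_on (ball 0 r \<times> M) (\<lambda>p. W' (fst p) (snd p))"
  unfolding W'_def using W_nonzero
  by (intro continuous_intros continuous_on_coeffs continuous_on_W) auto

lemma continuous_on_slice:
  assumes "continuous_on (ball 0 r \<times> M) (\<lambda>p. F (fst p) (snd p))" "z \<in> ball 0 r"
  shows "continuous_on M (F z)"
proof -
  have "continuous_on M ((\<lambda>p. F (fst p) (snd p)) \<circ> (\<lambda>y. (z, y)))"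
    by (intro continuous_on_compose continuous_intros continuous_on_subset[OF assms(1)]) (use assms(2) in auto)
  then show ?thesis by (simp add: o_def)
qed

lemma holomorphic_wave:
  fixes f :: "'a \<Rightarrow> complex"
  assumes f: "continuous_on UNIV f" "\<And>y. norm y > A \<Longrightarrow> f y = 0"
    and N: "open N" "\<And>y. y \<in> N \<Longrightarrow> f y = 0" and M: "open M" "M \<union> N = UNIV"
  shows "(\<lambda>z. integral\<^sup>L lborel (\<lambda>y. exp (\<i> * of_real \<kappa> * W z y) / W z y * f y)) holomorphic_on ball 0 r"
proof -
  define F where "F = (\<lambda>z y. exp (\<i> * of_real \<kappa> * W z y) / W z y)"
  define F' where "F' = (\<lambda>z y. (exp (\<i> * of_real \<kappa> * W z y) * (\<i> * of_real \<kappa> * W' z y) * W z y - exp (\<i> * of_real \<kappa> * W z y) * W' z y) / (W z y * W z y))"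
  have "(\<lambda>z. integral\<^sup>L lborel (\<lambda>y. F z y * f y)) holomorphic_on ball 0 r"
  proof (rule holomorphic_parameter_integral[OF f N M, where F' = F'])
    fix z y assume zy: "z \<in> ball (0::complex) r" "y \<in> M"
    show "((\<lambda>z. F z y) has_field_derivative F' z y) (at z)"
      unfolding F_def F'_def using W_nonzero[OF zy]
      by (auto intro!: derivative_eq_intros DERIV_W[OF zy])
  next
    have "continuous_on (ball 0 r \<times> M) (\<lambda>p. F (fst p) (snd p))"
      unfolding F_def using W_nonzero by (intro continuous_intros continuous_on_W) auto
    then show "continuous_on M (F z)" if "z \<in> ball 0 r" for z
      using that by (rule continuous_on_slice)
    show "continuous_on (ball 0 r \<times> M) (\<lambda>p. F' (fst p) (snd p))"
      unfolding F'_def using W_nonzero by (intro continuous_intros continuous_on_W continuous_on_W') auto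
  qed
  then show ?thesis by (simp add: F_def)
qed

text \<open>When \<open>\<alpha> = 1\<close>, the exponent is \<open>i\<kappa>(W - 1)/z\<close>, written without division by \<open>z\<close>.\<close>

lemma holomorphic_wave_at_infinity:
  fixes f :: "'a \<Rightarrow> complex"
  assumes f: "continuous_on UNIV f" "\<And>y. norm y > A \<Longrightarrow> f y = 0"
    and N: "open N" "\<And>y. y \<in> N \<Longrightarrow> f y = 0" and M: "open M" "M \<union> N = UNIV"
  shows "(\<lambda>z. integral\<^sup>L lborel (\<lambda>y. exp (\<i> * of_real \<kappa> * ((of_real (\<beta> y) + of_real (\<gamma> y) * z) / (1 + W z y))) / W z y * f y))
    holomorphic_on ball 0 r"
proof -
  define E where "E = (\<lambda>z y. (of_real (\<beta> y) + of_real (\<gamma> y) * z) / (1 + W z y))"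
  define E' where "E' = (\<lambda>z y. (of_real (\<gamma> y) * (1 + W z y) - (of_real (\<beta> y) + of_real (\<gamma> y) * z) * W' z y) / ((1 + W z y) * (1 + W z y)))"
  define F where "F = (\<lambda>z y. exp (\<i> * of_real \<kappa> * E z y) / W z y)"
  define F' where "F' = (\<lambda>z y. (exp (\<i> * of_real \<kappa> * E z y) * (\<i> * of_real \<kappa> * E' z y) * W z y - exp (\<i> * of_real \<kappa> * E z y) * W' z y) / (W z y * W z y))"
  have cE: "continuous_on (ball 0 r \<times> M) (\<lambda>p. E (fst p) (snd p))"
    unfolding E_def using W_nonzero by (intro continuous_intros continuous_on_W continuous_on_coeffs) auto
  have cE': "continuous_on (ball 0 r \<times> M) (\<lambda>p. E' (fst p) (snd p))"
    unfolding E'_def using W_nonzero by (intro continuous_intros continuous_on_W continuous_on_W' continuous_on_coeffs) auto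
  have "(\<lambda>z. integral\<^sup>L lborel (\<lambda>y. F z y * f y)) holomorphic_on ball 0 r"
  proof (rule holomorphic_parameter_integral[OF f N M, where F' = F'])
    fix z y assume zy: "z \<in> ball (0::complex) r" "y \<in> M"
    have dE: "((\<lambda>z. E z y) has_field_derivative E' z y) (at z)"
      unfolding E_def E'_def using W_nonzero[OF zy]
      by (auto intro!: derivative_eq_intros DERIV_W[OF zy])
    show "((\<lambda>z. F z y) has_field_derivative F' z y) (at z)"
      unfolding F_def F'_def using W_nonzero[OF zy]
      by (auto intro!: derivative_eq_intros DERIV_W[OF zy] dE)
  next
    have "continuous_on (ball 0 r \<times> M) (\<lambda>p. F (fst p) (snd p))"
      unfolding F_def using W_nonzero by (intro continuous_intros continuous_on_W cE) auto
    then show "continuous_on M (F z)" if "z \<in> ball 0 r" for z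
      using that by (rule continuous_on_slice)
    show "continuous_on (ball 0 r \<times> M) (\<lambda>p. F' (fst p) (snd p))"
      unfolding F'_def using W_nonzero by (intro continuous_intros continuous_on_W continuous_on_W' cE cE') auto
  qed
  then show ?thesis by (simp add: F_def E_def)
qed

end


section \<open>Real-analytic functions on a half-line and rotating phases\<close>

text \<open>Real analyticity at s, encoded by a holomorphic extension to a complex disc so that the
  identity theorem applies directly.\<close>

definition analytic_near :: "(real \<Rightarrow> complex) \<Rightarrow> real \<Rightarrow> bool" where
  "analytic_near u s \<longleftrightarrow> (\<exists>d>0. \<exists>F. F holomorphic_on ball (of_real s) d \<and> (\<forall>t. \<bar>t - s\<bar> < d \<longrightarrow> F (of_real t) = u t))"

text \<open>Schwarz reflection: \<open>cnj (F (cnj z))\<close> is holomorphic and extends the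
  conjugate of u, so (F(z) - cnj (F (cnj z))) / (2 i) extends Im u.\<close>

lemma analytic_near_Im:
  assumes "analytic_near u s"
  shows "analytic_near (\<lambda>t. of_real (Im (u t))) s"
proof -
  obtain d F where d: "d > 0" and F: "F holomorphic_on ball (of_real s) d" "\<And>t. \<bar>t - s\<bar> < d \<Longrightarrow> F (of_real t) = u t"
    using assms unfolding analytic_near_def by blast
  have "cnj ` ball (of_real s) d = ball (of_real s) d"
  proof
    have cb: "cnj z \<in> ball (of_real s) d" if "z \<in> ball (of_real s) d" for z
    proof -
      have "cmod (of_real s - cnj z) = cmod (cnj (of_real s - z))" by simp
      also have "\<dots> = cmod (of_real s - z)" by (rule complex_mod_cnj)
      finally show ?thesis using that by (simp add: dist_norm)
    qed
    then show "cnj ` ball (of_real s) d \<subseteq> ball (of_real s) d" by auto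
    show "ball (of_real s) d \<subseteq> cnj ` ball (of_real s) d"
    proof
      fix z assume "z \<in> ball (complex_of_real s) d"
      then have "cnj (cnj z) \<in> cnj ` ball (of_real s) d" by (intro imageI cb)
      then show "z \<in> cnj ` ball (of_real s) d" by simp
    qed
  qed
  then have "(cnj \<circ> F \<circ> cnj) holomorphic_on ball (of_real s) d"
    using F(1) by (intro holomorphic_on_compose_cnj_cnj) auto
  then have "(\<lambda>z. cnj (F (cnj z))) holomorphic_on ball (of_real s) d" by (simp add: o_def)
  then have "(\<lambda>z. (F z - cnj (F (cnj z))) / (2 * \<i>)) holomorphic_on ball (of_real s) d"
    by (intro holomorphic_intros F(1)) auto
  moreover have "(F (of_real t) - cnj (F (cnj (of_real t)))) / (2 * \<i>) = of_real (Im (u t))" if "\<bar>t - s\<bar> < d" for t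
    using F(2)[OF that] by (simp add: complex_diff_cnj complex_eq_iff)
  ultimately show ?thesis unfolding analytic_near_def using d by blast
qed

text \<open>Near each point the identity theorem leaves two options: u vanishes on a full interval,
  or no nearby point is interior to the zero set. Thus that interior is both open and closed in the
  connected half-line.\<close>

lemma analytic_near_eq_0:
  assumes an: "\<And>s. s > 0 \<Longrightarrow> analytic_near u s"
    and I: "open I" "I \<noteq> {}" "I \<subseteq> {0<..}" "\<And>t. t \<in> I \<Longrightarrow> u t = 0"
    and s: "s > 0"
  shows "u s = 0"
proof -
  define Z where "Z = interior {t. u t = 0}"
  have key: "{s - d<..<s + d} \<subseteq> Z"
    if d: "d > 0" and F: "F holomorphic_on ball (of_real s) d" "\<And>t. \<bar>t - s\<bar> < d \<Longrightarrow> F (of_real t) = u t"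
      and t: "t \<in> Z" "\<bar>t - s\<bar> < d" for s d F t
  proof -
    obtain e where e: "e > 0" "ball t e \<subseteq> {t. u t = 0}"
      using t(1) unfolding Z_def mem_interior by blast
    \<comment> \<open>Small enough that the interval around t lies in the zero set and, embedded in
      the complex plane, inside the disc where F is holomorphic.\<close>
    define e' where "e' = min e (d - \<bar>t - s\<bar>)"
    have e': "e' > 0" "e' \<le> e" "e' \<le> d - \<bar>t - s\<bar>" using e t by (auto simp: e'_def)
    let ?V = "complex_of_real ` ball t e'"
    have inb: "complex_of_real p \<in> ball (of_real s) d" if "\<bar>p - s\<bar> < d" for p
      using that by (simp add: dist_norm of_real_diff[symmetric] abs_minus_commute del: of_real_diff)
    have "F w = 0" if "w \<in> ball (of_real s) d" for w
    proof (rule analytic_continuation[OF F(1), of ?V "of_real t"])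
      show "?V \<subseteq> ball (of_real s) d"
        using e'(3) by (auto intro!: inb simp: dist_real_def)
      show "complex_of_real t \<in> ball (of_real s) d" using t(2) by (rule inb)
      have "t islimpt ball t e'" using e'(1) by (intro interior_limit_point) (simp add: interior_open)
      then show "complex_of_real t islimpt ?V"
        unfolding islimpt_approachable
      proof (intro allI impI)
        fix \<epsilon> :: real
        assume lim: "\<forall>\<epsilon>>0. \<exists>x'\<in>ball t e'. x' \<noteq> t \<and> dist x' t < \<epsilon>" and "\<epsilon> > 0"
        then obtain p where p: "p \<in> ball t e'" "p \<noteq> t" "dist p t < \<epsilon>" by blast
        show "\<exists>x'\<in>?V. x' \<noteq> of_real t \<and> dist x' (of_real t) < \<epsilon>"
          by (rule bexI[OF _ imageI[OF p(1)]]) (simp add: dist_of_real p(2,3))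
      qed
      show "F z = 0" if "z \<in> ?V" for z
      proof -
        obtain p where p': "z = of_real p" "p \<in> ball t e'"
          using \<open>z \<in> ?V\<close> by (rule imageE)
        then have p: "z = of_real p" "dist t p < e'" by simp_all
        have "\<bar>p - s\<bar> < d" "u p = 0" using p e' e(2) by (auto simp: dist_real_def subset_iff)
        then show ?thesis using F(2)[of p] p(1) by simp
      qed
    qed (use that in auto)
    then have "u p = 0" if "\<bar>p - s\<bar> < d" for p
      using F(2)[OF that] inb[OF that] by metis
    then have "{s - d<..<s + d} \<subseteq> {t. u t = 0}" by (auto simp: abs_if)
    then show ?thesis unfolding Z_def by (rule interior_maximal) simp
  qed
  have loc: "\<exists>d>0. {s - d<..<s + d} \<inter> Z = {} \<or> {s - d<..<s + d} \<subseteq> Z" if sp: "s > 0" for s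
  proof -
    obtain d F where d: "d > 0" and F: "F holomorphic_on ball (of_real s) d" "\<And>t. \<bar>t - s\<bar> < d \<Longrightarrow> F (of_real t) = u t"
      using an[OF sp] unfolding analytic_near_def by blast
    have "{s - d<..<s + d} \<subseteq> Z" if ne: "{s - d<..<s + d} \<inter> Z \<noteq> {}"
    proof -
      obtain t where "t \<in> Z" "s - d < t" "t < s + d" using ne by auto
      then show ?thesis using key[OF d F, of t] by (simp add: abs_less_iff)
    qed
    then show ?thesis using d by blast
  qed
  have oZ: "open Z" by (simp add: Z_def)
  have oC: "open ({0<..} - Z)"
    unfolding open_dist
  proof
    fix s assume s: "s \<in> {0<..} - Z"
    then obtain d where d: "d > 0" "{s - d<..<s + d} \<inter> Z = {} \<or> {s - d<..<s + d} \<subseteq> Z" using loc[of s] by auto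
    have "s \<in> {s - d<..<s + d}" using d(1) by simp
    then have dj: "{s - d<..<s + d} \<inter> Z = {}" using d(2) s by blast
    have "\<forall>y. dist y s < min d s \<longrightarrow> y \<in> {0<..} - Z"
      using dj by (auto simp: dist_real_def disjoint_iff abs_less_iff)
    then show "\<exists>e>0. \<forall>y. dist y s < e \<longrightarrow> y \<in> {0<..} - Z" using d(1) s by (intro exI[of _ "min d s"]) auto
  qed
  have "Z \<inter> ({0<..} - Z) \<inter> {0<..} = {}" "{0<..} \<subseteq> Z \<union> ({0<..} - Z)" by auto
  from connectedD[OF connected_Ioi oZ oC this] have "Z \<inter> {0<..} = {} \<or> ({0<..} - Z) \<inter> {0<..} = {}" .
  moreover have "I \<subseteq> Z" unfolding Z_def using I by (intro interior_maximal) auto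
  ultimately have "s \<in> Z" using I s by blast
  then show ?thesis unfolding Z_def using interior_subset by blast
qed

text \<open>If \<open>H(\<tau>) = \<tau>\<^sup>n g(\<tau>)\<close> with \<open>g(0) \<noteq> 0\<close>, the phase of \<open>e\<^sup>i\<^sup>\<kappa>\<^sup>s g(1/s)\<close> keeps rotating as
  \<open>s \<rightarrow> \<infinity>\<close>, so it cannot stay real.\<close>

lemma real_wave_eq_0:
  assumes \<kappa>: "\<kappa> > 0" and H: "H holomorphic_on ball 0 r" "r > 0"
    and real: "\<And>s. s > s0 \<Longrightarrow> Im (exp (\<i> * of_real (\<kappa> * s)) * H (of_real (1 / s))) = 0"
    and z: "z \<in> ball 0 r"
  shows "H z = 0"
proof (rule ccontr)
  assume nz: "H z \<noteq> 0"
  \<comment> \<open>The order of the zero at 0 and the cofactor g. For \<tau> = 1/s > 0 the power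
    \<tau>^n is a positive real and does not affect whether the product is real.\<close>
  define n where "n = nat (zorder H 0)"
  define g where "g = zor_poly H 0"
  have ex: "\<exists>w\<in>ball 0 r. H w \<noteq> 0" using nz z by blast
  have "0 \<in> ball (0::complex) r" using H(2) by simp
  from zorder_exist_zero[OF H(1) open_ball connected_ball this ex, THEN conjunct2, folded g_def n_def]
  obtain q where q: "q > 0" "cball (0::complex) q \<subseteq> ball 0 r" "g holomorphic_on cball 0 q"
      and gw: "\<forall>w\<in>cball 0 q. H w = g w * (w - 0) ^ n \<and> g w \<noteq> 0"
    by (elim exE conjE) (rule that)
  have g: "H w = g w * w ^ n \<and> g w \<noteq> 0" if "w \<in> cball 0 q" for w
    using bspec[OF gw that] by simp
  have gc: "continuous (at 0) g"
    using holomorphic_on_imp_continuous_on[OF q(3)] q(1)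
    by (intro continuous_on_interior[of "cball 0 q"]) auto
  \<comment> \<open>Along parameters at which the phase is frozen at w, the numbers w g(1/X) are
    eventually real; by continuity of g so is w g(0).\<close>
  have lim: "Im (w * g 0) = 0"
    if X: "filterlim X at_top sequentially" and w: "\<And>k. exp (\<i> * of_real (\<kappa> * X k)) = w" for X w
  proof -
    have "(\<lambda>k. 1 / X k) \<longlonglongrightarrow> 0"
      using tendsto_inverse_0_at_top[OF X] by (simp add: inverse_eq_divide)
    then have "(\<lambda>k. complex_of_real (1 / X k)) \<longlonglongrightarrow> of_real 0" by (rule tendsto_of_real)
    then have "(\<lambda>k. g (of_real (1 / X k))) \<longlonglongrightarrow> g 0"
      using isCont_tendsto_compose[OF gc] by simp
    then have "(\<lambda>k. Im (w * g (of_real (1 / X k)))) \<longlonglongrightarrow> Im (w * g 0)"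
      by (intro tendsto_intros)
    moreover have "\<forall>\<^sub>F k in sequentially. Im (w * g (of_real (1 / X k))) = 0"
    proof -
      have "\<forall>\<^sub>F k in sequentially. X k > max (max s0 (1 / q)) 0"
        using X unfolding filterlim_at_top_dense by blast
      then show ?thesis
      proof (rule eventually_mono)
        fix k assume k: "X k > max (max s0 (1 / q)) 0"
        then have Xk: "X k > s0" "1 / q < X k" "X k > 0" by auto
        have "1 / X k \<le> q" using Xk q(1) by (simp add: field_simps)
        then have "complex_of_real (1 / X k) \<in> cball 0 q"
          using Xk(3) by (simp add: norm_divide)
        then have "H (of_real (1 / X k)) = of_real ((1 / X k) ^ n) * g (of_real (1 / X k))"
          using g by (simp add: mult.commute)
        then have "0 = Im (of_real ((1 / X k) ^ n) * (w * g (of_real (1 / X k))))"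
          using real[OF Xk(1)] unfolding w by (simp add: mult.left_commute)
        also have "\<dots> = (1 / X k) ^ n * Im (w * g (of_real (1 / X k)))"
          by (simp only: Im_complex_of_real Re_complex_of_real times_complex.sel mult_zero_left add_0_right)
        finally show "Im (w * g (of_real (1 / X k))) = 0" using Xk(3) by simp
      qed
    qed
    ultimately have "(\<lambda>k. 0) \<longlonglongrightarrow> Im (w * g 0)" by (rule Lim_transform_eventually)
    then show ?thesis by (simp add: LIMSEQ_const_iff)
  qed
  have pk: "filterlim (\<lambda>k. 2 * pi * real k / \<kappa> + c) at_top sequentially" for c
    using \<kappa> by real_asymp
  have turn: "exp (2 * of_int n * of_real pi * \<i>) = 1" for n
    using exp_integer_2pi[OF Ints_of_int, of n] by simp
  have quarter: "exp (of_real (pi / 2) * \<i>) = \<i>"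
    using cis_conv_exp[of "pi / 2"] cis_pi_half by (simp only: mult.commute)
  \<comment> \<open>Phase 1 shows that g(0) is real. A quarter turn later, phase i shows that i g(0)
    is real too, which forces g(0) = 0.\<close>
  have "Im (1 * g 0) = 0"
  proof (rule lim[OF pk[of 0]])
    fix k
    have "\<i> * complex_of_real (\<kappa> * (2 * pi * real k / \<kappa> + 0)) = 2 * of_int (int k) * of_real pi * \<i>"
      using \<kappa> by simp
    then show "exp (\<i> * complex_of_real (\<kappa> * (2 * pi * real k / \<kappa> + 0))) = 1"
      by (simp only: turn)
  qed
  moreover have "Im (\<i> * g 0) = 0"
  proof (rule lim[OF pk[of "pi / 2 / \<kappa>"]])
    fix k
    have "\<i> * complex_of_real (\<kappa> * (2 * pi * real k / \<kappa> + pi / 2 / \<kappa>)) = 2 * of_int (int k) * of_real pi * \<i> + of_real (pi / 2) * \<i>"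
      using \<kappa> by (simp add: field_simps)
    then show "exp (\<i> * complex_of_real (\<kappa> * (2 * pi * real k / \<kappa> + pi / 2 / \<kappa>))) = \<i>"
      by (simp only: exp_add turn quarter mult_1)
  qed
  ultimately have "g 0 = 0" by (simp add: complex_eq_iff)
  then show False using g[of 0] q(1) by simp
qed

lemma helm_csqrt:
  assumes "q = (of_real d)\<^sup>2" "d > 0"
  shows "exp (\<i> * of_real \<kappa> * csqrt q) / csqrt q = helm \<kappa> d"
proof -
  have "csqrt q = of_real d" unfolding assms(1) by (rule csqrt_square) (use assms(2) in simp)
  then show ?thesis by (simp add: helm_def mult.assoc)
qed

section \<open>Continuation along the ray and to its point at infinity\<close>

text \<open>With the source in a shell around a = x0 + s \<theta>, the squared distance from y to a
  + z \<theta> is |y - a|^2 - 2 z \<theta> . (y - a) + z^2, and this polynomial may be continued to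
  small complex z.\<close>

lemma analytic_near_ray:
  fixes \<psi> :: "real^3 \<Rightarrow> complex"
  assumes \<kappa>: "\<kappa> > 0" and \<psi>: "C2_data U \<psi> \<psi>1 \<psi>2" "\<And>x. x \<in> U \<Longrightarrow> helmholtz \<kappa> \<psi> \<psi>2 x = 0"
    and U: "open U" and \<theta>: "norm \<theta> = 1" and s: "x0 + s *\<^sub>R \<theta> \<in> U"
  shows "analytic_near (\<lambda>s. \<psi> (x0 + s *\<^sub>R \<theta>)) s"
proof -
  define a where "a = x0 + s *\<^sub>R \<theta>"
  obtain d where d: "d > 0" "cball a (2 * d) \<subseteq> U"
  proof -
    obtain e where "e > 0" "cball a e \<subseteq> U"
      using U s unfolding a_def open_contains_cball by blast
    then show ?thesis by (intro that[of "e / 2"]) auto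
  qed
  obtain f where f: "continuous_on UNIV f" "\<And>y. norm (y - a) < d \<Longrightarrow> f y = 0" "\<And>y. norm (y - a) > 2 * d \<Longrightarrow> f y = 0"
    and rep: "\<And>x. norm (x - a) < d \<Longrightarrow> \<psi> x = integral\<^sup>L lborel (\<lambda>y. helm \<kappa> (norm (y - x)) * f y)"
    using local_representation[OF \<kappa> \<psi> U d(2,1)] by blast
  define \<alpha> \<beta> \<gamma> where "\<alpha> = (\<lambda>y. (y - a) \<bullet> (y - a))" and "\<beta> = (\<lambda>y. - 2 * (\<theta> \<bullet> (y - a)))" and "\<gamma> = (\<lambda>y::real^3. 1::real)"
  \<comment> \<open>The radius d / 2 lies below the radius d of the source-free ball, so these two
    open sets cover the space.\<close>
  define M where "M = {y. norm (y - a) > d / 2}"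
  \<comment> \<open>On M the distance m = |y - a| exceeds d / 2, and |z| < d / 8 gives |z| < m / 4.
    The perturbation is then at most m^2 / 2 + m^2 / 16, less than m^2.\<close>
  interpret csqrt_quadratic \<alpha> \<beta> \<gamma> "d / 8" M
  proof
    show "continuous_on UNIV \<alpha>" "continuous_on UNIV \<beta>" "continuous_on UNIV \<gamma>"
      unfolding \<alpha>_def \<beta>_def \<gamma>_def by (intro continuous_intros)+
    fix z :: complex and y assume z: "z \<in> ball 0 (d / 8)" and y: "y \<in> M"
    define m where "m = norm (y - a)"
    have m: "m > 4 * norm z" "m > 0" using z y d(1) unfolding M_def m_def by auto
    have "\<bar>\<theta> \<bullet> (y - a)\<bar> \<le> norm \<theta> * norm (y - a)" by (rule Cauchy_Schwarz_ineq2)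
    then have "norm (of_real (\<beta> y) * z) \<le> 2 * m * norm z"
      unfolding \<beta>_def m_def \<theta> norm_mult by (intro mult_right_mono) (auto simp: abs_mult)
    also have "\<dots> \<le> 2 * m * (m / 4)" using m by (intro mult_left_mono) auto
    finally have 1: "norm (of_real (\<beta> y) * z) \<le> m\<^sup>2 / 2" by (simp add: power2_eq_square)
    have "norm (of_real (\<gamma> y) * z\<^sup>2) = (norm z)\<^sup>2" by (simp add: \<gamma>_def norm_power)
    also have "\<dots> \<le> (m / 4)\<^sup>2" using m by (intro power_mono) auto
    finally have 2: "norm (of_real (\<gamma> y) * z\<^sup>2) \<le> m\<^sup>2 / 16" by (simp add: power2_eq_square)
    have "\<alpha> y = m\<^sup>2" by (simp add: \<alpha>_def m_def dot_square_norm)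
    moreover have "m\<^sup>2 > 0" using m(2) by simp
    ultimately show "Re (of_real (\<alpha> y) + of_real (\<beta> y) * z + of_real (\<gamma> y) * z\<^sup>2) > 0"
      using 1 2 abs_Re_le_cmod[of "of_real (\<beta> y) * z"] abs_Re_le_cmod[of "of_real (\<gamma> y) * z\<^sup>2"]
      unfolding plus_complex.sel Re_complex_of_real by linarith
  qed
  define N where "N = {y. norm (y - a) < d}"
  define G where "G = (\<lambda>z. integral\<^sup>L lborel (\<lambda>y. exp (\<i> * of_real \<kappa> * W z y) / W z y * f y))"
  have G: "G holomorphic_on ball 0 (d / 8)"
    unfolding G_def
  proof (rule holomorphic_wave[where A = "norm a + 2 * d" and N = N])
    show "f y = 0" if "norm a + 2 * d < norm y" for y
      using norm_triangle_ineq2[of y a] that by (intro f(3)) linarith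
    show "open N" "open M" unfolding N_def M_def
      by (auto intro!: open_Collect_less continuous_intros)
    show "M \<union> N = UNIV" using d(1) unfolding M_def N_def by auto
  qed (use f(1,2) in \<open>auto simp: N_def\<close>)
  have eq: "G (of_real t) = \<psi> (a + t *\<^sub>R \<theta>)" if t: "\<bar>t\<bar> < d / 8" for t
  proof -
    \<comment> \<open>Inside the source-free ball both sides vanish with \<open>f\<close>; outside
      it the distance is positive, hence equal to the principal root of its square.\<close>
    have "exp (\<i> * of_real \<kappa> * W (of_real t) y) / W (of_real t) y * f y = helm \<kappa> (norm (y - (a + t *\<^sub>R \<theta>))) * f y" for y
    proof (cases "norm (y - a) < d")
      case False
      have "norm (y - a) \<le> norm (y - (a + t *\<^sub>R \<theta>)) + norm (t *\<^sub>R \<theta>)"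
        using norm_triangle_ineq[of "y - (a + t *\<^sub>R \<theta>)" "t *\<^sub>R \<theta>"] by simp
      then have p: "norm (y - (a + t *\<^sub>R \<theta>)) > 0" using False t d(1) unfolding norm_scaleR \<theta> by linarith
      have "(y - (a + t *\<^sub>R \<theta>)) \<bullet> (y - (a + t *\<^sub>R \<theta>)) = \<alpha> y + \<beta> y * t + \<gamma> y * t\<^sup>2"
        using \<theta> unfolding \<alpha>_def \<beta>_def \<gamma>_def
        by (simp add: algebra_simps inner_commute power2_eq_square norm_eq_1)
      then have "Q (of_real t) y = (of_real (norm (y - (a + t *\<^sub>R \<theta>))))\<^sup>2"
        unfolding Q_def dot_square_norm of_real_power[symmetric] by simp
      from helm_csqrt[OF this p] show ?thesis unfolding W_def by simp
    qed (simp add: f(2))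
    moreover have "norm (a + t *\<^sub>R \<theta> - a) < d" using t \<theta> d(1) by simp
    ultimately show ?thesis unfolding G_def by (simp add: rep)
  qed
  define F where "F = (\<lambda>z. G (z - of_real s))"
  have "F holomorphic_on ball (of_real s) (d / 8)"
    unfolding F_def
    by (rule holomorphic_on_compose_gen[OF _ G, unfolded o_def]) (auto intro!: holomorphic_intros simp: dist_norm norm_minus_commute)
  moreover have "F (of_real t) = \<psi> (x0 + t *\<^sub>R \<theta>)" if "\<bar>t - s\<bar> < d / 8" for t
    using eq[OF that] by (simp add: F_def a_def algebra_simps)
  ultimately show ?thesis unfolding analytic_near_def using d(1) by (intro exI[of _ "d / 8"]) auto
qed

text \<open>Put z = 1/s. The distance D from y to x0 + s \<theta> is s W(z) with W(z)^2 = 1 +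
  \<beta> z + \<gamma> z^2. The growing phase e^(i \<kappa> s) factors out, and the remainder D - s
  = (W - 1) / z = (\<beta> + \<gamma> z) / (1 + W) is regular at z = 0.\<close>

lemma ray_expansion_at_infinity:
  fixes \<psi> :: "real^3 \<Rightarrow> complex"
  assumes \<kappa>: "\<kappa> > 0" and \<psi>: "C2_data U \<psi> \<psi>1 \<psi>2" "\<And>x. x \<in> U \<Longrightarrow> helmholtz \<kappa> \<psi> \<psi>2 x = 0" "radiating \<kappa> \<psi> \<psi>1"
    and U: "open U" and R: "\<And>y. norm y \<ge> R \<Longrightarrow> y \<in> U" "R > 0" and \<theta>: "norm \<theta> = 1"
  obtains H r s0 where "H holomorphic_on ball 0 r" "r > 0" "s0 > 0"
    "\<And>s. s > s0 \<Longrightarrow> of_real (1 / s) \<in> ball (0::complex) r"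
    "\<And>s. s > s0 \<Longrightarrow> \<psi> (x0 + s *\<^sub>R \<theta>) = of_real (1 / s) * (exp (\<i> * of_real (\<kappa> * s)) * H (of_real (1 / s)))"
proof -
  obtain f where f: "continuous_on UNIV f" "\<And>y. norm y > 2 * R \<Longrightarrow> f y = 0"
    and rep: "\<And>x. norm x > 2 * R \<Longrightarrow> \<psi> x = integral\<^sup>L lborel (\<lambda>y. helm \<kappa> (norm (y - x)) * f y)"
    using exterior_representation[OF \<kappa> \<psi> U R] by blast
  \<comment> \<open>An upper bound for |y - x0| on M. With |z| < 1 / (4 m) the linear term is at
    most 1/2 and the quadratic one at most 1/16, both measured against the constant term 1.\<close>
  define m where "m = 2 * R + 1 + norm x0"
  have m: "m > 0" unfolding m_def using R(2) by (simp add: add_pos_nonneg)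
  define r where "r = 1 / (4 * m)"
  have r: "r > 0" using m by (simp add: r_def)
  define \<alpha> \<beta> \<gamma> where "\<alpha> = (\<lambda>y::real^3. 1::real)" and "\<beta> = (\<lambda>y. - 2 * (\<theta> \<bullet> (y - x0)))" and "\<gamma> = (\<lambda>y. (y - x0) \<bullet> (y - x0))"
  \<comment> \<open>The extra 1 makes this open ball overlap the open set |y| > 2 R, where the
    source vanishes.\<close>
  define M where "M = ball (0::real^3) (2 * R + 1)"
  interpret csqrt_quadratic \<alpha> \<beta> \<gamma> r M
  proof
    show "continuous_on UNIV \<alpha>" "continuous_on UNIV \<beta>" "continuous_on UNIV \<gamma>"
      unfolding \<alpha>_def \<beta>_def \<gamma>_def by (intro continuous_intros)+
    fix z :: complex and y assume z: "z \<in> ball 0 r" and y: "y \<in> M"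
    have nz: "norm z \<le> 1 / (4 * m)" using z by (simp add: r_def)
    have ym: "norm (y - x0) \<le> m" using norm_triangle_ineq4[of y x0] y unfolding M_def m_def by simp
    have "\<bar>\<theta> \<bullet> (y - x0)\<bar> \<le> norm \<theta> * norm (y - x0)" by (rule Cauchy_Schwarz_ineq2)
    then have "\<bar>\<theta> \<bullet> (y - x0)\<bar> \<le> m" using ym \<theta> by simp
    then have "norm (of_real (\<beta> y) * z) \<le> 2 * m * (1 / (4 * m))"
      unfolding \<beta>_def norm_mult using nz m by (intro mult_mono) (auto simp: abs_mult)
    then have 1: "norm (of_real (\<beta> y) * z) \<le> 1 / 2" using m by simp
    have "\<gamma> y \<le> m\<^sup>2" "0 \<le> \<gamma> y" using ym unfolding \<gamma>_def dot_square_norm by (auto intro: power_mono)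
    moreover have "(norm z)\<^sup>2 \<le> (1 / (4 * m))\<^sup>2" using nz by (intro power_mono) auto
    ultimately have "\<gamma> y * (norm z)\<^sup>2 \<le> m\<^sup>2 * (1 / (4 * m))\<^sup>2" by (intro mult_mono) auto
    also have "m\<^sup>2 * (1 / (4 * m))\<^sup>2 = 1 / 16" using m by (simp add: field_simps power2_eq_square)
    finally have 2: "norm (of_real (\<gamma> y) * z\<^sup>2) \<le> 1 / 16"
      using \<open>0 \<le> \<gamma> y\<close> by (simp add: norm_mult norm_power)
    show "Re (of_real (\<alpha> y) + of_real (\<beta> y) * z + of_real (\<gamma> y) * z\<^sup>2) > 0"
      using 1 2 abs_Re_le_cmod[of "of_real (\<beta> y) * z"] abs_Re_le_cmod[of "of_real (\<gamma> y) * z\<^sup>2"]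
      unfolding plus_complex.sel Re_complex_of_real \<alpha>_def by linarith
  qed
  define H where "H = (\<lambda>z. integral\<^sup>L lborel (\<lambda>y. exp (\<i> * of_real \<kappa> * ((of_real (\<beta> y) + of_real (\<gamma> y) * z) / (1 + W z y))) / W z y * f y))"
  have H: "H holomorphic_on ball 0 r"
    unfolding H_def
  proof (rule holomorphic_wave_at_infinity[OF f, where N = "- cball 0 (2 * R)"])
    show "open M" "M \<union> - cball 0 (2 * R) = UNIV" unfolding M_def by auto
  qed (auto simp: f(2) open_Compl)
  \<comment> \<open>Beyond 1 / r the point 1/s lies in the disc of holomorphy; beyond 2 R + |x0| the
    point of the ray lies where the exterior representation holds.\<close>
  define s0 where "s0 = max (1 / r) (2 * R + norm x0)"
  have s0: "s0 > 0" using r by (simp add: s0_def less_max_iff_disj)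
  have inb: "complex_of_real (1 / s) \<in> ball 0 r" if s: "s > s0" for s
  proof -
    have "1 / r < s" "s > 0" using s s0 unfolding s0_def by auto
    then have "1 / s < r" using r by (simp add: field_simps)
    then show ?thesis using \<open>s > 0\<close> by (simp add: norm_divide)
  qed
  have main: "\<psi> (x0 + s *\<^sub>R \<theta>) = of_real (1 / s) * (exp (\<i> * of_real (\<kappa> * s)) * H (of_real (1 / s)))" if s: "s > s0" for s
  proof -
    have sp: "s > 0" "s > 2 * R + norm x0" using s s0 unfolding s0_def by auto
    have "s - norm x0 \<le> norm (x0 + s *\<^sub>R \<theta>)"
      using norm_triangle_ineq2[of "s *\<^sub>R \<theta>" "- x0"] sp(1) \<theta> by (simp add: add.commute)
    then have far: "norm (x0 + s *\<^sub>R \<theta>) > 2 * R" using sp(2) by linarith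
    let ?\<tau> = "complex_of_real (1 / s)"
    have pt: "helm \<kappa> (norm (y - (x0 + s *\<^sub>R \<theta>))) * f y = (?\<tau> * exp (\<i> * of_real (\<kappa> * s))) *
        (exp (\<i> * of_real \<kappa> * ((of_real (\<beta> y) + of_real (\<gamma> y) * ?\<tau>) / (1 + W ?\<tau> y))) / W ?\<tau> y * f y)" for y
    proof (cases "norm y > 2 * R")
      case False
      then have yM: "y \<in> M" unfolding M_def by simp
      define D where "D = norm (y - (x0 + s *\<^sub>R \<theta>))"
      have "norm (x0 + s *\<^sub>R \<theta>) \<le> D + norm y"
        unfolding D_def using norm_triangle_ineq2[of "x0 + s *\<^sub>R \<theta>" y] by (simp add: norm_minus_commute)
      then have Dp: "D > 0" using far False by linarith
      have "(y - (x0 + s *\<^sub>R \<theta>)) \<bullet> (y - (x0 + s *\<^sub>R \<theta>)) = s\<^sup>2 + \<beta> y * s + \<gamma> y"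
        using \<theta> unfolding \<beta>_def \<gamma>_def
        by (simp add: algebra_simps inner_commute power2_eq_square norm_eq_1)
      then have D2: "D\<^sup>2 = s\<^sup>2 + \<beta> y * s + \<gamma> y" unfolding D_def dot_square_norm .
      have "\<alpha> y + \<beta> y * (1 / s) + \<gamma> y * (1 / s)\<^sup>2 = (D / s)\<^sup>2"
        unfolding power_divide D2 \<alpha>_def using sp(1) by (simp add: field_simps power2_eq_square)
      then have "complex_of_real (\<alpha> y + \<beta> y * (1 / s) + \<gamma> y * (1 / s)\<^sup>2) = of_real ((D / s)\<^sup>2)" by (simp only:)
      then have "Q ?\<tau> y = (of_real (D / s))\<^sup>2"
        unfolding Q_def by (simp only: of_real_add of_real_mult of_real_power)
      then have W: "W ?\<tau> y = of_real (D / s)"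
        unfolding W_def using Dp sp(1) by (simp add: csqrt_square del: of_real_divide)
      \<comment> \<open>From (D - s)(D + s) = \<beta> s + \<gamma>: rationalising the difference D -
        s removes the division by 1/s.\<close>
      have "s + (\<beta> y + \<gamma> y * (1 / s)) / (1 + D / s) = D"
      proof -
        have "(D - s) * (D + s) = \<beta> y * s + \<gamma> y" using D2 by (simp add: algebra_simps power2_eq_square)
        moreover have "(\<beta> y + \<gamma> y * (1 / s)) / (1 + D / s) = (\<beta> y * s + \<gamma> y) / (D + s)"
        proof -
          have "\<beta> y + \<gamma> y * (1 / s) = (\<beta> y * s + \<gamma> y) / s" "1 + D / s = (D + s) / s"
            using sp(1) by (simp_all add: field_simps)
          then show ?thesis using sp(1) by simp
        qed
        moreover have "D + s \<noteq> 0" using sp(1) Dp by simp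
        ultimately have "(\<beta> y + \<gamma> y * (1 / s)) / (1 + D / s) = D - s"
          by (simp add: nonzero_divide_eq_eq)
        then show ?thesis by simp
      qed
      then have "complex_of_real (s + (\<beta> y + \<gamma> y * (1 / s)) / (1 + D / s)) = of_real D" by (simp only:)
      then have "of_real s + (of_real (\<beta> y) + of_real (\<gamma> y) * ?\<tau>) / (1 + W ?\<tau> y) = complex_of_real D"
        unfolding W by (simp only: of_real_add of_real_divide of_real_mult of_real_1)
      then have "exp (\<i> * of_real (\<kappa> * s)) * exp (\<i> * of_real \<kappa> * ((of_real (\<beta> y) + of_real (\<gamma> y) * ?\<tau>) / (1 + W ?\<tau> y)))
          = exp (\<i> * of_real (\<kappa> * D))"
        by (simp only: exp_add[symmetric] of_real_mult mult.assoc[symmetric] distrib_left[symmetric])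
      moreover have "helm \<kappa> D = ?\<tau> * exp (\<i> * of_real (\<kappa> * D)) / W ?\<tau> y"
        unfolding W helm_def using sp(1) Dp by simp
      ultimately show ?thesis unfolding D_def[symmetric] by (simp add: mult.assoc)
    qed (simp add: f(2))
    show ?thesis unfolding H_def rep[OF far] pt integral_mult_right_zero by (rule mult.assoc)
  qed
  show ?thesis by (rule that[OF H r s0 inb main])
qed

theorem theorem1:
  fixes \<kappa> :: real and U :: "(real^3) set" and \<psi>\<^sub>1 \<psi>\<^sub>2 :: "real^3 \<Rightarrow> complex"
    and x\<^sub>0 \<theta> :: "real^3" and \<Lambda> :: "(real^3) set"
  assumes "\<kappa> > 0"
    and "exterior_region U"
    and "radiation_solution \<kappa> U \<psi>\<^sub>1"
    and "radiation_solution \<kappa> U \<psi>\<^sub>2"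
    and "\<theta> \<in> sphere 0 1"
    and "ray x\<^sub>0 \<theta> \<subseteq> U"
    and "open_interval_of_ray x\<^sub>0 \<theta> \<Lambda>"
    and "\<Lambda> \<noteq> {}"
    and "\<forall>x\<in>\<Lambda>. Im (\<psi>\<^sub>1 x) = Im (\<psi>\<^sub>2 x)"
  shows "\<forall>x\<in>ray x\<^sub>0 \<theta>. \<psi>\<^sub>1 x = \<psi>\<^sub>2 x"
proof -
  note \<kappa> = assms(1)
  have \<theta>: "norm \<theta> = 1" using assms(5) by simp
  obtain S where S: "bounded S" "U = outside S" and U: "open U"
    using assms(2) unfolding exterior_region_def by blast
  \<comment> \<open>The outside of a bounded set has bounded complement, so U contains everything
    beyond some radius.\<close>
  obtain R where R: "\<And>y. norm y \<ge> R \<Longrightarrow> y \<in> U" "R > 0"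
  proof -
    obtain B where B: "B > 0" "\<forall>y\<in>- U. norm y \<le> B"
      using cobounded_outside[OF S(1)] unfolding S(2) bounded_pos by blast
    show ?thesis by (rule that[of "B + 1"]) (use B in force)+
  qed
  obtain a1 a2 where a: "C2_data U \<psi>\<^sub>1 a1 a2" "\<And>x. x \<in> U \<Longrightarrow> helmholtz \<kappa> \<psi>\<^sub>1 a2 x = 0" "radiating \<kappa> \<psi>\<^sub>1 a1"
    using radiation_solution_data[OF assms(3) U R(1)] by blast
  obtain b1 b2 where b: "C2_data U \<psi>\<^sub>2 b1 b2" "\<And>x. x \<in> U \<Longrightarrow> helmholtz \<kappa> \<psi>\<^sub>2 b2 x = 0" "radiating \<kappa> \<psi>\<^sub>2 b1"
    using radiation_solution_data[OF assms(4) U R(1)] by blast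
  define \<psi> where "\<psi> = (\<lambda>x. \<psi>\<^sub>1 x - \<psi>\<^sub>2 x)"
  define u where "u = (\<lambda>s. \<psi> (x\<^sub>0 + s *\<^sub>R \<theta>))"
  have data: "C2_data U \<psi> (\<lambda>b x. a1 b x - b1 b x) (\<lambda>b x. a2 b x - b2 b x)"
    unfolding \<psi>_def by (rule C2_data_diff[OF a(1) b(1)])
  have helm: "helmholtz \<kappa> \<psi> (\<lambda>b x. a2 b x - b2 b x) x = 0" if "x \<in> U" for x
    unfolding \<psi>_def helmholtz_diff using a(2) b(2) that by simp
  have rad: "radiating \<kappa> \<psi> (\<lambda>b x. a1 b x - b1 b x)"
    unfolding \<psi>_def by (rule radiating_diff[OF a(3) b(3)])
  have an: "analytic_near u s" if "s > 0" for s
  proof -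
    have "x\<^sub>0 + s *\<^sub>R \<theta> \<in> U" using assms(6) that unfolding ray_def by blast
    then show ?thesis
      unfolding u_def using analytic_near_ray[OF \<kappa> data helm U \<theta>, of x\<^sub>0 s] by simp
  qed
  obtain I where I: "I \<subseteq> {0<..}" "open I" "\<Lambda> = (\<lambda>s. x\<^sub>0 + s *\<^sub>R \<theta>) ` I"
    using assms(7) unfolding open_interval_of_ray_def by blast
  \<comment> \<open>The identity theorem is applied to Im u, which is itself real analytic, starting
    from the given interval.\<close>
  have Im0: "Im (u s) = 0" if "s > 0" for s
  proof -
    have "(of_real (Im (u s)) :: complex) = 0"
    proof (rule analytic_near_eq_0[where u = "\<lambda>t. of_real (Im (u t))" and I = I])
      show "analytic_near (\<lambda>t. of_real (Im (u t))) s" if "s > 0" for s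
        by (rule analytic_near_Im[OF an[OF that]])
      show "complex_of_real (Im (u t)) = 0" if "t \<in> I" for t
        using assms(9) that unfolding I(3) u_def \<psi>_def by simp
    qed (use I assms(8) that in auto)
    then show ?thesis by simp
  qed
  obtain H r s0 where H: "H holomorphic_on ball 0 r" "r > 0" "s0 > 0"
    and inb: "\<And>s. s > s0 \<Longrightarrow> of_real (1 / s) \<in> ball (0::complex) r"
    and uH: "\<And>s. s > s0 \<Longrightarrow> u s = of_real (1 / s) * (exp (\<i> * of_real (\<kappa> * s)) * H (of_real (1 / s)))"
    unfolding u_def using ray_expansion_at_infinity[OF \<kappa> data helm rad U R \<theta>, of x\<^sub>0] by blast
  have wave: "Im (exp (\<i> * of_real (\<kappa> * s)) * H (of_real (1 / s))) = 0" if "s > s0" for s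
  proof -
    have "0 = (1 / s) * Im (exp (\<i> * of_real (\<kappa> * s)) * H (of_real (1 / s)))"
      using Im0[of s] that H(3) unfolding uH[OF that] by (simp only: Im_complex_of_real Re_complex_of_real times_complex.sel) simp
    then show ?thesis using that H(3) by simp
  qed
  have far: "u s = 0" if "s > s0" for s
  proof -
    have "H (of_real (1 / s)) = 0"
      by (rule real_wave_eq_0[OF \<kappa> H(1,2) _ inb[OF that], of s0]) (rule wave)
    then show ?thesis unfolding uH[OF that] by simp
  qed
  \<comment> \<open>A second use of the identity theorem, now for u itself and starting from the far
    interval s > s0, carries the vanishing back to the whole ray.\<close>
  have "u s = 0" if "s > 0" for s
  proof (rule analytic_near_eq_0[OF an])
    show "open {s0<..}" "{s0<..} \<noteq> {}" "{s0<..} \<subseteq> {0<..}" using H(3) by auto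
  qed (use far that in auto)
  then show ?thesis unfolding ray_def u_def \<psi>_def by auto
qed

end
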